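(* For every measure of non-orientability $\eta$, every positive integer $n$ and all partitions $\mu,\nu\vdash n$, \[ \sum_{\tau\vdash n}h^\tau_{\mu,\nu}(\beta)=\sum_{\tau\vdash n}(H_\eta)^\tau_{\mu,\nu}(\beta),\qquad (H_\eta)^\tau_{\mu,\nu}(\beta):=\sum_{M\in\widetilde{\mathcal M}^\tau_{\mu,\nu}}\beta^{\eta(M)}. \]
   Context: Jack polynomials: $\langle p_\lambda,p_\mu\rangle_\alpha=z_\lambda\alpha^{\ell(\lambda)}\delta_{\lambda,\mu}$ ($z_\lambda=\prod_i i^{m_i(\lambda)}m_i(\lambda)!$); $J^{(\alpha)}_\lambda$ is the unique symmetric function over $\mathbb{Q}(\alpha)$ with $J_\lambda=\sum_{\mu\le\lambda}a^\lambda_\mu m_\mu$ (dominance order), coefficient of $m_{1^{|\lambda|}}$ equal to $|\lambda|!$, and pairwise $\langle\cdot,\cdot\rangle_\alpha$-orthogonal. With $\beta=\alpha-1$, $h^\tau_{\mu,\nu}(\beta)$ is defined by $\alpha t\partial_t\log\big(\sum_\lambda J_\lambda(\mathbf x)J_\lambda(\mathbf y)J_\lambda(\mathbf z)t^{|\lambda|}/\langle J_\lambda,J_\lambda\rangle_\alpha\big)=\sum_{n\ge1}t^n\sum_{\mu,\nu,\tau\vdash n}h^\tau_{\mu,\nu}(\alpha-1)p_\mu(\mathbf x)p_\nu(\mathbf y)p_\tau(\mathbf z)$. Maps: a map is a connected graph embedded in a compact connected surface without boundary (orientable or not) with simply connected faces; maps are bipartite (black/white vertices, edges join different colours) and rooted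 (a corner with an orientation; root vertex black). Type $(\mu,\nu;\tau)$: black vertex degrees $\mu$, white vertex degrees $\nu$, face degrees divided by 2 $\tau$; $\widetilde{\mathcal M}^\tau_{\mu,\nu}$ is the set of such maps on all surfaces. Root deletion: for root edge $e$, $M\setminus\{e\}$ is one or two maps rooted as follows: the root corner of $M$ lies in a unique corner of $M\setminus\{e\}$, the root corner (inherited orientation) of its component; if two components, the first corner of the root face of $M$ after the root corner lies in a unique corner of the other component, which becomes its root corner. $e$ is a bridge if $M\setminus\{e\}$ is disconnected; otherwise a border, twisted, or handle according as $M\setminus\{e\}$ has one fewer, the same, or one more face. If $e$ is a handle, twisting $e$ (reconnecting its half-edges the other way, keeping them in the same corners) gives a unique $M'\ne M$ with handle root edge $e'$, $M\setminus\{e\}=M'\setminus\{e'\}$. A measure of non-orientability is a function $\eta$ from rooted maps to nonnegative integers with: $\eta=0$ on edgeless maps; bridge: $\eta(M)=\eta(M_1)+\eta(M_2)$ with $M\setminus\{e\}=M_1\cup M_2$; border: $\eta(M)=\eta(M\setminus\{e\})$; twisted: $\eta(M)=\eta(M\setminus\{e\})+1$; handle: $\{\eta(M),\eta(M')\}=\{\eta(M\setminus\{e\}),\eta(M\setminus\{e\})+1\}$ (and if one of $M,M'$ is orientable, its value is $0$, the other's $1$). *)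

theory Defs
  imports
    "HOL-Library.Multiset"
    "HOL-Library.Poly_Mapping"
    "HOL-Library.Product_Plus"
    "HOL-Computational_Algebra.Computational_Algebra"
begin

section \<open>Partitions\<close>

text \<open>An integer partition is the multiset of its parts.\<close>

definition partitions :: "nat \<Rightarrow> nat multiset set" where
  "partitions n = {\<mu>. 0 \<notin># \<mu> \<and> sum_mset \<mu> = n}"

definition z_part :: "nat multiset \<Rightarrow> nat" where
  "z_part \<mu> = (\<Prod>i\<in>set_mset \<mu>. i ^ count \<mu> i * fact (count \<mu> i))"

definition largest_sum :: "nat \<Rightarrow> nat multiset \<Rightarrow> nat" where
  "largest_sum k \<mu> = sum_list (take k (rev (sorted_list_of_multiset \<mu>)))"

definition dominance_le :: "nat multiset \<Rightarrow> nat multiset \<Rightarrow> bool" where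
  "dominance_le \<mu> \<rho> \<longleftrightarrow>
     sum_mset \<mu> = sum_mset \<rho> \<and> (\<forall>k. largest_sum k \<mu> \<le> largest_sum k \<rho>)"

section \<open>Symmetric functions over the field of rational functions in \<open>\<alpha>\<close>\<close>

type_synonym scalar = "rat poly fract"

definition jack_alpha :: scalar where
  "jack_alpha = to_fract [:0, 1:]"

text \<open>
  Formal power series in the variables \<open>x\<^sub>0, x\<^sub>1, \<dots>\<close>, given by the coefficient of each monomial.
\<close>

type_synonym series = "(nat \<Rightarrow>\<^sub>0 nat) \<Rightarrow> scalar"

definition series_one :: series where
  "series_one e = (if e = 0 then 1 else 0)"

definition series_times :: "series \<Rightarrow> series \<Rightarrow> series" where
  "series_times f g e = (\<Sum>(a, b) \<in> {(a, b). a + b = e}. f a * g b)"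

definition power_sum :: "nat \<Rightarrow> series" where
  "power_sum k e = (if \<exists>i. e = Poly_Mapping.single i k then 1 else 0)"

definition power_sum_part :: "nat multiset \<Rightarrow> series" where
  "power_sum_part \<mu> =
     foldr series_times (map power_sum (sorted_list_of_multiset \<mu>)) series_one"

definition exponents :: "(nat \<Rightarrow>\<^sub>0 nat) \<Rightarrow> nat multiset" where
  "exponents e = image_mset (Poly_Mapping.lookup e) (mset_set (Poly_Mapping.keys e))"

definition monomial_sym :: "nat multiset \<Rightarrow> series" where
  "monomial_sym \<mu> e = (if exponents e = \<mu> then 1 else 0)"

text \<open>
  Over a field of characteristic 0 the ring of symmetric functions is the polynomial ring in the
  power sums \<open>p\<^sub>1, p\<^sub>2, \<dots>\<close>. The element \<open>\<Sum>\<^sub>\<lambda> c\<^sub>\<lambda> p\<^sub>\<lambda>\<close> is represented by \<open>\<lambda> \<mapsto> c\<^sub>\<lambda>\<close>; since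
  \<open>p\<^sub>\<lambda> p\<^sub>\<mu> = p\<close> of the union of \<open>\<lambda>\<close> and \<open>\<mu>\<close>, the product is the convolution product of \<open>\<Rightarrow>\<^sub>0\<close>.
  The actual symmetric function is recovered by \<open>expand\<close>. Multisets containing 0 are not
  partitions and have to be excluded.
\<close>

type_synonym symfun = "nat multiset \<Rightarrow>\<^sub>0 scalar"

definition symmetric_functions :: "symfun set" where
  "symmetric_functions = {f. \<forall>\<mu>\<in>Poly_Mapping.keys f. 0 \<notin># \<mu>}"

definition expand :: "symfun \<Rightarrow> series" where
  "expand f e = (\<Sum>\<mu>\<in>Poly_Mapping.keys f. Poly_Mapping.lookup f \<mu> * power_sum_part \<mu> e)"

text \<open>The bilinear form with \<open>\<langle>p\<^sub>\<lambda>, p\<^sub>\<mu>\<rangle> = z\<^sub>\<lambda> \<alpha>\<close> to the power \<open>\<ell>(\<lambda>)\<close> if \<open>\<lambda> = \<mu>\<close>, and 0 otherwise.\<close>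

definition jack_inner :: "symfun \<Rightarrow> symfun \<Rightarrow> scalar" where
  "jack_inner f g =
     (\<Sum>\<mu>\<in>Poly_Mapping.keys f.
        Poly_Mapping.lookup f \<mu> * Poly_Mapping.lookup g \<mu> *
          (of_nat (z_part \<mu>) * jack_alpha ^ size \<mu>))"

text \<open>
  The characterization that determines the Jack symmetric functions \<open>J\<^sub>\<lambda>\<close> uniquely
  (for partitions \<open>\<lambda>\<close>; the values of \<open>J\<close> at multisets containing 0 are irrelevant).
\<close>

definition is_jack_family :: "(nat multiset \<Rightarrow> symfun) \<Rightarrow> bool" where
  "is_jack_family J \<longleftrightarrow>
     (\<forall>n. \<forall>\<rho>\<in>partitions n.
        J \<rho> \<in> symmetric_functions \<and>
        (\<exists>a. (\<forall>e. expand (J \<rho>) e =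
                   (\<Sum>\<mu>\<in>{\<mu>\<in>partitions n. dominance_le \<mu> \<rho>}. a \<mu> * monomial_sym \<mu> e)) \<and>
             a (replicate_mset n 1) = fact n)) \<and>
     (\<forall>m n. \<forall>\<rho>\<in>partitions m. \<forall>\<mu>\<in>partitions n. \<rho> \<noteq> \<mu> \<longrightarrow> jack_inner (J \<rho>) (J \<mu>) = 0)"

section \<open>The coefficients \<open>h\<close>\<close>

text \<open>
  Polynomials in the power sums of three alphabets: the key \<open>(\<mu>, \<nu>, \<tau>)\<close> stands for
  \<open>p\<^sub>\<mu>(x) p\<^sub>\<nu>(y) p\<^sub>\<tau>(z)\<close>.
\<close>

type_synonym symfun3 = "(nat multiset \<times> nat multiset \<times> nat multiset) \<Rightarrow>\<^sub>0 scalar"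

definition tensor3 :: "symfun \<Rightarrow> symfun \<Rightarrow> symfun \<Rightarrow> symfun3" where
  "tensor3 f g h =
     (\<Sum>\<mu>\<in>Poly_Mapping.keys f. \<Sum>\<nu>\<in>Poly_Mapping.keys g. \<Sum>\<tau>\<in>Poly_Mapping.keys h.
        Poly_Mapping.single (\<mu>, \<nu>, \<tau>)
          (Poly_Mapping.lookup f \<mu> * Poly_Mapping.lookup g \<nu> * Poly_Mapping.lookup h \<tau>))"

definition const3 :: "scalar \<Rightarrow> symfun3" where
  "const3 c = Poly_Mapping.single 0 c"

text \<open>
  The series \<open>log F = \<Sum>\<^sub>k (-1)\<close> to the \<open>k+1\<close> times \<open>(F - 1)\<close> to the \<open>k\<close> over \<open>k\<close>, for \<open>F\<close> with constant
  term 1; the summands with \<open>k > n\<close> do not contribute to the coefficient of \<open>t\<close> to the \<open>n\<close>.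
\<close>

definition formal_log :: "symfun3 fps \<Rightarrow> symfun3 fps" where
  "formal_log F =
     Abs_fps (\<lambda>n. \<Sum>k = 1..n. const3 ((-1) ^ (k + 1) / of_nat k) * fps_nth ((F - 1) ^ k) n)"

definition jack_series :: "(nat multiset \<Rightarrow> symfun) \<Rightarrow> symfun3 fps" where
  "jack_series J =
     Abs_fps (\<lambda>n. \<Sum>\<rho>\<in>partitions n.
       const3 (1 / jack_inner (J \<rho>) (J \<rho>)) * tensor3 (J \<rho>) (J \<rho>) (J \<rho>))"

definition h_series :: "(nat multiset \<Rightarrow> symfun) \<Rightarrow> symfun3 fps" where
  "h_series J =
     fps_const (const3 jack_alpha) * (fps_X * fps_deriv (formal_log (jack_series J)))"

text \<open>\<open>h_coeff J \<mu> \<nu> \<tau>\<close>, for partitions of the same integer, has \<open>\<tau>\<close> as the upper index of \<open>h\<close>.\<close>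

definition h_coeff ::
  "(nat multiset \<Rightarrow> symfun) \<Rightarrow> nat multiset \<Rightarrow> nat multiset \<Rightarrow> nat multiset \<Rightarrow> scalar" where
  "h_coeff J \<mu> \<nu> \<tau> = Poly_Mapping.lookup (fps_nth (h_series J) (sum_mset \<tau>)) (\<mu>, \<nu>, \<tau>)"

section \<open>Rooted bipartite maps\<close>

text \<open>
  A map on a compact surface without boundary, orientable or not, is encoded in the standard way
  by its flags. An edge consists of two half-edges, each of which has two sides; a flag is a side
  of a half-edge, so there are four flags for each edge. There are three involutions without
  fixed points:
  \<^item> \<open>side\<close> leads to the other side of the same half-edge;
  \<^item> \<open>far\<close> leads along the same side of the edge to its other end;
  \<^item> \<open>corner\<close> leads across the corner at the vertex that is adjacent to the flag.

  Vertices are the orbits of \<open>side\<close> and \<open>corner\<close>, edges those of \<open>side\<close> and \<open>far\<close>, and faces those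
  of \<open>far\<close> and \<open>corner\<close>. A corner is a pair \<open>{x, corner x}\<close>; the corner with the orientation from
  \<open>corner x\<close> to \<open>x\<close> is encoded by the flag \<open>x\<close>. The walk along the face that starts in this
  direction continues along the edge of \<open>x\<close>, which is the root edge if \<open>x\<close> is the root.

  The empty set of flags encodes the map with a single vertex on the sphere.
\<close>

record flag_map =
  flags :: "nat set"
  side :: "nat \<Rightarrow> nat"
  far :: "nat \<Rightarrow> nat"
  corner :: "nat \<Rightarrow> nat"
  root :: nat

definition free_involution :: "nat set \<Rightarrow> (nat \<Rightarrow> nat) \<Rightarrow> bool" where
  "free_involution A f \<longleftrightarrow> (\<forall>x\<in>A. f x \<in> A \<and> f x \<noteq> x \<and> f (f x) = x)"

text \<open>
  One step between flags at the same vertex, or between the two ends of an edge outside \<open>E\<close>.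
\<close>

definition steps_avoiding :: "nat set \<Rightarrow> flag_map \<Rightarrow> (nat \<times> nat) set" where
  "steps_avoiding E M =
     {(x, y). x \<in> flags M \<and> (y = side M x \<or> y = corner M x \<or> (x \<notin> E \<and> y = far M x))}"

definition connected_avoiding :: "nat set \<Rightarrow> flag_map \<Rightarrow> bool" where
  "connected_avoiding E M \<longleftrightarrow>
     (\<forall>x\<in>flags M. \<forall>y\<in>flags M. (x, y) \<in> (steps_avoiding E M)\<^sup>*)"

definition vertex_colouring :: "flag_map \<Rightarrow> (nat \<Rightarrow> bool) \<Rightarrow> bool" where
  "vertex_colouring M c \<longleftrightarrow>
     (\<forall>x\<in>flags M. c (side M x) = c x \<and> c (corner M x) = c x \<and> c (far M x) = (\<not> c x))"

definition bipartite_map :: "flag_map \<Rightarrow> bool" where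
  "bipartite_map M \<longleftrightarrow>
     finite (flags M) \<and>
     free_involution (flags M) (side M) \<and>
     free_involution (flags M) (far M) \<and>
     free_involution (flags M) (corner M) \<and>
     (\<forall>x\<in>flags M. side M (far M x) = far M (side M x) \<and> side M (far M x) \<noteq> x) \<and>
     connected_avoiding {} M \<and>
     (\<exists>c. vertex_colouring M c) \<and>
     (flags M \<noteq> {} \<longrightarrow> root M \<in> flags M)"

definition flag_iso :: "(nat \<Rightarrow> nat) \<Rightarrow> flag_map \<Rightarrow> flag_map \<Rightarrow> bool" where
  "flag_iso f M N \<longleftrightarrow>
     bij_betw f (flags M) (flags N) \<and>
     (\<forall>x\<in>flags M. f (side M x) = side N (f x) \<and> f (far M x) = far N (f x) \<and>
                   f (corner M x) = corner N (f x)) \<and>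
     (flags M \<noteq> {} \<longrightarrow> f (root M) = root N)"

definition map_iso :: "flag_map \<Rightarrow> flag_map \<Rightarrow> bool" where
  "map_iso M N \<longleftrightarrow> bipartite_map M \<and> bipartite_map N \<and> (\<exists>f. flag_iso f M N)"

lemma flag_iso_inverse:
  assumes wf: "bipartite_map M" and iso: "flag_iso f M N"
  shows "flag_iso (the_inv_into (flags M) f) N M"
proof -
  let ?g = "the_inv_into (flags M) f"
  have f: "bij_betw f (flags M) (flags N)" using iso by (simp add: flag_iso_def)
  have hom: "f (side M x) = side N (f x)" "f (far M x) = far N (f x)"
    "f (corner M x) = corner N (f x)" if "x \<in> flags M" for x
    using iso that by (simp_all add: flag_iso_def)
  have inj: "inj_on f (flags M)" using f by (rule bij_betw_imp_inj_on)
  have img: "f ` flags M = flags N" using f by (rule bij_betw_imp_surj_on)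
  have gf: "?g (f x) = x" if "x \<in> flags M" for x
    using inj that by (rule the_inv_into_f_f)
  have closed: "side M x \<in> flags M" "far M x \<in> flags M" "corner M x \<in> flags M"
    if "x \<in> flags M" for x
    using wf that by (simp_all add: bipartite_map_def free_involution_def)
  have "?g (side N y) = side M (?g y) \<and> ?g (far N y) = far M (?g y) \<and>
        ?g (corner N y) = corner M (?g y)" if "y \<in> flags N" for y
  proof -
    from that img have "y \<in> f ` flags M" by simp
    then obtain x where x: "y = f x" "x \<in> flags M" by (rule imageE)
    show ?thesis
      unfolding x(1) hom[OF x(2), symmetric] by (simp add: gf closed x(2))
  qed
  moreover have "?g (root N) = root M" if "flags N \<noteq> {}"
  proof -
    have ne: "flags M \<noteq> {}" using img that by force
    then have "root M \<in> flags M" using wf by (simp add: bipartite_map_def)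
    moreover have "root N = f (root M)" using iso ne by (simp add: flag_iso_def)
    ultimately show ?thesis using gf by simp
  qed
  ultimately show ?thesis
    using bij_betw_the_inv_into[OF f] by (simp add: flag_iso_def)
qed

lemma flag_iso_compose:
  assumes f: "flag_iso f L M" and g: "flag_iso g M N"
  shows "flag_iso (g \<circ> f) L N"
proof -
  have bf: "bij_betw f (flags L) (flags M)" using f by (simp add: flag_iso_def)
  have bg: "bij_betw g (flags M) (flags N)" using g by (simp add: flag_iso_def)
  have "f x \<in> flags M" if "x \<in> flags L" for x
    using bf that by (rule bij_betwE[THEN bspec])
  moreover from this have "flags M \<noteq> {}" if "flags L \<noteq> {}" using that by force
  ultimately show ?thesis
    using f g bij_betw_trans[OF bf bg] by (simp add: flag_iso_def)
qed

text \<open>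
  The two colours of a connected bipartite map are determined by the root vertex being black, so
  they are not part of the data. Recolouring a component of \<open>M\<close> minus an edge that is rooted at a
  formerly white vertex is therefore implicit.
\<close>

quotient_type rooted_map = flag_map / partial: map_iso
proof (rule part_equivpI)
  let ?E = "\<lparr>flags = {}, side = id, far = id, corner = id, root = 0\<rparr>"
  have "map_iso ?E ?E"
    by (simp add: map_iso_def flag_iso_def bipartite_map_def free_involution_def
        connected_avoiding_def vertex_colouring_def bij_betw_def)
  then show "\<exists>M. map_iso M M" by (rule exI)
  show "symp map_iso"
    by (rule sympI) (auto simp: map_iso_def intro: flag_iso_inverse)
  show "transp map_iso"
    by (rule transpI) (auto simp: map_iso_def intro: flag_iso_compose)
qed

definition orbit :: "(nat \<Rightarrow> nat) \<Rightarrow> (nat \<Rightarrow> nat) \<Rightarrow> nat \<Rightarrow> nat set" where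
  "orbit f g x = {(y, z). z = f y \<or> z = g y}\<^sup>* `` {x}"

definition vertex_of :: "flag_map \<Rightarrow> nat \<Rightarrow> nat set" where
  "vertex_of M = orbit (side M) (corner M)"

definition face_of :: "flag_map \<Rightarrow> nat \<Rightarrow> nat set" where
  "face_of M = orbit (far M) (corner M)"

definition num_faces :: "flag_map \<Rightarrow> nat" where
  "num_faces M = (if flags M = {} then 1 else card (face_of M ` flags M))"

definition orientable_map :: "flag_map \<Rightarrow> bool" where
  "orientable_map M \<longleftrightarrow>
     (\<exists>s :: nat \<Rightarrow> bool. \<forall>x\<in>flags M.
        s (side M x) = (\<not> s x) \<and> s (far M x) = (\<not> s x) \<and> s (corner M x) = (\<not> s x))"

text \<open>
  The type \<open>(\<mu>, \<nu>; \<tau>)\<close> of a map with at least one edge. A vertex of degree \<open>d\<close> has \<open>2d\<close> flags; a face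
  of degree \<open>2d\<close> has \<open>4d\<close> flags and contributes the part \<open>d\<close>.
\<close>

definition has_type ::
  "flag_map \<Rightarrow> nat multiset \<Rightarrow> nat multiset \<Rightarrow> nat multiset \<Rightarrow> bool" where
  "has_type M \<mu> \<nu> \<tau> \<longleftrightarrow>
     flags M \<noteq> {} \<and>
     (\<exists>black. vertex_colouring M black \<and> black (root M) \<and>
        \<mu> = image_mset (\<lambda>V. card V div 2) (mset_set (vertex_of M ` {x \<in> flags M. black x})) \<and>
        \<nu> = image_mset (\<lambda>V. card V div 2) (mset_set (vertex_of M ` {x \<in> flags M. \<not> black x}))) \<and>
     \<tau> = image_mset (\<lambda>F. card F div 4) (mset_set (face_of M ` flags M))"

definition maps_of_type ::
  "nat multiset \<Rightarrow> nat multiset \<Rightarrow> nat multiset \<Rightarrow> rooted_map set" where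
  "maps_of_type \<mu> \<nu> \<tau> = abs_rooted_map ` {M. bipartite_map M \<and> has_type M \<mu> \<nu> \<tau>}"

section \<open>Root deletion and measures of non-orientability\<close>

definition root_edge :: "flag_map \<Rightarrow> nat set" where
  "root_edge M = {root M, side M (root M), far M (root M), side M (far M (root M))}"

text \<open>
  The \<open>corner\<close> involution after the root edge is deleted. As a bipartite map has no loops, a corner
  of the remaining map contains at most one half-edge of the root edge.
\<close>

definition corner_deleted :: "flag_map \<Rightarrow> nat \<Rightarrow> nat" where
  "corner_deleted M x =
     (let y = corner M x in if y \<in> root_edge M then corner M (side M y) else y)"

text \<open>
  The component of \<open>M\<close> minus its root edge that contains the vertex of the flag \<open>x\<close>, rooted at \<open>r\<close>.
  In \<open>steps_avoiding\<close> the flags of the root edge still represent its end vertices, so a component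
  that is a single vertex is obtained with the empty set of flags (and then \<open>r\<close> is irrelevant).
\<close>

definition deletion_component :: "flag_map \<Rightarrow> nat \<Rightarrow> nat \<Rightarrow> flag_map" where
  "deletion_component M x r =
     \<lparr>flags = (steps_avoiding (root_edge M) M)\<^sup>* `` {x} - root_edge M,
      side = side M, far = far M, corner = corner_deleted M, root = r\<rparr>"

text \<open>
  The root corner of \<open>M\<close>, oriented from \<open>corner M (root M)\<close> to \<open>root M\<close>, becomes part of the corner
  oriented from \<open>corner M (root M)\<close> to \<open>corner M (side M (root M))\<close>.
\<close>

definition root_component :: "flag_map \<Rightarrow> flag_map" where
  "root_component M = deletion_component M (root M) (corner M (side M (root M)))"

text \<open>
  The first corner of the root face after the root corner is the one from \<open>far M (root M)\<close> to
  \<open>corner M (far M (root M))\<close>.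
\<close>

definition other_component :: "flag_map \<Rightarrow> flag_map" where
  "other_component M = deletion_component M (far M (root M)) (corner M (far M (root M)))"

definition root_bridge :: "flag_map \<Rightarrow> bool" where
  "root_bridge M \<longleftrightarrow> \<not> connected_avoiding (root_edge M) M"

text \<open>If the root edge is not a bridge, then \<open>root_component M\<close> is all of \<open>M\<close> minus the root edge.\<close>

definition root_border :: "flag_map \<Rightarrow> bool" where
  "root_border M \<longleftrightarrow> \<not> root_bridge M \<and> num_faces (root_component M) + 1 = num_faces M"

definition root_twisted :: "flag_map \<Rightarrow> bool" where
  "root_twisted M \<longleftrightarrow> \<not> root_bridge M \<and> num_faces (root_component M) = num_faces M"

definition root_handle :: "flag_map \<Rightarrow> bool" where
  "root_handle M \<longleftrightarrow> \<not> root_bridge M \<and> num_faces (root_component M) = num_faces M + 1"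

definition twist_root :: "flag_map \<Rightarrow> flag_map" where
  "twist_root M =
     M\<lparr>far := (\<lambda>x. if x \<in> root_edge M then side M (far M x) else far M x)\<rparr>"

definition measure_of_non_orientability :: "(rooted_map \<Rightarrow> nat) \<Rightarrow> bool" where
  "measure_of_non_orientability \<eta> \<longleftrightarrow>
     (\<forall>M. bipartite_map M \<longrightarrow>
        (if flags M = {} then \<eta> (abs_rooted_map M) = 0
         else
           (let m = \<eta> (abs_rooted_map M);
                d = \<eta> (abs_rooted_map (root_component M));
                m' = \<eta> (abs_rooted_map (twist_root M))
            in (root_bridge M \<longrightarrow> m = d + \<eta> (abs_rooted_map (other_component M))) \<and>
               (root_border M \<longrightarrow> m = d) \<and>
               (root_twisted M \<longrightarrow> m = d + 1) \<and>
               (root_handle M \<longrightarrow>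
                  {m, m'} = {d, d + 1} \<and>
                  (orientable_map M \<longrightarrow> m = 0 \<and> m' = 1) \<and>
                  (orientable_map (twist_root M) \<longrightarrow> m' = 0 \<and> m = 1)))))"

definition H_coeff ::
  "(rooted_map \<Rightarrow> nat) \<Rightarrow> nat multiset \<Rightarrow> nat multiset \<Rightarrow> nat multiset \<Rightarrow> scalar \<Rightarrow> scalar" where
  "H_coeff \<eta> \<mu> \<nu> \<tau> \<beta> = (\<Sum>M\<in>maps_of_type \<mu> \<nu> \<tau>. \<beta> ^ \<eta> M)"

end

(*
  Write w_i(mu, nu) for the generating function of the rooted maps whose root vertex has degree i
  and whose other black and white vertices have degrees mu and nu. Deleting the root edge either
  splits the map into two rooted maps or leaves one; in the second case the map M and its twist
  have the same deletion M', and always {eta(M), eta(twist M)} = {eta(M'), eta(M') + 1}, because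
  among M, its twist and M' exactly one has one face more than the other two. Together they
  contribute the factor 1 + beta = alpha, whatever eta is. In the resulting recursion for w_i the
  corners of the white vertices are counted by the derivation sum_j alpha j q_(j+1) d/dq_j, and its
  solution is w_i Psi = V_i, where V_i is explicit and Psi = V_0 is the sum over n of
  n! alpha^n g_n(x) g_n(y), with g_n = sum_mu p_mu / (z_mu alpha^(length mu)).

  On the other side, setting z = (1, 0, 0, ...) replaces each p_tau(z) by 1 and kills J_rho(z) unless
  rho has at most one part, so that the series of triple products becomes Psi as well. Both sums
  over tau are therefore the unique solution H of H Psi = alpha n Psi in degree n.
*)
theory Submission
  imports Defs "HOL-Library.Function_Algebras"
begin

section \<open>Orbits of two involutions\<close>

text \<open>Twisting keeps the vertex degrees but may change the face degrees, so only after summing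
  over \<tau> do M and its twist always occur together. The claim about faces concerns four loose
  ends. Cutting the root edge out of the face walks leaves two paths, whose ends pair up four
  points. M, its twist and its deletion close these paths by the three perfect matchings of the four
  points; the matching that agrees with the paths makes two cycles, the other two make one. Rooted
  maps have no nontrivial automorphisms, so the flags of a representative can be counted; the two
  flags of a white corner yield a map and its twist. Put w_i = V_i / Psi and U = V_1 / Psi, and let
  L be the derivation. The recursion w_(i+1) = w_i U + L w_i then becomes V_(i+1) = L V_i + q_1 V_i,
  a consequence of Euler's identity for g_n. As U is built from all w_j with the colours exchanged,
  the induction runs over the total degree. Psi arises from the Jack functions because g_n
  represents evaluation at (1, 0, 0, ...) under the inner product; it is thus orthogonal to every
  J_rho except the one with rho = (n).\<close>

lemma free_involutionD:
  assumes "free_involution A f" "x \<in> A"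
  shows "f x \<in> A" "f x \<noteq> x" "f (f x) = x"
  using assms by (auto simp: free_involution_def)

lemma free_involution_bij_betw:
  assumes "free_involution A f"
  shows "bij_betw f A A"
  using assms by (intro bij_betw_byWitness[where f' = f]) (auto simp: free_involution_def)

lemma free_involution_Diff:
  assumes "free_involution A f" "\<And>x. x \<in> B \<Longrightarrow> f x \<in> B"
  shows "free_involution (A - B) f"
  using assms unfolding free_involution_def by (metis Diff_iff)

lemma even_card_free_involution:
  assumes "finite A" "free_involution A f"
  shows "even (card A)"
  using assms
proof (induction "card A" arbitrary: A rule: less_induct)
  case less
  show ?case
  proof (cases "A = {}")
    case False
    then obtain x where x: "x \<in> A" by blast
    note fx = free_involutionD[OF less.prems(2) x]
    have "free_involution (A - {x, f x}) f"
      using less.prems(2) by (rule free_involution_Diff) (use fx in auto)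
    moreover have c: "card A = card (A - {x, f x}) + 2"
      using less.prems(1) x fx by (subst card_Diff_subset) (auto simp: card_Diff_subset
          intro!: le_add_diff_inverse2[symmetric] dest!: card_mono[of A "{x, f x}"])
    ultimately have "even (card (A - {x, f x}))"
      using less.prems(1) by (intro less.hyps) auto
    then show ?thesis using c by simp
  qed simp
qed

lemma orbit_self: "x \<in> orbit f g x"
  by (simp add: orbit_def)

lemma orbit_step:
  assumes "y \<in> orbit f g x"
  shows "f y \<in> orbit f g x" "g y \<in> orbit f g x"
  using assms by (auto simp: orbit_def intro: rtrancl_into_rtrancl)

lemma orbit_subset:
  assumes "x \<in> B" "\<And>y. y \<in> B \<Longrightarrow> f y \<in> B" "\<And>y. y \<in> B \<Longrightarrow> g y \<in> B"
  shows "orbit f g x \<subseteq> B"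
proof
  fix z assume "z \<in> orbit f g x"
  then have "(x, z) \<in> {(y, z). z = f y \<or> z = g y}\<^sup>*" by (simp add: orbit_def)
  then show "z \<in> B" by (induction rule: rtrancl_induct) (use assms in auto)
qed

lemma orbit_subset_orbit: "y \<in> orbit f g x \<Longrightarrow> orbit f g y \<subseteq> orbit f g x"
  by (rule orbit_subset) (auto intro: orbit_step)

lemma orbit_in:
  assumes "free_involution A f" "free_involution A g" "x \<in> A"
  shows "orbit f g x \<subseteq> A"
  using assms by (intro orbit_subset) (auto simp: free_involution_def)

text \<open>\<open>orbit\<close> is defined by forward steps only. On a set where both maps are
  involutions every step can be undone, so reachability is symmetric.\<close>

lemma orbit_eq:
  assumes "free_involution A f" "free_involution A g" "x \<in> A" "y \<in> orbit f g x"
  shows "orbit f g y = orbit f g x"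
proof
  show "orbit f g y \<subseteq> orbit f g x"
    using assms(4) by (rule orbit_subset_orbit)
  let ?B = "{z \<in> A. x \<in> orbit f g z}"
  have step: "orbit f g z \<subseteq> orbit f g (f z)" "orbit f g z \<subseteq> orbit f g (g z)" if "z \<in> A" for z
  proof -
    have "f (f z) \<in> orbit f g (f z)" "g (g z) \<in> orbit f g (g z)"
      by (auto intro: orbit_step orbit_self)
    then have "z \<in> orbit f g (f z)" "z \<in> orbit f g (g z)"
      using that assms(1,2) by (auto simp: free_involution_def)
    then show "orbit f g z \<subseteq> orbit f g (f z)" "orbit f g z \<subseteq> orbit f g (g z)"
      by (auto dest: orbit_subset_orbit)
  qed
  have "orbit f g x \<subseteq> ?B"
  proof (rule orbit_subset)
    show "x \<in> ?B" using assms(3) by (simp add: orbit_self)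
    show "f z \<in> ?B" "g z \<in> ?B" if "z \<in> ?B" for z
      using that step[of z] assms(1,2) by (auto simp: free_involution_def)
  qed
  then have "x \<in> orbit f g y" using assms(4) by blast
  then show "orbit f g x \<subseteq> orbit f g y" by (rule orbit_subset_orbit)
qed

lemma orbit_cong:
  assumes "x \<in> A" "\<And>y. y \<in> A \<Longrightarrow> f y \<in> A \<and> g y \<in> A"
    "\<And>y. y \<in> A \<Longrightarrow> f' y = f y" "\<And>y. y \<in> A \<Longrightarrow> g' y = g y"
  shows "orbit f' g' x = orbit f g x"
proof
  have 1: "orbit f g x \<subseteq> A" using assms(1,2) by (intro orbit_subset) auto
  have 2: "orbit f' g' x \<subseteq> A" using assms by (intro orbit_subset) auto
  show "orbit f' g' x \<subseteq> orbit f g x"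
  proof (rule orbit_subset[OF orbit_self])
    fix y assume y: "y \<in> orbit f g x"
    then have "y \<in> A" using 1 by blast
    then show "f' y \<in> orbit f g x" "g' y \<in> orbit f g x"
      using orbit_step[OF y] assms(3,4) by auto
  qed
  show "orbit f g x \<subseteq> orbit f' g' x"
  proof (rule orbit_subset[OF orbit_self])
    fix y assume y: "y \<in> orbit f' g' x"
    then have "y \<in> A" using 2 by blast
    then show "f y \<in> orbit f' g' x" "g y \<in> orbit f' g' x"
      using orbit_step[OF y] assms(3,4) by auto
  qed
qed

text \<open>
  \<open>shortcut E g c\<close> removes the points of \<open>E\<close> from the chains formed by \<open>c\<close> and \<open>g\<close>: a point that
  \<open>c\<close> links to \<open>e \<in> E\<close> gets linked to the point beyond \<open>g e\<close>.
\<close>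

definition shortcut :: "nat set \<Rightarrow> (nat \<Rightarrow> nat) \<Rightarrow> (nat \<Rightarrow> nat) \<Rightarrow> nat \<Rightarrow> nat" where
  "shortcut E g c x = (if c x \<in> E then c (g (c x)) else c x)"

text \<open>If the chain stayed in \<open>E\<close> beyond \<open>g e\<close>, the hypothesis on
  \<open>E\<close> would give \<open>c (g e) = e\<close>, hence \<open>c e = g e\<close> in
  \<open>E\<close>. So a chain leaves \<open>E\<close> again after a single pair \<open>e\<close>,
  \<open>g e\<close>, and one detour suffices in \<open>shortcut\<close>.\<close>

lemma shortcut_not_in:
  assumes "free_involution A g" "free_involution A c" "E \<subseteq> A" "\<And>e. e \<in> E \<Longrightarrow> g e \<in> E"
    and "\<And>e. e \<in> E \<Longrightarrow> c e \<in> E \<Longrightarrow> c e = g e" and "e \<in> E" "c e \<notin> E"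
  shows "c (g e) \<notin> E"
proof
  assume *: "c (g e) \<in> E"
  have "c (g e) = g (g e)" using assms(4,5,6) * by blast
  then have "c (g e) = e" using assms(1,3,6) by (auto simp: free_involution_def)
  then have "c e = g e" using assms(1-4,6) by (metis free_involutionD(1,3) subsetD)
  then show False using assms(4,6,7) by auto
qed

text \<open>A detour through \<open>e\<close> and \<open>g e\<close>, read backwards, is the detour
  that starts at its other end.\<close>

lemma free_involution_shortcut:
  assumes "free_involution A g" "free_involution A c" "E \<subseteq> A" "\<And>e. e \<in> E \<Longrightarrow> g e \<in> E"
    and "\<And>e. e \<in> E \<Longrightarrow> c e \<in> E \<Longrightarrow> c e = g e"
  shows "free_involution (A - E) (shortcut E g c)"
  unfolding free_involution_def
proof
  fix x assume x: "x \<in> A - E"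
  note c = free_involutionD[OF assms(2)] and g = free_involutionD[OF assms(1)]
  show "shortcut E g c x \<in> A - E \<and> shortcut E g c x \<noteq> x \<and>
        shortcut E g c (shortcut E g c x) = x"
  proof (cases "c x \<in> E")
    case True
    let ?e = "c x"
    have e: "?e \<in> A" "g ?e \<in> E" "g ?e \<in> A" "c ?e = x" using True assms(3,4) x c by auto
    have out: "c (g ?e) \<notin> E"
      by (rule shortcut_not_in[OF assms True]) (use e x in auto)
    have s: "shortcut E g c x = c (g ?e)" using True by (simp add: shortcut_def)
    have "c (g ?e) \<noteq> x"
    proof
      assume "c (g ?e) = x"
      then have "c (c (g ?e)) = c x" by simp
      then have "g ?e = ?e" using c(3)[OF e(3)] by simp
      then show False using g(2)[OF e(1)] by simp
    qed
    moreover have "shortcut E g c (c (g ?e)) = x"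
      using e c(3)[OF e(3)] g(3)[OF e(1)] by (simp add: shortcut_def)
    ultimately show ?thesis using s out c(1)[OF e(3)] by simp
  next
    case False
    then show ?thesis using x c by (auto simp: shortcut_def)
  qed
qed

text \<open>Translates sets closed for the shortened chains into sets closed for the original ones,
  by adding the points of \<open>E\<close> that border on \<open>B\<close>. It serves both for
  comparing orbits and for the connectedness of a map after deletion.\<close>

lemma shortcut_closure:
  assumes "free_involution A g" "free_involution A c" "E \<subseteq> A" "\<And>e. e \<in> E \<Longrightarrow> g e \<in> E"
    and B: "B \<subseteq> A - E" "\<And>x. x \<in> B \<Longrightarrow> g x \<in> B" "\<And>x. x \<in> B \<Longrightarrow> shortcut E g c x \<in> B"
    and y: "y \<in> B \<union> {e \<in> E. c e \<in> B \<or> c (g e) \<in> B}"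
  shows "g y \<in> B \<union> {e \<in> E. c e \<in> B \<or> c (g e) \<in> B}" (is "_ \<in> ?B")
    and "c y \<in> B \<union> {e \<in> E. c e \<in> B \<or> c (g e) \<in> B}"
proof -
  note ci = free_involutionD[OF assms(2)] and gi = free_involutionD[OF assms(1)]
  show "g y \<in> ?B"
  proof (cases "y \<in> B")
    case False
    then have "y \<in> E" "c y \<in> B \<or> c (g y) \<in> B" using y by auto
    moreover have "g (g y) = y" using \<open>y \<in> E\<close> assms(3) gi by auto
    ultimately show ?thesis using assms(4) by auto
  qed (use B(2) in simp)
  show "c y \<in> ?B"
  proof (cases "y \<in> B")
    case True
    then have yA: "y \<in> A - E" using B(1) by blast
    show ?thesis
    proof (cases "c y \<in> E")
      case True
      then show ?thesis using ci(3)[of y] yA \<open>y \<in> B\<close> by auto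
    next
      case False
      then have "c y = shortcut E g c y" by (simp add: shortcut_def)
      then show ?thesis using B(3)[OF \<open>y \<in> B\<close>] by auto
    qed
  next
    case False
    then have yE: "y \<in> E" "c y \<in> B \<or> c (g y) \<in> B" using y by auto
    have yA: "y \<in> A" "g y \<in> E" "g y \<in> A" using yE assms(3,4) by auto
    have "c y \<in> B"
    proof (cases "c y \<in> B")
      case False
      then have 1: "c (g y) \<in> B" using yE by blast
      have 2: "c (c (g y)) = g y" using ci(3) yA by simp
      have "shortcut E g c (c (g y)) = c (g (g y))" using 2 yA by (simp add: shortcut_def)
      then have "shortcut E g c (c (g y)) = c y" using gi(3) yA by simp
      then show ?thesis using B(3)[OF 1] by simp
    qed
    then show ?thesis by blast
  qed
qed

lemma orbit_shortcut:
  assumes "free_involution A g" "free_involution A c" "E \<subseteq> A" "\<And>e. e \<in> E \<Longrightarrow> g e \<in> E"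
    and "\<And>e. e \<in> E \<Longrightarrow> c e \<in> E \<Longrightarrow> c e = g e" and x: "x \<in> A - E"
  shows "orbit g (shortcut E g c) x = orbit g c x - E"
proof
  let ?O = "orbit g (shortcut E g c) x"
  have s: "free_involution (A - E) (shortcut E g c)"
    by (rule free_involution_shortcut[OF assms(1-5)])
  have gE: "free_involution (A - E) g"
    using assms(1,4) by (rule free_involution_Diff)
  have OA: "?O \<subseteq> A - E" by (rule orbit_in[OF gE s x])
  have "?O \<subseteq> orbit g c x"
    by (intro orbit_subset) (auto simp: orbit_self shortcut_def intro: orbit_step)
  then show "?O \<subseteq> orbit g c x - E" using OA by blast
  have "orbit g c x \<subseteq> ?O \<union> {e \<in> E. c e \<in> ?O \<or> c (g e) \<in> ?O}"
    by (rule orbit_subset; (rule shortcut_closure[OF assms(1-4) OA])?)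
      (auto simp: orbit_self intro: orbit_step)
  then show "orbit g c x - E \<subseteq> ?O" by blast
qed

text \<open>By \<open>out\<close> an orbit that meets \<open>E\<close> also has points outside, so
  no orbit disappears with \<open>E\<close>, and different orbits keep different traces. Applied to
  \<open>far\<close> and \<open>corner\<close>, this counts faces without the flags of the root
  edge.\<close>

lemma card_orbits_shortcut:
  assumes "free_involution A g" "free_involution A c" "E \<subseteq> A" "\<And>e. e \<in> E \<Longrightarrow> g e \<in> E"
    and out: "\<And>e. e \<in> E \<Longrightarrow> c e \<notin> E"
  shows "card (orbit g (shortcut E g c) ` (A - E)) = card (orbit g c ` A)"
proof -
  have 1: "orbit g c ` A = orbit g c ` (A - E)"
  proof -
    have "orbit g c e \<in> orbit g c ` (A - E)" if "e \<in> A" "e \<in> E" for e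
    proof -
      have "c e \<in> A - E" using that out assms(2) by (auto simp: free_involution_def)
      moreover have "orbit g c (c e) = orbit g c e"
        using that by (intro orbit_eq[OF assms(1,2)]) (auto intro: orbit_step orbit_self)
      ultimately show ?thesis by (metis imageI)
    qed
    then show ?thesis by blast
  qed
  have 2: "orbit g (shortcut E g c) x = orbit g c x - E" if "x \<in> A - E" for x
    using assms that by (intro orbit_shortcut[where A = A]) auto
  have "orbit g (shortcut E g c) ` (A - E) = (\<lambda>U. U - E) ` orbit g c ` (A - E)"
    using 2 by (auto simp: image_image)
  moreover have "inj_on (\<lambda>U. U - E) (orbit g c ` (A - E))"
  proof (rule inj_onI)
    fix O1 O2 assume "O1 \<in> orbit g c ` (A - E)" "O2 \<in> orbit g c ` (A - E)" and eq: "O1 - E = O2 - E"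
    then obtain x y where x: "x \<in> A - E" "O1 = orbit g c x" and y: "y \<in> A - E" "O2 = orbit g c y"
      by blast
    have "x \<in> O2" using x eq orbit_self[of x g c] by blast
    then show "O1 = O2" using orbit_eq[OF assms(1,2), of y x] x y by auto
  qed
  ultimately show ?thesis using 1 by (simp add: card_image)
qed

section \<open>Paths and the perfect matchings of four points\<close>

text \<open>
  If \<open>c\<close> is only used outside \<open>Q\<close>, then the links of \<open>f\<close> and \<open>c\<close> form cycles and paths; the path
  that starts at a point of \<open>Q\<close> ends at another one.
\<close>

definition is_path ::
  "(nat \<Rightarrow> nat) \<Rightarrow> (nat \<Rightarrow> nat) \<Rightarrow> nat set \<Rightarrow> nat set \<Rightarrow> nat \<Rightarrow> nat \<Rightarrow> nat set \<Rightarrow> bool" where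
  "is_path f c A Q q q' C \<longleftrightarrow>
     C \<subseteq> A \<and> (\<forall>x\<in>C. f x \<in> C) \<and> (\<forall>x\<in>C - Q. c x \<in> C) \<and> q' \<noteq> q \<and> C \<inter> Q = {q, q'} \<and>
     (\<forall>B. q \<in> B \<longrightarrow> (\<forall>x\<in>B \<inter> A. f x \<in> B \<and> (x \<notin> Q \<longrightarrow> c x \<in> B)) \<longrightarrow> C \<subseteq> B)"

lemma is_pathD:
  assumes "is_path f c A Q q q' C"
  shows "C \<subseteq> A" "\<And>x. x \<in> C \<Longrightarrow> f x \<in> C" "\<And>x. x \<in> C - Q \<Longrightarrow> c x \<in> C" "q' \<noteq> q" "C \<inter> Q = {q, q'}"
    and "\<And>B. q \<in> B \<Longrightarrow> (\<forall>x\<in>B \<inter> A. f x \<in> B \<and> (x \<notin> Q \<longrightarrow> c x \<in> B)) \<Longrightarrow> C \<subseteq> B"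
proof -
  note * = assms[unfolded is_path_def]
  show "C \<subseteq> A" "q' \<noteq> q" "C \<inter> Q = {q, q'}"
    using * by - (elim conjE, assumption)+
  show "\<And>x. x \<in> C \<Longrightarrow> f x \<in> C" "\<And>x. x \<in> C - Q \<Longrightarrow> c x \<in> C"
    using * by - (elim conjE, erule bspec, assumption)+
  show "\<And>B. q \<in> B \<Longrightarrow> (\<forall>x\<in>B \<inter> A. f x \<in> B \<and> (x \<notin> Q \<longrightarrow> c x \<in> B)) \<Longrightarrow> C \<subseteq> B"
    using * by (elim conjE) (erule allE, erule impE, assumption, erule impE, assumption, assumption)
qed

text \<open>If \<open>f q\<close> lies in \<open>Q\<close>, the path is \<open>{q, f q}\<close>.
  Otherwise the first two points \<open>q\<close>, \<open>f q\<close> are cut off, and the next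
  point \<open>c (f q)\<close> replaces \<open>q\<close> in \<open>Q\<close> as the start of a
  shorter path.\<close>

lemma ex_path:
  assumes "finite A" "free_involution A f" "Q \<subseteq> A" "free_involution (A - Q) c" "q \<in> Q"
  shows "\<exists>C q'. is_path f c A Q q q' C"
  unfolding is_path_def using assms
proof (induction "card A" arbitrary: A Q q rule: less_induct)
  case less
  note f = free_involutionD[OF less.prems(2)] and c = free_involutionD[OF less.prems(4)]
  let ?x = "f q"
  have qA: "q \<in> A" using less.prems by auto
  note fq = f[OF qA]
  show ?case
  proof (cases "?x \<in> Q")
    case True
    show ?thesis
      by (rule exI[of _ "{q, ?x}"], rule exI[of _ ?x]) (use True fq qA less.prems(5) in auto)
  next
    case False
    define A1 where "A1 = A - {q, ?x}"
    define x' where "x' = c ?x"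
    define Q1 where "Q1 = insert x' (Q - {q})"
    have x: "?x \<in> A - Q" using False fq by simp
    have x': "x' \<in> A - Q" "x' \<noteq> ?x" "c x' = ?x" using c[OF x] by (auto simp: x'_def)
    have x'q: "x' \<noteq> q" using x' less.prems(5) by auto
    have "card A1 < card A"
      unfolding A1_def using less.prems(1) qA by (intro psubset_card_mono) auto
    moreover have "free_involution A1 f"
      unfolding A1_def using less.prems(2) by (rule free_involution_Diff) (use fq in auto)
    moreover have "Q1 \<subseteq> A1" using less.prems(3) x' x x'q by (auto simp: Q1_def A1_def)
    moreover have "A1 - Q1 = (A - Q) - {?x, x'}"
      using less.prems(5) x x' by (auto simp: Q1_def A1_def)
    then have "free_involution (A1 - Q1) c"
      using free_involution_Diff[OF less.prems(4), of "{?x, x'}"] x' by (auto simp: x'_def)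
    ultimately have "\<exists>C q'. is_path f c A1 Q1 x' q' C"
      unfolding is_path_def using less.hyps[of A1 Q1 x'] less.prems(1) by (simp add: A1_def Q1_def)
    then obtain C q' where path: "is_path f c A1 Q1 x' q' C" by blast
    note C = is_pathD(1-5)[OF path] and min = is_pathD(6)[OF path]
    have "{q, ?x} \<inter> C = {}" using C(1) by (auto simp: A1_def)
    show ?thesis
    proof (rule exI[of _ "insert q (insert ?x C)"], rule exI[of _ q'], intro conjI allI impI)
      show "insert q (insert ?x C) \<subseteq> A" using C(1) x qA by (auto simp: A1_def)
      show "\<forall>y\<in>insert q (insert ?x C). f y \<in> insert q (insert ?x C)" using C(2) fq by auto
      show "\<forall>y\<in>insert q (insert ?x C) - Q. c y \<in> insert q (insert ?x C)"
        using C(3,5) x' less.prems(5) by (auto simp: Q1_def x'_def)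
      have q': "q' \<in> C" "q' \<in> Q1" using C(5) by blast+
      then show "q' \<noteq> q" using C(1) by (auto simp: A1_def)
      have "q' \<in> Q" using q' C(4) by (auto simp: Q1_def)
      moreover have "C \<inter> Q \<subseteq> {q'}"
      proof
        fix y assume y: "y \<in> C \<inter> Q"
        then have "y \<in> Q1" using C(1) by (auto simp: A1_def Q1_def)
        then have "y \<in> {x', q'}" using y C(5) by blast
        then show "y \<in> {q'}" using y x'(1) by auto
      qed
      ultimately show "insert q (insert ?x C) \<inter> Q = {q, q'}"
        using q'(1) x less.prems(5) by blast
    next
      fix B assume B: "q \<in> B" "\<forall>x\<in>B \<inter> A. f x \<in> B \<and> (x \<notin> Q \<longrightarrow> c x \<in> B)"
      then have xB: "?x \<in> B" "x' \<in> B" using qA x by (auto simp: x'_def)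
      have "C \<subseteq> B"
        using B xB less.prems(5) by (intro min) (auto simp: A1_def Q1_def)
      then show "insert q (insert ?x C) \<subseteq> B" using B xB by blast
    qed
  qed
qed


text \<open>\<open>C\<close> and \<open>D\<close> are the paths with ends \<open>a\<close>,
  \<open>b\<close> and \<open>d\<close>, \<open>e\<close>. The links of \<open>c1\<close> close each
  of them to a cycle of its own, those of \<open>c2\<close> join them to a single cycle; all other
  orbits avoid \<open>Q\<close> and are common to both. Minimality of \<open>C\<close> and
  \<open>D\<close> makes these sets whole orbits.\<close>

lemma card_orbits_two_paths:
  assumes fin: "finite A" and f: "free_involution A f"
    and c1: "free_involution A c1" and c2: "free_involution A c2"
    and agree: "\<And>x. x \<in> A - Q \<Longrightarrow> c2 x = c1 x"
    and Q: "Q = {a, b, d, e}" "Q \<subseteq> A" "card Q = 4"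
    and m1: "c1 a = b" "c1 d = e" and m2: "{c2 a, c2 b} = {d, e}"
    and C: "C \<subseteq> A" "\<And>x. x \<in> C \<Longrightarrow> f x \<in> C" "\<And>x. x \<in> C - Q \<Longrightarrow> c1 x \<in> C" "C \<inter> Q = {a, b}"
    and minC: "\<And>B. a \<in> B \<Longrightarrow> (\<forall>x\<in>B \<inter> A. f x \<in> B \<and> (x \<notin> Q \<longrightarrow> c1 x \<in> B)) \<Longrightarrow> C \<subseteq> B"
    and D: "D \<subseteq> A" "\<And>x. x \<in> D \<Longrightarrow> f x \<in> D" "\<And>x. x \<in> D - Q \<Longrightarrow> c1 x \<in> D" "D \<inter> Q = {d, e}"
    and minD: "\<And>B. d \<in> B \<Longrightarrow> (\<forall>x\<in>B \<inter> A. f x \<in> B \<and> (x \<notin> Q \<longrightarrow> c1 x \<in> B)) \<Longrightarrow> D \<subseteq> B"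
    and disj: "C \<inter> D = {}"
  shows "card (orbit f c1 ` A) = card (orbit f c2 ` A) + 1"
proof -
  let ?Z = "A - (C \<union> D)"
  have ab: "a \<in> A" "b \<in> A" "d \<in> A" "e \<in> A" "a \<in> C" "b \<in> C" "d \<in> D" "e \<in> D"
    using Q(1,2) C(4) D(4) by blast+
  have m1': "c1 b = a" "c1 e = d"
    using free_involutionD(3)[OF c1 ab(1)] free_involutionD(3)[OF c1 ab(3)] m1 by simp_all
  have c1C: "c1 x \<in> C" if "x \<in> C" for x
  proof (cases "x \<in> Q")
    case True
    then have "x = a \<or> x = b" using that C(4) by blast
    then show ?thesis using m1 m1' ab by auto
  qed (use that C(3) in blast)
  have c1D: "c1 x \<in> D" if "x \<in> D" for x
  proof (cases "x \<in> Q")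
    case True
    then have "x = d \<or> x = e" using that D(4) by blast
    then show ?thesis using m1 m1' ab by auto
  qed (use that D(3) in blast)
  have oC: "orbit f c1 x = C" if "x \<in> C" for x
  proof -
    have "orbit f c1 a = C"
    proof
      show "orbit f c1 a \<subseteq> C" using ab C(2) c1C by (intro orbit_subset) auto
      show "C \<subseteq> orbit f c1 a" by (rule minC) (auto simp: orbit_self intro: orbit_step)
    qed
    then show ?thesis using orbit_eq[OF f c1 ab(1), of x] that by simp
  qed
  have oD: "orbit f c1 x = D" if "x \<in> D" for x
  proof -
    have "orbit f c1 d = D"
    proof
      show "orbit f c1 d \<subseteq> D" using ab D(2) c1D by (intro orbit_subset) auto
      show "D \<subseteq> orbit f c1 d" by (rule minD) (auto simp: orbit_self intro: orbit_step)
    qed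
    then show ?thesis using orbit_eq[OF f c1 ab(3), of x] that by simp
  qed
  have c2Q: "c2 x \<in> Q" if "x \<in> Q" for x
  proof -
    have "c2 (c2 a) = a" "c2 (c2 b) = b" using free_involutionD(3)[OF c2] ab by auto
    moreover from m2 have "c2 a = d \<and> c2 b = e \<or> c2 a = e \<and> c2 b = d"
      by (auto simp: doubleton_eq_iff)
    ultimately have "c2 d \<in> {a, b}" "c2 e \<in> {a, b}" "c2 a \<in> {d, e}" "c2 b \<in> {d, e}" by auto
    then show ?thesis using that unfolding Q(1) by blast
  qed
  have c2CD: "c2 x \<in> C \<union> D" if "x \<in> C \<union> D" for x
  proof (cases "x \<in> Q")
    case True
    have "Q \<subseteq> C \<union> D" using ab unfolding Q(1) by blast
    then show ?thesis using c2Q[OF True] by blast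
  next
    case False
    then have "c2 x = c1 x" using that agree[of x] C(1) D(1) by blast
    then show ?thesis using that c1C c1D by auto
  qed
  have oCD: "orbit f c2 x = C \<union> D" if "x \<in> C \<union> D" for x
  proof -
    have "orbit f c2 a = C \<union> D"
    proof
      show "orbit f c2 a \<subseteq> C \<union> D" using ab C(2) D(2) c2CD by (intro orbit_subset) auto
      let ?B = "orbit f c2 a"
      have cl: "\<forall>x\<in>?B \<inter> A. f x \<in> ?B \<and> (x \<notin> Q \<longrightarrow> c1 x \<in> ?B)"
      proof (intro ballI conjI impI)
        fix x assume x: "x \<in> ?B \<inter> A"
        then show "f x \<in> ?B" by (auto intro: orbit_step)
        assume "x \<notin> Q"
        then show "c1 x \<in> ?B" using x agree[of x] orbit_step(2)[of x f c2 a] by auto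
      qed
      have 1: "C \<subseteq> ?B" by (rule minC[OF orbit_self cl])
      then have "c2 a \<in> ?B" "c2 b \<in> ?B" using ab by (auto intro: orbit_step)
      then have "d \<in> ?B" using m2 by (metis insertE insertI1 singletonD)
      from minD[OF this cl] 1 show "C \<union> D \<subseteq> ?B" by blast
    qed
    then show ?thesis using orbit_eq[OF f c2 ab(1), of x] that by simp
  qed
  have ZQ: "x \<notin> Q" if "x \<in> ?Z" for x using that ab unfolding Q(1) by blast
  have cC: "free_involution ?Z c1"
    using c1 by (rule free_involution_Diff) (use c1C c1D in auto)
  have fZ: "free_involution ?Z f"
    using f by (rule free_involution_Diff) (use C(2) D(2) in auto)
  have oZ: "orbit f c2 x = orbit f c1 x" if "x \<in> ?Z" for x
    using that cC fZ agree ZQ by (intro orbit_cong[where A = ?Z]) (auto simp: free_involution_def)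
  have ZA: "orbit f c1 x \<subseteq> ?Z" if "x \<in> ?Z" for x by (rule orbit_in[OF fZ cC that])
  let ?O = "orbit f c1 ` ?Z"
  have A: "A = C \<union> D \<union> ?Z" using C(1) D(1) by blast
  have "orbit f c1 ` A = orbit f c1 ` C \<union> orbit f c1 ` D \<union> ?O" using A by (metis image_Un)
  also have "orbit f c1 ` C = {C}" using oC ab(5) by force
  also have "orbit f c1 ` D = {D}" using oD ab(7) by force
  finally have 1: "orbit f c1 ` A = insert C (insert D ?O)" by blast
  have "orbit f c2 ` A = orbit f c2 ` (C \<union> D) \<union> orbit f c2 ` ?Z" using A by (metis image_Un)
  also have "orbit f c2 ` (C \<union> D) = {C \<union> D}" using oCD ab(5) by force
  also have "orbit f c2 ` ?Z = ?O" using oZ by (intro image_cong) auto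
  finally have 2: "orbit f c2 ` A = insert (C \<union> D) ?O" by blast
  have "C \<notin> ?O" "D \<notin> ?O" "C \<union> D \<notin> ?O" using ZA ab by blast+
  moreover have "C \<noteq> D" using disj ab by blast
  ultimately show ?thesis unfolding 1 2 using fin by simp
qed

text \<open>\<open>c1\<close>, \<open>c2\<close>, \<open>c3\<close> induce the three perfect
  matchings of \<open>p\<close>, \<open>q\<close>, \<open>r\<close>, \<open>s\<close>. The path from
  \<open>p\<close> ends at one of the other three points, and this point tells which matching agrees
  with the paths and so has one orbit more than the other two.\<close>

lemma three_matchings:
  assumes fin: "finite A" and f: "free_involution A f"
    and c: "free_involution A c1" "free_involution A c2" "free_involution A c3"
    and agree: "\<And>x. x \<in> A - Q \<Longrightarrow> c2 x = c1 x" "\<And>x. x \<in> A - Q \<Longrightarrow> c3 x = c1 x"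
    and Q: "Q = {p, q, r, s}" "Q \<subseteq> A" "card Q = 4"
    and m: "c1 p = q" "c1 r = s" "c2 p = r" "c2 q = s" "c3 p = s" "c3 q = r"
  defines "N \<equiv> \<lambda>c. card (orbit f c ` A)"
  shows "N c1 = N c2 + 1 \<and> N c3 = N c2 \<or> N c2 = N c1 + 1 \<and> N c3 = N c1 \<or>
         N c3 = N c1 + 1 \<and> N c2 = N c1"
proof -
  have inA: "p \<in> A" "q \<in> A" "r \<in> A" "s \<in> A" using Q(1,2) by auto
  have m': "c1 q = p" "c1 s = r" "c2 r = p" "c2 s = q" "c3 s = p" "c3 r = q"
    using m free_involutionD(3)[OF c(1)] free_involutionD(3)[OF c(2)] free_involutionD(3)[OF c(3)]
      inA by metis+
  have dist: "distinct [p, q, r, s]"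
    using Q(1,3) by (intro card_distinct) (simp add: insert_commute)
  have "free_involution (A - Q) c1"
    using c(1) by (rule free_involution_Diff) (use Q(1) m m' in auto)
  note pc = ex_path[OF fin f Q(2) this]
  have "p \<in> Q" using Q by simp
  from pc[OF this] obtain C q' where p: "is_path f c1 A Q p q' C" by blast
  note C = is_pathD(1-5)[OF p] and minC = is_pathD(6)[OF p]
  \<comment> \<open>\<open>d1\<close> is the matching that links the ends of each path to each
    other; \<open>d2\<close> and \<open>d3\<close> link ends of different paths.\<close>
  have main: "N d1 = N d2 + 1 \<and> N d1 = N d3 + 1"
    if d: "free_involution A d1" "free_involution A d2" "free_involution A d3"
    and ag: "\<And>x. x \<in> A - Q \<Longrightarrow> d1 x = c1 x" "\<And>x. x \<in> A - Q \<Longrightarrow> d2 x = c1 x"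
      "\<And>x. x \<in> A - Q \<Longrightarrow> d3 x = c1 x"
    and Q': "Q = {p, q', u, v}" and dd: "d1 p = q'" "d1 u = v" "{d2 p, d2 q'} = {u, v}"
      "{d3 p, d3 q'} = {u, v}" for d1 d2 d3 u v
  proof -
    have dist': "distinct [p, q', u, v]"
      using Q' Q(3) by (intro card_distinct) (simp add: insert_commute)
    have "u \<in> Q" using Q' by simp
    from pc[OF this] obtain D u' where pD: "is_path f c1 A Q u u' D" by blast
    note D = is_pathD(1-5)[OF pD] and minD = is_pathD(6)[OF pD]
    have cc: "free_involution (A - Q) c1"
      using c(1) by (rule free_involution_Diff) (use Q(1) m m' in auto)
    \<comment> \<open>The complement of \<open>C\<close> is closed under the same steps, because
      they are involutions, so the minimal set \<open>D\<close> lies in it.\<close>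
    have "D \<subseteq> - C"
    proof (rule minD)
      show "u \<in> - C" using C(5) Q' dist' by auto
      show "\<forall>x\<in>- C \<inter> A. f x \<in> - C \<and> (x \<notin> Q \<longrightarrow> c1 x \<in> - C)"
      proof (intro ballI conjI impI)
        fix x assume x: "x \<in> - C \<inter> A"
        show "f x \<in> - C" using C(2)[of "f x"] free_involutionD(3)[OF f, of x] x by auto
        assume "x \<notin> Q"
        then have "c1 x \<in> A - Q" "c1 (c1 x) = x" using free_involutionD[OF cc, of x] x by auto
        then show "c1 x \<in> - C" using C(3)[of "c1 x"] x by auto
      qed
    qed
    then have disj: "C \<inter> D = {}" by blast
    have u': "u' = v" using D(4,5) disj C(5) Q' by blast
    have Cd: "x \<in> C - Q \<Longrightarrow> d1 x \<in> C" "x \<in> D - Q \<Longrightarrow> d1 x \<in> D" for x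
      using C(1,3) D(1,3) ag(1)[of x] by auto
    have mind: "\<And>B. p \<in> B \<Longrightarrow> (\<forall>x\<in>B \<inter> A. f x \<in> B \<and> (x \<notin> Q \<longrightarrow> d1 x \<in> B)) \<Longrightarrow> C \<subseteq> B"
      "\<And>B. u \<in> B \<Longrightarrow> (\<forall>x\<in>B \<inter> A. f x \<in> B \<and> (x \<notin> Q \<longrightarrow> d1 x \<in> B)) \<Longrightarrow> D \<subseteq> B"
    proof -
      fix B assume *: "\<forall>x\<in>B \<inter> A. f x \<in> B \<and> (x \<notin> Q \<longrightarrow> d1 x \<in> B)"
      have "\<forall>x\<in>B \<inter> A. f x \<in> B \<and> (x \<notin> Q \<longrightarrow> c1 x \<in> B)"
      proof
        fix x assume x: "x \<in> B \<inter> A"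
        then show "f x \<in> B \<and> (x \<notin> Q \<longrightarrow> c1 x \<in> B)" using * ag(1)[of x] by auto
      qed
      then show "p \<in> B \<Longrightarrow> C \<subseteq> B" "u \<in> B \<Longrightarrow> D \<subseteq> B" using minC minD by blast+
    qed
    note cnt = card_orbits_two_paths[OF fin f d(1) _ _ Q' Q(2,3) dd(1,2) _ C(1,2) Cd(1) C(5) mind(1)
        D(1,2) Cd(2) _ mind(2) disj]
    have "N d1 = N d2 + 1" "N d1 = N d3 + 1" unfolding N_def
      by (rule cnt; use d dd ag D(5) u' in simp)+
    then show ?thesis by simp
  qed
  have "q' \<in> {q, r, s}" using C(4,5) Q(1) by auto
  then consider "q' = q" | "q' = r" | "q' = s" by blast
  then show ?thesis
  proof cases
    case 1
    have "N c1 = N c2 + 1 \<and> N c1 = N c3 + 1"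
      by (rule main[where u = r and v = s]) (use 1 c agree Q(1) m m' in \<open>simp_all add: insert_commute\<close>)
    then show ?thesis by simp
  next
    case 2
    have "N c2 = N c1 + 1 \<and> N c2 = N c3 + 1"
      by (rule main[where u = q and v = s]) (use 2 c agree Q(1) m m' in \<open>simp_all add: insert_commute\<close>)
    then show ?thesis by simp
  next
    case 3
    have "N c3 = N c1 + 1 \<and> N c3 = N c2 + 1"
      by (rule main[where u = q and v = r]) (use 3 c agree Q(1) m m' in \<open>simp_all add: insert_commute\<close>)
    then show ?thesis by simp
  qed
qed

section \<open>Deleting the root edge\<close>

definition reach :: "flag_map \<Rightarrow> nat \<Rightarrow> nat set" where
  "reach M x = (steps_avoiding (root_edge M) M)\<^sup>* `` {x}"

text \<open>On the flags of a bipartite map the choice is unique, see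
  \<open>colouring_unique\<close>.\<close>

definition black_of :: "flag_map \<Rightarrow> nat \<Rightarrow> bool" where
  "black_of M = (SOME b. vertex_colouring M b \<and> b (root M))"

abbreviation degrees_of :: "nat set set \<Rightarrow> nat multiset" where
  "degrees_of S \<equiv> image_mset (\<lambda>V. card V div 2) (mset_set S)"

text \<open>The degree of the root vertex is kept apart from the other black degrees because root
  deletion lowers it by 1. The edgeless map counts as a root vertex of degree 0 with no other
  vertices.\<close>

definition profile :: "flag_map \<Rightarrow> nat \<times> nat multiset \<times> nat multiset" where
  "profile M = (if flags M = {} then (0, {#}, {#}) else
     (card (vertex_of M (root M)) div 2,
      degrees_of (vertex_of M ` {x \<in> flags M. black_of M x} - {vertex_of M (root M)}),
      degrees_of (vertex_of M ` {x \<in> flags M. \<not> black_of M x})))"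

locale edged_map =
  fixes M :: flag_map
  assumes bip: "bipartite_map M" and ne: "flags M \<noteq> {}"
begin

abbreviation "A \<equiv> flags M"
abbreviation "s \<equiv> side M"
abbreviation "f \<equiv> far M"
abbreviation "c \<equiv> corner M"
abbreviation "r \<equiv> root M"
abbreviation "E \<equiv> root_edge M"
abbreviation "b \<equiv> black_of M"

lemma fin: "finite A"
  using bip by (simp add: bipartite_map_def)

lemma s_inv: "free_involution A s" and f_inv: "free_involution A f" and c_inv: "free_involution A c"
  using bip by (simp_all add: bipartite_map_def)

lemma s: "x \<in> A \<Longrightarrow> s x \<in> A" "x \<in> A \<Longrightarrow> s x \<noteq> x" "x \<in> A \<Longrightarrow> s (s x) = x"
  and f: "x \<in> A \<Longrightarrow> f x \<in> A" "x \<in> A \<Longrightarrow> f x \<noteq> x" "x \<in> A \<Longrightarrow> f (f x) = x"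
  and c: "x \<in> A \<Longrightarrow> c x \<in> A" "x \<in> A \<Longrightarrow> c x \<noteq> x" "x \<in> A \<Longrightarrow> c (c x) = x"
  using s_inv f_inv c_inv by (simp_all add: free_involution_def)

lemma sf: "x \<in> A \<Longrightarrow> f (s x) = s (f x)" "x \<in> A \<Longrightarrow> s (f x) \<noteq> x"
  using bip by (auto simp: bipartite_map_def)

lemma r: "r \<in> A"
  using bip ne by (simp add: bipartite_map_def)

lemma black: "vertex_colouring M b" "b r"
proof -
  obtain d where d: "vertex_colouring M d" using bip by (auto simp: bipartite_map_def)
  have "\<exists>d. vertex_colouring M d \<and> d r"
  proof (cases "d r")
    case False
    then show ?thesis using d by (intro exI[of _ "\<lambda>x. \<not> d x"]) (auto simp: vertex_colouring_def)
  qed (use d in blast)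
  from someI_ex[OF this] show "vertex_colouring M b" "b r" by (simp_all add: black_of_def)
qed

lemma b: "x \<in> A \<Longrightarrow> b (s x) = b x" "x \<in> A \<Longrightarrow> b (c x) = b x" "x \<in> A \<Longrightarrow> b (f x) = (\<not> b x)"
  using black(1) by (simp_all add: vertex_colouring_def)

lemma E: "E = {r, s r, f r, s (f r)}"
  by (auto simp: root_edge_def)

lemma E_A: "E \<subseteq> A"
  using r s f by (auto simp: E)

lemma E_s: "e \<in> E \<Longrightarrow> s e \<in> E" and E_f: "e \<in> E \<Longrightarrow> f e \<in> E"
  using r s f sf by (auto simp: E)

lemma E_colours: "b r" "b (s r)" "\<not> b (f r)" "\<not> b (s (f r))"
  using r f(1)[OF r] b black(2) by auto

lemma E_black: "e \<in> E \<Longrightarrow> b e \<longleftrightarrow> e = r \<or> e = s r" and E_white: "e \<in> E \<Longrightarrow> \<not> b e \<longleftrightarrow> e = f r \<or> e = s (f r)"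
  using E_colours by (auto simp: E)

text \<open>The ends of the root edge have different colours and \<open>corner\<close> preserves
  colours, so \<open>corner\<close> can link a flag of the edge only to the other side of the same
  half-edge. This happens exactly at an end of degree 1, and it is the condition under which
  \<open>shortcut\<close> works.\<close>

lemma E_c:
  assumes "e \<in> E" "c e \<in> E"
  shows "c e = s e"
proof -
  have e: "e \<in> A" using assms E_A by blast
  have "b (c e) = b e" "c e \<noteq> e" using b c e by auto
  then show ?thesis
    using E_black[OF assms(1)] E_black[OF assms(2)] E_white[OF assms(1)] E_white[OF assms(2)]
      r s f by (cases "b e") auto
qed

lemma corner_deleted: "corner_deleted M = shortcut E s c"
  by (auto simp: fun_eq_iff corner_deleted_def shortcut_def Let_def)

lemma deleted_inv: "free_involution (A - E) (corner_deleted M)"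
  unfolding corner_deleted by (rule free_involution_shortcut[OF s_inv c_inv E_A E_s E_c])

lemma vertex_deleted:
  assumes "x \<in> A - E"
  shows "orbit s (corner_deleted M) x = vertex_of M x - E"
  unfolding corner_deleted vertex_of_def
  by (rule orbit_shortcut[OF s_inv c_inv E_A E_s E_c assms])

lemma reach_self: "x \<in> reach M x"
  by (simp add: reach_def)

lemma reach_step:
  assumes "y \<in> reach M x" "y \<in> A"
  shows "s y \<in> reach M x" "c y \<in> reach M x" "y \<notin> E \<Longrightarrow> f y \<in> reach M x"
  using assms by (auto simp: reach_def steps_avoiding_def intro: rtrancl_into_rtrancl)

lemma reach_subset:
  assumes "x \<in> B" "\<And>y. y \<in> B \<Longrightarrow> y \<in> A \<Longrightarrow> s y \<in> B" "\<And>y. y \<in> B \<Longrightarrow> y \<in> A \<Longrightarrow> c y \<in> B"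
    "\<And>y. y \<in> B \<Longrightarrow> y \<in> A \<Longrightarrow> y \<notin> E \<Longrightarrow> f y \<in> B"
  shows "reach M x \<subseteq> B"
proof
  fix z assume "z \<in> reach M x"
  then have "(x, z) \<in> (steps_avoiding E M)\<^sup>*" by (simp add: reach_def)
  then show "z \<in> B"
    by (induction rule: rtrancl_induct) (use assms in \<open>auto simp: steps_avoiding_def\<close>)
qed

lemma reach_A: "x \<in> A \<Longrightarrow> reach M x \<subseteq> A"
  by (rule reach_subset) (use s f c in auto)

lemma reach_trans: "y \<in> reach M x \<Longrightarrow> reach M y \<subseteq> reach M x"
  unfolding reach_def by (auto intro: rtrancl_trans)

lemma reach_eq:
  assumes "x \<in> A" "y \<in> reach M x"
  shows "reach M y = reach M x"
proof
  show "reach M y \<subseteq> reach M x" by (rule reach_trans[OF assms(2)])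
  let ?B = "{z \<in> A. x \<in> reach M z}"
  have "reach M x \<subseteq> ?B"
  proof (rule reach_subset)
    show "x \<in> ?B" using assms(1) by (simp add: reach_self)
    fix z assume z: "z \<in> ?B"
    then have zA: "z \<in> A" and x: "x \<in> reach M z" by auto
    have "z \<in> reach M (s z)" using reach_step(1)[OF reach_self[of "s z"]] s zA by simp
    then show "s z \<in> ?B" using s zA x reach_trans[of z "s z"] by auto
    have "z \<in> reach M (c z)" using reach_step(2)[OF reach_self[of "c z"]] c zA by simp
    then show "c z \<in> ?B" using c zA x reach_trans[of z "c z"] by auto
    assume zE: "z \<notin> E"
    have "f z \<notin> E" using E_f[of "f z"] zE f zA by auto
    then have "z \<in> reach M (f z)" using reach_step(3)[OF reach_self[of "f z"]] f zA by simp
    then show "f z \<in> ?B" using f zA x reach_trans[of z "f z"] by auto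
  qed
  then have "x \<in> reach M y" using assms(2) by blast
  then show "reach M x \<subseteq> reach M y" by (rule reach_trans)
qed

text \<open>Connectedness as an induction principle; the uniqueness of colourings and of
  isomorphisms is derived from it.\<close>

lemma connected_subset:
  assumes "x \<in> B" "x \<in> A" "\<And>y. y \<in> B \<Longrightarrow> y \<in> A \<Longrightarrow> s y \<in> B" "\<And>y. y \<in> B \<Longrightarrow> y \<in> A \<Longrightarrow> c y \<in> B"
    "\<And>y. y \<in> B \<Longrightarrow> y \<in> A \<Longrightarrow> f y \<in> B"
  shows "A \<subseteq> B"
proof
  fix z assume "z \<in> A"
  then have "(x, z) \<in> (steps_avoiding {} M)\<^sup>*"
    using bip assms(2) by (simp add: bipartite_map_def connected_avoiding_def)
  then show "z \<in> B"
    by (induction rule: rtrancl_induct) (use assms in \<open>auto simp: steps_avoiding_def\<close>)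
qed

lemma reach_cover: "A = reach M r \<union> reach M (f r)"
proof
  let ?B = "reach M r \<union> reach M (f r)"
  have 1: "E \<subseteq> ?B"
    using reach_self[of r] reach_self[of "f r"] reach_step(1)[OF reach_self] r f by (auto simp: E)
  show "A \<subseteq> ?B"
  proof (rule connected_subset)
    show "r \<in> ?B" by (simp add: reach_self)
    fix y assume "y \<in> ?B" "y \<in> A"
    then show "s y \<in> ?B" "c y \<in> ?B" by (auto intro: reach_step)
    show "f y \<in> ?B"
    proof (cases "y \<in> E")
      case True
      then show ?thesis using E_f 1 by blast
    next
      case False
      then show ?thesis using \<open>y \<in> ?B\<close> \<open>y \<in> A\<close> by (auto intro: reach_step)
    qed
  qed (rule r)
  show "?B \<subseteq> A" using reach_A r f by auto
qed

lemma bridge_iff: "root_bridge M \<longleftrightarrow> f r \<notin> reach M r"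
proof
  assume br: "root_bridge M"
  show "f r \<notin> reach M r"
  proof
    assume *: "f r \<in> reach M r"
    have "reach M r = A" using reach_cover reach_eq[OF r *] by simp
    then have "reach M x = A" if "x \<in> A" for x using reach_eq[OF r, of x] that by simp
    then have "connected_avoiding E M"
      unfolding connected_avoiding_def reach_def by blast
    then show False using br by (simp add: root_bridge_def)
  qed
next
  assume "f r \<notin> reach M r"
  then show "root_bridge M"
    using r f by (auto simp: root_bridge_def connected_avoiding_def reach_def)
qed

lemma nonbridge_reach: "\<not> root_bridge M \<Longrightarrow> reach M r = A \<and> reach M (f r) = A"
  using bridge_iff reach_cover reach_eq[OF r] by auto

lemma bridge_disjoint: "root_bridge M \<Longrightarrow> reach M r \<inter> reach M (f r) = {}"
proof (rule ccontr)
  assume br: "root_bridge M" and "reach M r \<inter> reach M (f r) \<noteq> {}"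
  then obtain y where "y \<in> reach M r" "y \<in> reach M (f r)" by blast
  then have "reach M r = reach M (f r)" using reach_eq r f by metis
  then show False using br bridge_iff reach_self by auto
qed

text \<open>By \<open>E_c\<close> the end vertex has degree 1, and its two flags belong to the root
  edge; what remains is a single vertex.\<close>

lemma component_empty: "c (s r) \<in> E \<Longrightarrow> reach M r \<subseteq> E" "c (f r) \<in> E \<Longrightarrow> reach M (f r) \<subseteq> E"
proof -
  assume *: "c (s r) \<in> E"
  have "s r \<in> E" by (simp add: E)
  then have "c (s r) = r" using E_c[OF _ *] s r by simp
  moreover have "c r = s r" using c(3)[of "s r"] calculation s r by simp
  ultimately have "reach M r \<subseteq> {r, s r}"
    by (intro reach_subset) (use s r in \<open>auto simp: E\<close>)
  then show "reach M r \<subseteq> E" by (auto simp: E)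
next
  assume *: "c (f r) \<in> E"
  have "f r \<in> E" by (simp add: E)
  then have "c (f r) = s (f r)" using E_c[OF _ *] by simp
  moreover have "c (s (f r)) = f r" using c(3)[of "f r"] calculation f r by simp
  ultimately have "reach M (f r) \<subseteq> {f r, s (f r)}"
    by (intro reach_subset) (use s r f in \<open>auto simp: E\<close>)
  then show "reach M (f r) \<subseteq> E" by (auto simp: E)
qed

lemma neighbour_reach: "c (s r) \<in> reach M r" "c (f r) \<in> reach M (f r)"
  using r s f by (auto intro: reach_step reach_self)

lemma component_bipartite:
  assumes x: "x \<in> A" and \<rho>: "reach M x \<subseteq> E \<or> \<rho> \<in> reach M x - E"
  shows "bipartite_map (deletion_component M x \<rho>)"
proof -
  let ?N = "deletion_component M x \<rho>"
  let ?F = "reach M x - E"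
  have N: "flags ?N = ?F" "side ?N = s" "far ?N = f" "corner ?N = corner_deleted M" "root ?N = \<rho>"
    by (simp_all add: deletion_component_def reach_def)
  have FA: "?F \<subseteq> A - E" using reach_A[OF x] by blast
  have del_in: "corner_deleted M y \<in> ?F" if "y \<in> ?F" for y
  proof -
    have yA: "y \<in> A" "y \<in> reach M x" using that FA by auto
    have "corner_deleted M y \<in> A - E" using deleted_inv that FA by (auto simp: free_involution_def)
    moreover have "corner_deleted M y \<in> reach M x"
      using yA c(1) s(1) by (auto simp: corner_deleted shortcut_def intro!: reach_step)
    ultimately show ?thesis by blast
  qed
  have sF: "s y \<in> ?F" "f y \<in> ?F" if "y \<in> ?F" for y
  proof -
    have y: "y \<in> A" "y \<in> reach M x" "y \<notin> E" using that FA by auto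
    then show "s y \<in> ?F" "f y \<in> ?F"
      using E_s[of "s y"] E_f[of "f y"] s f by (auto intro: reach_step)
  qed
  have 1: "free_involution ?F s" "free_involution ?F f" "free_involution ?F (corner_deleted M)"
    using sF del_in s f deleted_inv FA by (auto simp: free_involution_def subset_iff)
  have 2: "connected_avoiding {} ?N"
    unfolding connected_avoiding_def N
  proof (intro ballI)
    fix x1 y1 assume x1: "x1 \<in> ?F" and y1: "y1 \<in> ?F"
    let ?B = "(steps_avoiding {} ?N)\<^sup>* `` {x1} \<inter> ?F"
    \<comment> \<open>A walk that defines \<open>reach\<close> may pass through flags of the root
      edge at an end vertex. Adding those next to \<open>?B\<close> makes the set closed under such
      walks; \<open>far\<close> steps are allowed only outside \<open>E\<close>.\<close>
    let ?B' = "?B \<union> {e \<in> E. c e \<in> ?B \<or> c (s e) \<in> ?B}"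
    have step: "s y \<in> ?B" "f y \<in> ?B" "shortcut E s c y \<in> ?B" if "y \<in> ?B" for y
      using that sF[of y] del_in[of y] N
      by (auto simp: steps_avoiding_def corner_deleted intro: rtrancl_into_rtrancl)
    have BA: "?B \<subseteq> A - E" using FA by blast
    have "reach M x1 \<subseteq> ?B'"
    proof (rule reach_subset)
      show "x1 \<in> ?B'" using x1 by simp
      show "s y \<in> ?B'" "c y \<in> ?B'" if "y \<in> ?B'" for y
        using shortcut_closure[OF s_inv c_inv E_A E_s BA step(1,3) that] by blast+
      show "f y \<in> ?B'" if "y \<in> ?B'" "y \<notin> E" for y using step(2)[of y] that by blast
    qed
    moreover have "y1 \<in> reach M x1" using reach_eq[OF x, of x1] x1 y1 by blast
    ultimately show "(x1, y1) \<in> (steps_avoiding {} ?N)\<^sup>*" using y1 by blast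
  qed
  have "vertex_colouring ?N b"
    unfolding vertex_colouring_def N
  proof
    fix y assume y: "y \<in> ?F"
    then have yA: "y \<in> A" using FA by blast
    have "b (corner_deleted M y) = b y"
      using yA c s b by (auto simp: corner_deleted shortcut_def)
    then show "b (s y) = b y \<and> b (corner_deleted M y) = b y \<and> b (f y) = (\<not> b y)"
      using b yA by auto
  qed
  then have 3: "\<exists>d. vertex_colouring ?N d" by blast
  have 4: "\<forall>y\<in>?F. s (f y) = f (s y) \<and> s (f y) \<noteq> y"
  proof
    fix y assume "y \<in> ?F"
    then have "y \<in> A" using FA by blast
    from sf(1)[OF this, symmetric] sf(2)[OF this] show "s (f y) = f (s y) \<and> s (f y) \<noteq> y" by (rule conjI)
  qed
  have "finite ?F" using FA fin finite_subset by blast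
  then show ?thesis
    unfolding bipartite_map_def N using 1 2 3 4 \<rho> by blast
qed

end

lemma colouring_unique:
  assumes "bipartite_map M" "flags M \<noteq> {}" "vertex_colouring M d" "d (root M)" "x \<in> flags M"
  shows "d x = black_of M x"
proof -
  interpret edged_map M by unfold_locales (use assms in auto)
  have "A \<subseteq> {x \<in> A. d x = b x}"
    by (rule connected_subset[of r])
      (use assms(3,4) r black s f c b in \<open>auto simp: vertex_colouring_def\<close>)
  then show ?thesis using assms(5) by blast
qed

lemma profile_eq:
  assumes "bipartite_map M" "flags M \<noteq> {}" "vertex_colouring M d" "d (root M)"
  shows "profile M =
     (card (vertex_of M (root M)) div 2,
      degrees_of (vertex_of M ` {x \<in> flags M. d x} - {vertex_of M (root M)}),
      degrees_of (vertex_of M ` {x \<in> flags M. \<not> d x}))"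
proof -
  have "{x \<in> flags M. d x} = {x \<in> flags M. black_of M x}"
    "{x \<in> flags M. \<not> d x} = {x \<in> flags M. \<not> black_of M x}"
    using colouring_unique[OF assms] by auto
  then show ?thesis using assms(2) by (simp add: profile_def)
qed

section \<open>Vertex degrees under root deletion\<close>

context edged_map
begin

lemma vertex_self: "x \<in> vertex_of M x"
  by (simp add: vertex_of_def orbit_self)

lemma vertex_A: "x \<in> A \<Longrightarrow> vertex_of M x \<subseteq> A"
  unfolding vertex_of_def by (rule orbit_in[OF s_inv c_inv])

lemma vertex_eq: "x \<in> A \<Longrightarrow> y \<in> vertex_of M x \<Longrightarrow> vertex_of M y = vertex_of M x"
  unfolding vertex_of_def by (rule orbit_eq[OF s_inv c_inv])

lemma vertex_s: "s x \<in> vertex_of M x" and vertex_c: "c x \<in> vertex_of M x"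
  unfolding vertex_of_def by (auto intro: orbit_step orbit_self)

lemma vertex_reach:
  assumes "x \<in> A"
  shows "vertex_of M x \<subseteq> reach M x"
proof -
  have "orbit s c x \<subseteq> reach M x \<inter> A"
    by (rule orbit_subset) (use assms s c in \<open>auto intro: reach_self reach_step\<close>)
  then show ?thesis by (simp add: vertex_of_def)
qed

lemma vertex_colour: "x \<in> A \<Longrightarrow> y \<in> vertex_of M x \<Longrightarrow> b y = b x"
proof -
  assume x: "x \<in> A" and y: "y \<in> vertex_of M x"
  have "vertex_of M x \<subseteq> {y \<in> A. b y = b x}"
    unfolding vertex_of_def using x s c b by (intro orbit_subset) auto
  then show ?thesis using y by blast
qed

lemma finite_vertex: "x \<in> A \<Longrightarrow> finite (vertex_of M x)"
  using vertex_A fin finite_subset by blast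

lemma even_vertex: "x \<in> A \<Longrightarrow> even (card (vertex_of M x))"
proof (rule even_card_free_involution)
  assume x: "x \<in> A"
  show "finite (vertex_of M x)" by (rule finite_vertex[OF x])
  show "free_involution (vertex_of M x) s"
    using s vertex_A[OF x] unfolding free_involution_def vertex_of_def
    by (auto intro: orbit_step)
qed

text \<open>As the ends of the root edge have different colours, each of them carries only one
  half-edge of it.\<close>

lemma E_vertex:
  assumes "e \<in> {r, f r}"
  shows "vertex_of M e \<inter> E = {e, s e}" "e \<in> A"
proof -
  show eA: "e \<in> A" using assms r f by auto
  have "x \<in> {e, s e}" if x: "x \<in> vertex_of M e" "x \<in> E" for x
    using vertex_colour[OF eA x(1)] E_black[OF x(2)] E_white[OF x(2)] assms black(2) b(3)[OF r]
    by auto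
  moreover have "{e, s e} \<subseteq> E" using assms by (auto simp: E)
  ultimately show "vertex_of M e \<inter> E = {e, s e}" using vertex_self vertex_s by blast
qed

lemma card_vertex_deleted:
  assumes "e \<in> {r, f r}"
  shows "card (vertex_of M e - E) div 2 = card (vertex_of M e) div 2 - 1" "card (vertex_of M e) \<ge> 2"
proof -
  note e = E_vertex[OF assms]
  have fin: "finite (vertex_of M e)" by (rule finite_vertex[OF e(2)])
  have 2: "card (vertex_of M e \<inter> E) = 2" using e s by (simp add: card_2_iff')
  have "card (vertex_of M e - E) = card (vertex_of M e) - card (vertex_of M e \<inter> E)"
    using fin by (simp add: card_Diff_subset_Int)
  then show "card (vertex_of M e - E) div 2 = card (vertex_of M e) div 2 - 1" using 2 by simp
  show "card (vertex_of M e) \<ge> 2" using 2 card_mono[OF fin, of "vertex_of M e \<inter> E"] by simp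
qed

text \<open>All flags of the root edge that have the colour of \<open>e\<close> lie at the vertex of
  \<open>e\<close>, so every other vertex of this colour survives unchanged.\<close>

lemma vertices_deleted:
  assumes "X \<subseteq> A" "e \<in> {r, f r}" and col: "b e = col"
  shows "(\<lambda>y. vertex_of M y - E) ` {y \<in> X - E. b y = col} - {vertex_of M e - E}
       = vertex_of M ` {y \<in> X. b y = col} - {vertex_of M e}" (is "?L = ?R")
proof -
  note e = E_vertex[OF assms(2)]
  have in_e: "y \<in> vertex_of M e" if "y \<in> E" "b y = col" for y
  proof -
    have "y \<in> {e, s e}"
      using E_black[OF that(1)] E_white[OF that(1)] assms(2) col that(2) black(2) b(3)[OF r] by auto
    then show ?thesis using vertex_self vertex_s by auto
  qed
  have other: "vertex_of M y \<inter> E = {}" if "y \<in> A" "b y = col" "vertex_of M y \<noteq> vertex_of M e" for y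
  proof (rule ccontr)
    assume "vertex_of M y \<inter> E \<noteq> {}"
    then obtain z where z: "z \<in> vertex_of M y" "z \<in> E" by blast
    have "z \<in> vertex_of M e" using in_e[OF z(2)] vertex_colour[OF that(1) z(1)] that(2) by simp
    then show False using vertex_eq[OF that(1) z(1)] vertex_eq[OF e(2)] that(3) by metis
  qed
  show ?thesis
  proof (intro subset_antisym subsetI)
    fix V assume "V \<in> ?L"
    then obtain y where y: "y \<in> X" "y \<notin> E" "b y = col" "V = vertex_of M y - E"
      "vertex_of M y - E \<noteq> vertex_of M e - E" by blast
    have n: "vertex_of M y \<noteq> vertex_of M e" using y(5) by metis
    have "V = vertex_of M y" using other[OF _ y(3) n] y(1,4) assms(1) by blast
    then show "V \<in> ?R" using y n by blast
  next
    fix V assume "V \<in> ?R"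
    then obtain y where y: "y \<in> X" "b y = col" "V = vertex_of M y" "vertex_of M y \<noteq> vertex_of M e"
      by blast
    have yA: "y \<in> A" using y assms(1) by blast
    have 1: "vertex_of M y - E = V" using other[OF yA y(2,4)] y(3) by blast
    have yv: "y \<in> V" using y(3) vertex_self by blast
    have "V \<noteq> vertex_of M e - E" using yv y(3,4) vertex_eq[OF e(2), of y] by blast
    moreover have "y \<notin> E" using 1 yv by blast
    ultimately show "V \<in> ?L" using 1 y by blast
  qed
qed

text \<open>A component is rooted at the vertex of \<open>e\<close>, so the colour of
  \<open>e\<close> becomes black in it. For \<open>e = f r\<close> the two colours are therefore
  exchanged. The edgeless component fits in because its end vertex has no flags outside
  \<open>E\<close>.\<close>

lemma profile_component:
  assumes e: "e \<in> {r, f r}" and \<rho>: "reach M e \<subseteq> E \<or> \<rho> \<in> vertex_of M e - E"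
  shows "profile (deletion_component M e \<rho>) =
     (card (vertex_of M e - E) div 2,
      degrees_of (vertex_of M ` {y \<in> reach M e. b y = b e} - {vertex_of M e}),
      degrees_of ((\<lambda>y. vertex_of M y - E) ` {y \<in> reach M e - E. b y = (\<not> b e)}))"
proof -
  let ?N = "deletion_component M e \<rho>"
  let ?F = "reach M e - E"
  have N: "flags ?N = ?F" "side ?N = s" "far ?N = f" "corner ?N = corner_deleted M" "root ?N = \<rho>"
    by (simp_all add: deletion_component_def reach_def)
  note eA = E_vertex(2)[OF e]
  have FA: "reach M e \<subseteq> A" using reach_A[OF eA] .
  note vd = vertices_deleted[OF FA e refl]
  have vN: "vertex_of ?N y = vertex_of M y - E" if "y \<in> ?F" for y
    unfolding vertex_of_def[of ?N] N using vertex_deleted that FA by blast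
  show ?thesis
  proof (cases "?F = {}")
    case True
    then have F0: "{y \<in> ?F. P y} = {}" for P by blast
    have "vertex_of M e - E = {}" using vertex_reach[OF eA] True by blast
    moreover have "profile ?N = (0, {#}, {#})" using N True by (simp add: profile_def)
    moreover have "vertex_of M ` {y \<in> reach M e. b y = b e} - {vertex_of M e} = {}"
      using vd[symmetric] unfolding F0 by simp
    ultimately show ?thesis by (simp only: F0) simp
  next
    case False
    then have \<rho>': "\<rho> \<in> vertex_of M e - E" using \<rho> by blast
    then have \<rho>F: "\<rho> \<in> ?F" using vertex_reach[OF eA] by blast
    have bN: "bipartite_map ?N" by (rule component_bipartite[OF eA]) (use \<rho>F in blast)
    have col: "vertex_colouring ?N (\<lambda>y. b y = b e)"
      unfolding vertex_colouring_def N
    proof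
      fix y assume y: "y \<in> ?F"
      then have yA: "y \<in> A" using FA by blast
      have "b (corner_deleted M y) = b y"
        using yA c s b by (auto simp: corner_deleted shortcut_def)
      then show "(b (s y) = b e) = (b y = b e) \<and> (b (corner_deleted M y) = b e) = (b y = b e) \<and>
          (b (f y) = b e) = (b y \<noteq> b e)"
        using b yA by auto
    qed
    have r\<rho>: "b \<rho> = b e" using vertex_colour[OF eA] \<rho>' by blast
    have v\<rho>: "vertex_of ?N \<rho> = vertex_of M e - E"
      using vN[OF \<rho>F] vertex_eq[OF eA, of \<rho>] \<rho>' by simp
    have "profile ?N = (card (vertex_of ?N \<rho>) div 2,
        degrees_of (vertex_of ?N ` {x \<in> ?F. b x = b e} - {vertex_of ?N \<rho>}),
        degrees_of (vertex_of ?N ` {x \<in> ?F. \<not> (b x = b e)}))"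
      using profile_eq[OF bN _ col] N r\<rho> False by simp
    moreover have "vertex_of ?N ` {x \<in> ?F. b x = b e} = (\<lambda>y. vertex_of M y - E) ` {x \<in> ?F. b x = b e}"
      using vN by (intro image_cong) auto
    moreover have "vertex_of ?N ` {x \<in> ?F. \<not> (b x = b e)} =
        (\<lambda>y. vertex_of M y - E) ` {x \<in> ?F. b x = (\<not> b e)}"
      using vN by (intro image_cong) auto
    ultimately show ?thesis using v\<rho> vd by simp
  qed
qed

lemma profile_M:
  "profile M = (card (vertex_of M r) div 2, degrees_of (vertex_of M ` {y \<in> A. b y} - {vertex_of M r}),
     degrees_of (vertex_of M ` {y \<in> A. \<not> b y}))"
  using profile_eq[OF bip ne black] .

lemma root_neighbour: "c (s r) \<notin> E \<Longrightarrow> c (s r) \<in> vertex_of M r - E"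
  "c (f r) \<notin> E \<Longrightarrow> c (f r) \<in> vertex_of M (f r) - E"
  using vertex_c[of "f r"] orbit_step(2)[of "s r" s c r] vertex_s[of r] by (auto simp: vertex_of_def)

lemma profile_root_component:
  "profile (root_component M) =
     (card (vertex_of M r) div 2 - 1,
      degrees_of (vertex_of M ` {y \<in> reach M r. b y} - {vertex_of M r}),
      degrees_of ((\<lambda>y. vertex_of M y - E) ` {y \<in> reach M r - E. \<not> b y}))"
  using profile_component[of r "c (s r)"] component_empty(1) root_neighbour(1) black(2)
    card_vertex_deleted[of r]
  by (auto simp: root_component_def)

lemma profile_other_component:
  "profile (other_component M) =
     (card (vertex_of M (f r)) div 2 - 1,
      degrees_of (vertex_of M ` {y \<in> reach M (f r). \<not> b y} - {vertex_of M (f r)}),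
      degrees_of ((\<lambda>y. vertex_of M y - E) ` {y \<in> reach M (f r) - E. b y}))"
  using profile_component[of "f r" "c (f r)"] component_empty(2) root_neighbour(2) black(2)
    card_vertex_deleted[of "f r"] b(3)[OF r]
  by (auto simp: other_component_def)

lemma root_component_bipartite: "bipartite_map (root_component M)"
  unfolding root_component_def
  by (rule component_bipartite[OF r]) (use component_empty(1) neighbour_reach in blast)

lemma other_component_bipartite: "bipartite_map (other_component M)"
  unfolding other_component_def
  by (rule component_bipartite[OF f(1)[OF r]]) (use component_empty(2) neighbour_reach in blast)

lemma root_component_simps: "flags (root_component M) = reach M r - E"
  "side (root_component M) = s" "far (root_component M) = f"
  "corner (root_component M) = corner_deleted M" "root (root_component M) = c (s r)"
  by (simp_all add: root_component_def deletion_component_def reach_def)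

lemma other_component_simps: "flags (other_component M) = reach M (f r) - E"
  "side (other_component M) = s" "far (other_component M) = f"
  "corner (other_component M) = corner_deleted M" "root (other_component M) = c (f r)"
  by (simp_all add: other_component_def deletion_component_def reach_def)

text \<open>Otherwise an end of the root edge has degree 1. Without a bridge, the edgeless component
  at this end is everything, so the map consists of the root edge alone, but that edge is a
  bridge.\<close>

lemma nonbridge_corner:
  assumes "\<not> root_bridge M" "e \<in> E"
  shows "c e \<notin> E"
proof
  assume *: "c e \<in> E"
  have "c (s r) \<in> E \<or> c (f r) \<in> E"
  proof -
    have ce: "c e = s e" by (rule E_c[OF assms(2) *])
    have "c (s e) = e" using c(3)[of e] ce assms(2) E_A by auto
    then show ?thesis using ce assms(2) s f r by (auto simp: E)
  qed
  then have "A \<subseteq> E" using component_empty nonbridge_reach[OF assms(1)] by auto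
  then have EA: "A = E" using E_A by blast
  have "\<not> root_bridge M \<Longrightarrow> f r \<in> reach M r" using bridge_iff by blast
  then have "f r \<in> reach M r" using assms(1) by blast
  moreover have "reach M r \<subseteq> {r, s r}"
  proof (rule reach_subset)
    show "c y \<in> {r, s r}" if "y \<in> {r, s r}" "y \<in> A" for y
    proof -
      have "c y \<in> E" "b (c y) = b y" "b y" using that c b EA black r by auto
      then show ?thesis using E_black by blast
    qed
  qed (use s r EA in auto)
  ultimately have "f r \<in> {r, s r}" by blast
  then show False using E_colours by auto
qed

text \<open>The white end of degree \<open>j + 1\<close> becomes a vertex of degree
  \<open>j\<close>, and by \<open>nonbridge_corner\<close> neither end loses its last edge. The
  formula for \<open>j\<close> allows the profile of the map to be recovered from that of its
  deletion and the place of attachment.\<close>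

lemma profile_nonbridge:
  assumes nb: "\<not> root_bridge M" and p: "profile M = (i, \<mu>, \<nu>)"
  shows "\<exists>j \<nu>'. j = card (vertex_of M (f r) - E) div 2 \<and> 1 \<le> j \<and> \<nu> = add_mset (j + 1) \<nu>' \<and> 2 \<le> i \<and>
     profile (root_component M) = (i - 1, \<mu>, add_mset j \<nu>')"
proof -
  let ?u = "vertex_of M (f r)"
  let ?W = "vertex_of M ` {y \<in> A. \<not> b y}"
  let ?S = "(\<lambda>y. vertex_of M y - E) ` {y \<in> A - E. \<not> b y}"
  note R = nonbridge_reach[OF nb]
  have fr: "f r \<in> A" "\<not> b (f r)" using f b r black by auto
  have vd: "?S - {?u - E} = ?W - {?u}"
    using vertices_deleted[of A "f r" False] fr(2) by simp
  have cf: "c (f r) \<in> ?u - E" using root_neighbour(2) nonbridge_corner[OF nb] by (simp add: E)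
  have cs: "c (s r) \<in> vertex_of M r - E" using root_neighbour(1) nonbridge_corner[OF nb] by (simp add: E)
  have "?u - E \<in> ?S"
  proof -
    have "c (f r) \<in> {y \<in> A - E. \<not> b y}" using cf fr c b by auto
    moreover have "vertex_of M (c (f r)) = ?u" using vertex_eq[OF fr(1)] vertex_c by blast
    ultimately show ?thesis by (metis (mono_tags, lifting) imageI)
  qed
  then have "?S = insert (?u - E) (?W - {?u})" using vd by blast
  moreover have "?u - E \<notin> ?W - {?u}" using vd by blast
  ultimately have S: "mset_set ?S = add_mset (?u - E) (mset_set (?W - {?u}))"
    using fin by simp
  have "?u \<in> ?W" using fr by blast
  then have W: "mset_set ?W = add_mset ?u (mset_set (?W - {?u}))"
    by (intro mset_set.remove) (use fin in auto)
  have pos: "2 \<le> card (vertex_of M e)" "card (vertex_of M e) div 2 = card (vertex_of M e - E) div 2 + 1"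
     "1 \<le> card (vertex_of M e - E) div 2" if e: "e \<in> {r, f r}" for e
  proof -
    note cd = card_vertex_deleted[OF e] and eA = E_vertex(2)[OF e]
    show "2 \<le> card (vertex_of M e)" by (rule cd(2))
    show "card (vertex_of M e) div 2 = card (vertex_of M e - E) div 2 + 1" using cd by linarith
    have "c (s r) \<in> vertex_of M r - E" "c (f r) \<in> ?u - E" using cf cs by auto
    then have "vertex_of M e - E \<noteq> {}" using e by auto
    then have "card (vertex_of M e - E) \<noteq> 0" using finite_vertex[OF eA] by simp
    moreover have "even (card (vertex_of M e - E))"
    proof -
      have "card (vertex_of M e \<inter> E) = 2" using E_vertex[OF e] s by (simp add: card_2_iff')
      then have "card (vertex_of M e - E) = card (vertex_of M e) - 2"
        using finite_vertex[OF eA] by (simp add: card_Diff_subset_Int)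
      then show ?thesis using even_vertex[OF eA] by simp
    qed
    ultimately show "1 \<le> card (vertex_of M e - E) div 2" by presburger
  qed
  let ?j = "card (?u - E) div 2" and ?n = "degrees_of (?W - {?u})"
  have "\<nu> = add_mset (card ?u div 2) ?n" using p profile_M W by simp
  then have "\<nu> = add_mset (?j + 1) ?n" using pos(2)[of "f r"] by simp
  moreover have "2 \<le> i" using p profile_M pos(2,3)[of r] by simp
  moreover have "profile (root_component M) = (i - 1, \<mu>, add_mset ?j ?n)"
    using profile_root_component p profile_M R S by simp
  moreover have "1 \<le> ?j" using pos(3)[of "f r"] by simp
  ultimately show ?thesis by blast
qed

text \<open>Every vertex other than the two ends lies in one of the components and keeps its degree.
  The second component is rooted at the white end, whence the exchanged order in
  \<open>(j, \<nu>2, \<mu>2)\<close>; \<open>j = 0\<close> occurs when it is a single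
  vertex.\<close>

lemma profile_bridge:
  assumes br: "root_bridge M" and p: "profile M = (i, \<mu>, \<nu>)"
  shows "\<exists>j \<mu>1 \<nu>1 \<mu>2 \<nu>2. \<mu> = \<mu>1 + \<mu>2 \<and> \<nu> = add_mset (j + 1) (\<nu>1 + \<nu>2) \<and> 1 \<le> i \<and>
     profile (root_component M) = (i - 1, \<mu>1, \<nu>1) \<and> profile (other_component M) = (j, \<nu>2, \<mu>2)"
proof -
  let ?v = "vertex_of M r" and ?u = "vertex_of M (f r)"
  let ?R = "reach M r" and ?T = "reach M (f r)"
  note disj = bridge_disjoint[OF br]
  have fr: "f r \<in> A" "\<not> b (f r)" using f b r black by auto
  have RA: "?R \<subseteq> A" "?T \<subseteq> A" using reach_A r fr by auto
  define B1 where "B1 = vertex_of M ` {y \<in> ?R. b y} - {?v}"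
  define B2 where "B2 = vertex_of M ` {y \<in> ?T. b y}"
  define W1 where "W1 = vertex_of M ` {y \<in> ?R. \<not> b y}"
  define W2 where "W2 = vertex_of M ` {y \<in> ?T. \<not> b y} - {?u}"
  have finB: "finite B1" "finite B2" "finite W1" "finite W2"
    using RA fin by (auto simp: B1_def B2_def W1_def W2_def finite_subset)
  have sub: "V \<subseteq> ?R" if "V \<in> vertex_of M ` {y \<in> ?R. P y}" for V P
    using that vertex_reach reach_eq[OF r] RA by blast
  have subT: "V \<subseteq> ?T" if "V \<in> vertex_of M ` {y \<in> ?T. P y}" for V P
    using that vertex_reach reach_eq[OF fr(1)] RA by blast
  have nonempty: "V \<noteq> {}" if "V \<in> vertex_of M ` X" for V X using that vertex_self by blast
  have vR: "?v \<subseteq> ?R" and uT: "?u \<subseteq> ?T" using vertex_reach r fr by auto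
  have vne: "?v \<noteq> {}" "?u \<noteq> {}" using vertex_self by blast+
  have B: "V \<subseteq> ?R \<and> V \<noteq> {}" if "V \<in> B1 \<or> V \<in> W1" for V
  proof -
    have "V \<in> vertex_of M ` {y \<in> ?R. b y} \<or> V \<in> vertex_of M ` {y \<in> ?R. \<not> b y}"
      using that by (simp only: B1_def W1_def Diff_iff) (elim disjE conjE; simp only: simp_thms)
    then show ?thesis using sub nonempty by (elim disjE) (rule conjI; assumption | simp)+
  qed
  have T: "V \<subseteq> ?T \<and> V \<noteq> {}" if "V \<in> B2 \<or> V \<in> W2" for V
  proof -
    have "V \<in> vertex_of M ` {y \<in> ?T. b y} \<or> V \<in> vertex_of M ` {y \<in> ?T. \<not> b y}"
      using that by (simp only: B2_def W2_def Diff_iff) (elim disjE conjE; simp only: simp_thms)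
    then show ?thesis using subT nonempty by (elim disjE) (rule conjI; assumption | simp)+
  qed
  have d: "B1 \<inter> B2 = {}" "W1 \<inter> W2 = {}" "?v \<notin> B2" "?u \<notin> W1"
    using B T disj vR uT vne by blast+
  have "vertex_of M ` {y \<in> A. b y} - {?v} = B1 \<union> B2"
    using reach_cover d(3) by (auto simp: B1_def B2_def)
  then have M1: "degrees_of (vertex_of M ` {y \<in> A. b y} - {?v}) = degrees_of B1 + degrees_of B2"
    using d finB by (simp add: mset_set_Union)
  have "?u \<in> vertex_of M ` {y \<in> ?T. \<not> b y}" using fr reach_self by blast
  then have "vertex_of M ` {y \<in> A. \<not> b y} = insert ?u (W1 \<union> W2)"
    using reach_cover by (auto simp: W1_def W2_def)
  moreover have "?u \<notin> W1 \<union> W2" using d(4) by (simp add: W2_def)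
  ultimately have M2: "degrees_of (vertex_of M ` {y \<in> A. \<not> b y}) =
      add_mset (card ?u div 2) (degrees_of W1 + degrees_of W2)"
    using d finB by (simp add: mset_set_Union)
  have "(\<lambda>y. vertex_of M y - E) ` {y \<in> ?R - E. \<not> b y} = W1"
  proof -
    have "vertex_of M y - E = vertex_of M y" "y \<notin> E" if "y \<in> ?R" "\<not> b y" for y
    proof -
      have yA: "y \<in> A" using RA that by blast
      have "x \<notin> E" if x: "x \<in> vertex_of M y" for x
      proof
        assume "x \<in> E"
        then have "x \<in> ?u"
          using vertex_colour[OF yA x] \<open>\<not> b y\<close> E_white[of x] vertex_self vertex_s by blast
        moreover have "x \<in> ?R" using sub[of "vertex_of M y" "\<lambda>_. True"] x \<open>y \<in> ?R\<close> by blast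
        ultimately show False using uT disj by blast
      qed
      then show "vertex_of M y - E = vertex_of M y" "y \<notin> E" using vertex_self by blast+
    qed
    then show ?thesis unfolding W1_def by (auto intro!: image_cong)
  qed
  moreover have "(\<lambda>y. vertex_of M y - E) ` {y \<in> ?T - E. b y} = B2"
  proof -
    have "vertex_of M y - E = vertex_of M y" "y \<notin> E" if "y \<in> ?T" "b y" for y
    proof -
      have yA: "y \<in> A" using RA that by blast
      have "x \<notin> E" if x: "x \<in> vertex_of M y" for x
      proof
        assume "x \<in> E"
        then have "x \<in> ?v"
          using vertex_colour[OF yA x] \<open>b y\<close> E_black[of x] vertex_self vertex_s by blast
        moreover have "x \<in> ?T" using subT[of "vertex_of M y" "\<lambda>_. True"] x \<open>y \<in> ?T\<close> by blast
        ultimately show False using vR disj by blast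
      qed
      then show "vertex_of M y - E = vertex_of M y" "y \<notin> E" using vertex_self by blast+
    qed
    then show ?thesis unfolding B2_def by (auto intro!: image_cong)
  qed
  ultimately have
    "profile (root_component M) = (i - 1, degrees_of B1, degrees_of W1)"
    "profile (other_component M) = (card ?u div 2 - 1, degrees_of W2, degrees_of B2)"
    using profile_root_component profile_other_component p profile_M
    by (simp_all add: B1_def W2_def)
  moreover have "card ?u div 2 = card ?u div 2 - 1 + 1" "1 \<le> i"
    using card_vertex_deleted(2)[of "f r"] card_vertex_deleted(2)[of r] p profile_M by auto
  moreover have "\<mu> = degrees_of B1 + degrees_of B2"
    "\<nu> = add_mset (card ?u div 2) (degrees_of W1 + degrees_of W2)"
    using p profile_M M1 M2 by simp_all
  ultimately show ?thesis
    by (intro exI[of _ "card ?u div 2 - 1"] exI[of _ "degrees_of B1"] exI[of _ "degrees_of W1"]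
        exI[of _ "degrees_of B2"] exI[of _ "degrees_of W2"]) simp
qed

end

section \<open>Twisting the root edge\<close>

lemma abs_eq_iff:
  assumes "bipartite_map M" "bipartite_map N"
  shows "abs_rooted_map M = abs_rooted_map N \<longleftrightarrow> (\<exists>h. flag_iso h M N)"
proof -
  have refl: "map_iso L L" if "bipartite_map L" for L
  proof -
    have "flag_iso id L L" by (simp add: flag_iso_def)
    then show ?thesis unfolding map_iso_def using that by blast
  qed
  show ?thesis
    using Quotient3_rel[OF Quotient3_rooted_map, of M N] refl assms
    by (auto simp: map_iso_def)
qed

text \<open>Records with the same flags may still have different values of \<open>side\<close>,
  \<open>far\<close> and \<open>corner\<close> elsewhere, so agreement yields an isomorphism rather
  than an equation.\<close>

lemma flag_iso_cong:
  assumes "flags N = flags M" "flags M \<noteq> {} \<Longrightarrow> root N = root M"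
    "\<And>x. x \<in> flags M \<Longrightarrow> side N x = side M x" "\<And>x. x \<in> flags M \<Longrightarrow> far N x = far M x"
    "\<And>x. x \<in> flags M \<Longrightarrow> corner N x = corner M x"
  shows "flag_iso id M N"
  using assms by (simp add: flag_iso_def)

lemma measureD:
  assumes "measure_of_non_orientability \<eta>" "bipartite_map M" "flags M \<noteq> {}"
  shows "root_bridge M \<Longrightarrow> \<eta> (abs_rooted_map M) =
      \<eta> (abs_rooted_map (root_component M)) + \<eta> (abs_rooted_map (other_component M))"
    and "root_border M \<Longrightarrow> \<eta> (abs_rooted_map M) = \<eta> (abs_rooted_map (root_component M))"
    and "root_twisted M \<Longrightarrow> \<eta> (abs_rooted_map M) = \<eta> (abs_rooted_map (root_component M)) + 1"
    and "root_handle M \<Longrightarrow> {\<eta> (abs_rooted_map M), \<eta> (abs_rooted_map (twist_root M))} =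
      {\<eta> (abs_rooted_map (root_component M)), \<eta> (abs_rooted_map (root_component M)) + 1}"
  using assms(1)[unfolded measure_of_non_orientability_def Let_def, rule_format, OF assms(2)] assms(3)
  by (simp_all only: if_False simp_thms)

context edged_map
begin

lemma twist_simps: "flags (twist_root M) = A" "side (twist_root M) = s" "corner (twist_root M) = c"
  "root (twist_root M) = r" "far (twist_root M) x = (if x \<in> E then s (f x) else f x)"
  by (simp_all add: twist_root_def)

lemma E_sf: "e \<in> E \<Longrightarrow> s (f e) \<in> E" "e \<in> E \<Longrightarrow> s (f (s (f e))) = e"
  using E_s E_f E_A s f sf(1) by (metis subsetD)+

lemma twist_far_inv: "free_involution A (far (twist_root M))"
  unfolding free_involution_def twist_simps
proof (intro ballI conjI)
  fix x assume x: "x \<in> A"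
  show "(if x \<in> E then s (f x) else f x) \<in> A" using x s f by simp
  show "(if x \<in> E then s (f x) else f x) \<noteq> x" using x f sf by simp
  have "x \<notin> E \<Longrightarrow> f x \<notin> E" using E_f[of "f x"] f x by auto
  then show "(if (if x \<in> E then s (f x) else f x) \<in> E
       then s (f (if x \<in> E then s (f x) else f x)) else f (if x \<in> E then s (f x) else f x)) = x"
    using E_sf x f by simp
qed

lemma twist_root_edge: "root_edge (twist_root M) = E"
  using r f s by (auto simp: root_edge_def[of "twist_root M"] twist_simps E)

lemma twist_bipartite: "bipartite_map (twist_root M)"
proof -
  let ?T = "twist_root M"
  \<comment> \<open>The twist is undone by a further \<open>side\<close> step, so sets closed under
    the steps of \<open>?T\<close> are closed under those of \<open>M\<close>.\<close>
  have f_T: "f x = (if x \<in> E then s (far ?T x) else far ?T x)" if "x \<in> A" for x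
    using that s f by (simp add: twist_simps)
  have conn: "connected_avoiding {} ?T"
    unfolding connected_avoiding_def twist_simps
  proof (intro ballI)
    fix x y assume x: "x \<in> A" and y: "y \<in> A"
    let ?B = "(steps_avoiding {} ?T)\<^sup>* `` {x}"
    have step: "s z \<in> ?B" "c z \<in> ?B" "far ?T z \<in> ?B" if "z \<in> ?B" "z \<in> A" for z
      using that by (auto simp: steps_avoiding_def twist_simps intro: rtrancl_into_rtrancl)
    have "A \<subseteq> ?B"
    proof (rule connected_subset[of x])
      fix z assume z: "z \<in> ?B" "z \<in> A"
      have "far ?T z \<in> A" using twist_far_inv z by (simp add: free_involution_def)
      then have "s (far ?T z) \<in> ?B" using step z by blast
      then show "f z \<in> ?B" unfolding f_T[OF z(2)] using step(3) z by simp
    qed (use x step in auto)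
    then show "(x, y) \<in> (steps_avoiding {} ?T)\<^sup>*" using y by blast
  qed
  have col: "vertex_colouring ?T b"
    unfolding vertex_colouring_def twist_simps using b s f by auto
  have "\<forall>x\<in>A. s (far ?T x) = far ?T (s x) \<and> s (far ?T x) \<noteq> x"
  proof
    fix x assume x: "x \<in> A"
    have "s x \<in> E \<longleftrightarrow> x \<in> E" using E_s[of x] E_s[of "s x"] s x by auto
    then show "s (far ?T x) = far ?T (s x) \<and> s (far ?T x) \<noteq> x"
      using x s f sf(2) sf(1)[OF x] by (auto simp: twist_simps)
  qed
  then show ?thesis
    unfolding bipartite_map_def
    using twist_simps(1-4) conn col twist_far_inv s_inv c_inv fin r by auto
qed

lemma twist_steps: "steps_avoiding E (twist_root M) = steps_avoiding E M"
  by (auto simp: steps_avoiding_def twist_simps)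

lemma twist_bridge: "root_bridge (twist_root M) = root_bridge M"
  by (simp add: root_bridge_def connected_avoiding_def twist_root_edge twist_steps twist_simps)

lemma twist_edged: "edged_map (twist_root M)"
  using twist_bipartite ne twist_simps by unfold_locales simp_all

lemma twist_component_iso: "flag_iso id (root_component M) (root_component (twist_root M))"
proof -
  interpret T: edged_map "twist_root M" by (rule twist_edged)
  have "corner_deleted (twist_root M) = corner_deleted M"
    unfolding corner_deleted T.corner_deleted twist_simps twist_root_edge ..
  moreover have "reach (twist_root M) r = reach M r"
    unfolding reach_def twist_root_edge twist_steps ..
  ultimately show ?thesis
    by (intro flag_iso_cong)
      (simp_all add: root_component_simps T.root_component_simps twist_root_edge twist_simps)
qed

lemma twist_component: "abs_rooted_map (root_component (twist_root M)) = abs_rooted_map (root_component M)"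
  using twist_component_iso
    abs_eq_iff[OF root_component_bipartite edged_map.root_component_bipartite[OF twist_edged]] by metis

text \<open>With the root edge cut out, the faces of the three maps are orbits on the same set
  \<open>A - E\<close>, formed by \<open>f\<close> and by \<open>?c1\<close> for the map,
  \<open>?c2\<close> for its deletion and \<open>?c3\<close> for its twist. A face walk that meets
  the edge is continued across it along \<open>far\<close>, \<open>side\<close> or the twisted
  \<open>far\<close>; this is the situation of \<open>three_matchings\<close>.\<close>

lemma faces_trichotomy:
  assumes nb: "\<not> root_bridge M"
  shows "num_faces M = num_faces (root_component M) + 1 \<and> num_faces (twist_root M) = num_faces (root_component M) \<or>
    num_faces (root_component M) = num_faces M + 1 \<and> num_faces (twist_root M) = num_faces M \<or>
    num_faces (twist_root M) = num_faces M + 1 \<and> num_faces (root_component M) = num_faces M"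
proof -
  let ?T = "twist_root M"
  let ?fT = "far ?T"
  let ?c1 = "shortcut E f c" and ?c2 = "shortcut E s c" and ?c3 = "shortcut E ?fT c"
  note cE = nonbridge_corner[OF nb]
  have fT_E: "?fT e \<in> E" if "e \<in> E" for e using that E_sf by (simp add: twist_simps)
  have inv: "free_involution (A - E) ?c1" "free_involution (A - E) ?c2" "free_involution (A - E) ?c3"
    using free_involution_shortcut[OF f_inv c_inv E_A E_f] cE
      free_involution_shortcut[OF s_inv c_inv E_A E_s]
      free_involution_shortcut[OF twist_far_inv c_inv E_A fT_E] by blast+
  have fA0: "free_involution (A - E) f" using free_involution_Diff[OF f_inv E_f] .
  have memE: "r \<in> E" "s r \<in> E" "f r \<in> E" "s (f r) \<in> E" by (simp_all add: E)
  \<comment> \<open>The four flags that face the removed edge across a corner; only here do the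
    three involutions differ.\<close>
  let ?Q = "{c r, c (f r), c (s r), c (s (f r))}"
  have Qc: "?Q = c ` E" by (auto simp: E)
  have inA0: "c e \<in> A - E" if "e \<in> E" for e using that cE E_A c by auto
  have dist: "card E = 4"
  proof -
    have "r \<noteq> f r" "s r \<noteq> f r" "r \<noteq> s (f r)" "s r \<noteq> s (f r)"
      using E_colours by metis+
    moreover have "s r \<noteq> r" "s (f r) \<noteq> f r" using s f r by auto
    ultimately show ?thesis by (simp add: E)
  qed
  have "inj_on c E" using c_inv E_A by (metis bij_betw_def free_involution_bij_betw inj_on_subset)
  then have cardQ: "card ?Q = 4" unfolding Qc by (simp add: card_image dist)
  have off: "?c2 x = ?c1 x" "?c3 x = ?c1 x" if "x \<in> A - E - ?Q" for x
  proof -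
    have "c x \<notin> E"
    proof
      assume "c x \<in> E"
      then have "c (c x) \<in> ?Q" unfolding Qc by blast
      then show False using c that by simp
    qed
    then show "?c2 x = ?c1 x" "?c3 x = ?c1 x" by (simp_all add: shortcut_def)
  qed
  have sc: "shortcut E g c (c e) = c (g e)" if "e \<in> E" for e g
    using that c E_A by (auto simp: shortcut_def)
  have "finite (A - E)" using fin by simp
  note three_matchings[OF this fA0 inv off refl _ cardQ]
  moreover have "?Q \<subseteq> A - E" using inA0 memE by blast
  moreover have "?c1 (c r) = c (f r)" "?c1 (c (s r)) = c (s (f r))" "?c2 (c r) = c (s r)"
    "?c2 (c (f r)) = c (s (f r))" "?c3 (c r) = c (s (f r))" "?c3 (c (f r)) = c (s r)"
    using memE r s f sf(1)[OF r] by (simp_all add: sc twist_simps)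
  ultimately have tri: "let n = (\<lambda>c. card (orbit f c ` (A - E))) in
     n ?c1 = n ?c2 + 1 \<and> n ?c3 = n ?c2 \<or> n ?c2 = n ?c1 + 1 \<and> n ?c3 = n ?c1 \<or>
     n ?c3 = n ?c1 + 1 \<and> n ?c2 = n ?c1"
    unfolding Let_def by blast
  have 1: "num_faces M = card (orbit f ?c1 ` (A - E))"
    using card_orbits_shortcut[OF f_inv c_inv E_A E_f cE] ne
    by (simp add: num_faces_def face_of_def[abs_def])
  have 3: "num_faces ?T = card (orbit f ?c3 ` (A - E))"
  proof -
    have "num_faces ?T = card (orbit ?fT c ` A)"
      using ne by (simp add: num_faces_def face_of_def[abs_def] twist_simps)
    also have "\<dots> = card (orbit ?fT ?c3 ` (A - E))"
      using card_orbits_shortcut[OF twist_far_inv c_inv E_A fT_E cE] by simp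
    also have "orbit ?fT ?c3 ` (A - E) = orbit f ?c3 ` (A - E)"
      using fA0 inv(3)
      by (intro image_cong orbit_cong[where A = "A - E"]) (auto simp: twist_simps free_involution_def)
    finally show ?thesis .
  qed
  have "A - E \<noteq> {}" using inA0 memE by blast
  then have 2: "num_faces (root_component M) = card (orbit f ?c2 ` (A - E))"
    using nonbridge_reach[OF nb]
    by (simp add: num_faces_def face_of_def[abs_def] root_component_simps corner_deleted)
  show ?thesis using tri unfolding 1 2 3 Let_def by blast
qed

text \<open>By \<open>faces_trichotomy\<close> one of the two maps has a border and the other a
  twisted root edge, or both have handles. In the last case \<eta> decides which of them gets the
  larger value, but the sum is symmetric in the two values.\<close>

lemma measure_twist:
  fixes \<beta> :: "'a :: comm_ring_1"
  assumes \<eta>: "measure_of_non_orientability \<eta>" and nb: "\<not> root_bridge M"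
  shows "\<beta> ^ \<eta> (abs_rooted_map M) + \<beta> ^ \<eta> (abs_rooted_map (twist_root M)) =
     (1 + \<beta>) * \<beta> ^ \<eta> (abs_rooted_map (root_component M))"
proof -
  let ?m = "\<eta> (abs_rooted_map M)" and ?m' = "\<eta> (abs_rooted_map (twist_root M))"
  let ?d = "\<eta> (abs_rooted_map (root_component M))"
  have M: "(root_border M \<longrightarrow> ?m = ?d) \<and> (root_twisted M \<longrightarrow> ?m = ?d + 1) \<and>
      (root_handle M \<longrightarrow> {?m, ?m'} = {?d, ?d + 1})"
    using measureD(2-4)[OF \<eta> bip ne] by blast
  have T: "(root_border (twist_root M) \<longrightarrow> ?m' = ?d) \<and> (root_twisted (twist_root M) \<longrightarrow> ?m' = ?d + 1)"
    using measureD(2,3)[OF \<eta> twist_bipartite] ne twist_component twist_simps(1) by simp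
  \<comment> \<open>The two deletions are isomorphic, but as records they differ in
    \<open>far\<close> on the removed edge, so their numbers of faces are compared through the
    orbits on \<open>A - E\<close>.\<close>
  have comp: "num_faces (root_component (twist_root M)) = num_faces (root_component M)"
  proof -
    interpret T: edged_map "twist_root M" by (rule twist_edged)
    have R: "reach (twist_root M) r = reach M r"
      unfolding reach_def twist_root_edge twist_steps ..
    have nbT: "\<not> root_bridge (twist_root M)" using nb twist_bridge by simp
    have "corner_deleted (twist_root M) = corner_deleted M"
      unfolding corner_deleted T.corner_deleted twist_simps twist_root_edge ..
    moreover have "orbit (far (twist_root M)) (corner_deleted M) ` (A - E) = orbit f (corner_deleted M) ` (A - E)"
      using free_involution_Diff[OF f_inv E_f] deleted_inv
      by (intro image_cong orbit_cong[where A = "A - E"]) (auto simp: twist_simps free_involution_def)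
    ultimately show ?thesis
      using R nonbridge_reach[OF nb]
      by (simp add: num_faces_def face_of_def[abs_def] root_component_simps T.root_component_simps
          twist_root_edge twist_simps(1,4))
  qed
  have "?m = ?d \<and> ?m' = ?d + 1 \<or> ?m = ?d + 1 \<and> ?m' = ?d"
    using faces_trichotomy[OF nb]
  proof (elim disjE conjE)
    assume "num_faces M = num_faces (root_component M) + 1" "num_faces (twist_root M) = num_faces (root_component M)"
    then have "root_border M" "root_twisted (twist_root M)"
      using nb twist_bridge comp by (simp_all add: root_border_def root_twisted_def)
    then show ?thesis using M T by blast
  next
    assume "num_faces (root_component M) = num_faces M + 1"
    then have "root_handle M" using nb by (simp add: root_handle_def)
    then have "{?m, ?m'} = {?d, ?d + 1}" using M by blast
    then show ?thesis by (auto simp: doubleton_eq_iff)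
  next
    assume "num_faces (twist_root M) = num_faces M + 1" "num_faces (root_component M) = num_faces M"
    then have "root_twisted M" "root_border (twist_root M)"
      using nb twist_bridge comp by (simp_all add: root_border_def root_twisted_def)
    then show ?thesis using M T by blast
  qed
  then show ?thesis by (auto simp: algebra_simps)
qed

lemma measure_bridge:
  assumes "measure_of_non_orientability \<eta>" "root_bridge M"
  shows "\<eta> (abs_rooted_map M) = \<eta> (abs_rooted_map (root_component M)) + \<eta> (abs_rooted_map (other_component M))"
  using measureD(1)[OF assms(1) bip ne assms(2)] .

end

section \<open>Isomorphisms\<close>

locale iso_maps = M: edged_map M + N: edged_map N for M N +
  fixes h :: "nat \<Rightarrow> nat"
  assumes iso: "flag_iso h M N"
begin

lemma h: "x \<in> flags M \<Longrightarrow> h (side M x) = side N (h x)" "x \<in> flags M \<Longrightarrow> h (far M x) = far N (h x)"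
  "x \<in> flags M \<Longrightarrow> h (corner M x) = corner N (h x)" "h (root M) = root N"
  "x \<in> flags M \<Longrightarrow> h x \<in> flags N"
  using iso M.ne by (auto simp: flag_iso_def bij_betw_def)

lemma h_inj: "inj_on h (flags M)" and h_img: "h ` flags M = flags N"
  using iso by (auto simp: flag_iso_def bij_betw_def)

lemma h_root_edge: "h ` root_edge M = root_edge N"
  using h M.r M.s M.f by (simp add: root_edge_def)

lemma h_root_edge_iff: "x \<in> flags M \<Longrightarrow> h x \<in> root_edge N \<longleftrightarrow> x \<in> root_edge M"
  unfolding h_root_edge[symmetric] using h_inj M.E_A by (auto dest: inj_onD)

lemma h_corner_deleted: "x \<in> flags M \<Longrightarrow> h (corner_deleted M x) = corner_deleted N (h x)"
  using h M.c(1) M.s(1) h_root_edge_iff[of "corner M x"]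
  by (simp add: M.corner_deleted N.corner_deleted shortcut_def)

lemma inverse: "iso_maps N M (the_inv_into (flags M) h)"
  using flag_iso_inverse[OF M.bip iso] by unfold_locales

lemma h_orbit:
  assumes "x \<in> flags M" "free_involution (flags M) f" "free_involution (flags M) g"
    "\<And>y. y \<in> flags M \<Longrightarrow> h (f y) = f' (h y)" "\<And>y. y \<in> flags M \<Longrightarrow> h (g y) = g' (h y)"
  shows "orbit f' g' (h x) = h ` orbit f g x"
proof
  have A: "orbit f g x \<subseteq> flags M" by (rule orbit_in[OF assms(2,3,1)])
  show "orbit f' g' (h x) \<subseteq> h ` orbit f g x"
  proof (rule orbit_subset)
    show "h x \<in> h ` orbit f g x" using orbit_self by (rule imageI)
    fix y assume "y \<in> h ` orbit f g x"
    then obtain z where z: "y = h z" "z \<in> orbit f g x" by blast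
    then have "f' y = h (f z)" "g' y = h (g z)" using assms(4,5) A by auto
    then show "f' y \<in> h ` orbit f g x" "g' y \<in> h ` orbit f g x" using orbit_step[OF z(2)] by auto
  qed
  have "orbit f g x \<subseteq> {z \<in> flags M. h z \<in> orbit f' g' (h x)}"
    using assms by (intro orbit_subset) (auto simp: orbit_self free_involution_def intro: orbit_step)
  then show "h ` orbit f g x \<subseteq> orbit f' g' (h x)" by blast
qed

lemma h_vertex: "x \<in> flags M \<Longrightarrow> vertex_of N (h x) = h ` vertex_of M x"
  unfolding vertex_of_def by (rule h_orbit) (use M.s_inv M.c_inv h in auto)

lemma h_reach_subset:
  assumes "x \<in> flags M"
  shows "h ` reach M x \<subseteq> reach N (h x)"
proof -
  have "reach M x \<subseteq> {z \<in> flags M. h z \<in> reach N (h x)}"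
  proof (rule M.reach_subset)
    show "x \<in> {z \<in> flags M. h z \<in> reach N (h x)}" using assms N.reach_self by simp
    fix y assume "y \<in> {z \<in> flags M. h z \<in> reach N (h x)}"
    then have y: "y \<in> flags M" "h y \<in> reach N (h x)" by auto
    show "side M y \<in> {z \<in> flags M. h z \<in> reach N (h x)}" "corner M y \<in> {z \<in> flags M. h z \<in> reach N (h x)}"
      using y h M.s M.c N.reach_step by auto
    assume "y \<notin> root_edge M"
    then have "h y \<notin> root_edge N" using h_root_edge_iff y by blast
    then show "far M y \<in> {z \<in> flags M. h z \<in> reach N (h x)}"
      using y h M.f N.reach_step by auto
  qed
  then show ?thesis by blast
qed

lemma h_reach:
  assumes x: "x \<in> flags M"
  shows "h ` reach M x = reach N (h x)"
proof
  show "h ` reach M x \<subseteq> reach N (h x)" by (rule h_reach_subset[OF x])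
  let ?g = "the_inv_into (flags M) h"
  interpret I: iso_maps N M ?g by (rule inverse)
  have gh: "?g (h x) = x" using x h_inj by (rule the_inv_into_f_f[rotated])
  have "?g ` reach N (h x) \<subseteq> reach M x" using I.h_reach_subset[OF h(5)[OF x]] gh by simp
  then have "h ` ?g ` reach N (h x) \<subseteq> h ` reach M x" by blast
  moreover have "h (?g y) = y" if "y \<in> reach N (h x)" for y
    using f_the_inv_into_f[OF h_inj, of y] h_img N.reach_A[OF h(5)[OF x]] that by blast
  ultimately show "reach N (h x) \<subseteq> h ` reach M x" by (force simp: image_image)
qed

lemma h_bridge: "root_bridge N = root_bridge M"
proof -
  have "far N (root N) \<in> reach N (root N) \<longleftrightarrow> h (far M (root M)) \<in> h ` reach M (root M)"
    using h M.r h_reach[OF M.r] by simp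
  also have "\<dots> \<longleftrightarrow> far M (root M) \<in> reach M (root M)"
    using inj_on_image_mem_iff[OF h_inj _ M.reach_A[OF M.r]] M.f(1)[OF M.r] by blast
  finally show ?thesis unfolding M.bridge_iff N.bridge_iff by simp
qed

lemma h_component:
  assumes "x \<in> flags M" "\<rho> \<in> flags M"
  shows "flag_iso h (deletion_component M x \<rho>) (deletion_component N (h x) (h \<rho>))"
proof -
  have A: "reach M x \<subseteq> flags M" by (rule M.reach_A[OF assms(1)])
  have "h ` (reach M x - root_edge M) = reach N (h x) - root_edge N"
  proof -
    have "reach M x - root_edge M \<subseteq> flags M" using A by blast
    from inj_on_image_set_diff[OF h_inj this M.E_A] show ?thesis
      using h_reach[OF assms(1)] h_root_edge by simp
  qed
  moreover have "inj_on h (reach M x - root_edge M)" by (rule inj_on_subset[OF h_inj]) (use A in blast)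
  moreover have "y \<in> flags M" if "y \<in> reach M x" for y using A that by blast
  ultimately show ?thesis
    using h h_corner_deleted
    unfolding flag_iso_def deletion_component_def reach_def[symmetric]
    by (simp add: bij_betw_def)
qed

lemma h_root_component: "flag_iso h (root_component M) (root_component N)"
  unfolding root_component_def
  using h_component[OF M.r, of "corner M (side M (root M))"] h M.r M.s M.c by simp

lemma h_other_component: "flag_iso h (other_component M) (other_component N)"
  unfolding other_component_def
  using h_component[of "far M (root M)" "corner M (far M (root M))"] h M.r M.f M.c by simp

lemma degrees_image:
  assumes "X \<subseteq> flags M"
  shows "degrees_of (vertex_of N ` h ` X - {vertex_of N (root N)}) = degrees_of (vertex_of M ` X - {vertex_of M (root M)})"
    "degrees_of (vertex_of N ` h ` X) = degrees_of (vertex_of M ` X)"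
proof -
  let ?S = "vertex_of M ` flags M"
  have sub: "V \<subseteq> flags M" if "V \<in> ?S" for V using that M.vertex_A by blast
  have inj: "inj_on ((`) h) ?S"
  proof (rule inj_onI)
    fix U V assume "U \<in> ?S" "V \<in> ?S" "h ` U = h ` V"
    then show "U = V" using inj_on_image_eq_iff[OF h_inj] sub by metis
  qed
  have img: "vertex_of N ` h ` Y = (`) h ` vertex_of M ` Y" if "Y \<subseteq> flags M" for Y
    using that h_vertex by (auto simp: image_image subset_iff)
  have deg: "degrees_of ((`) h ` T) = degrees_of T" if "T \<subseteq> ?S" for T
  proof -
    have "mset_set ((`) h ` T) = image_mset ((`) h) (mset_set T)"
      using inj that by (intro image_mset_mset_set[symmetric]) (rule inj_on_subset)
    moreover have "card (h ` V) = card V" if "V \<in> T" for V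
      using sub[of V] that \<open>T \<subseteq> ?S\<close> h_inj by (metis card_image inj_on_subset subsetD)
    moreover have "finite T" using that M.fin finite_subset by blast
    moreover from calculation have "image_mset (\<lambda>V. card (h ` V) div 2) (mset_set T) = degrees_of T"
      by (intro image_mset_cong) simp
    ultimately show ?thesis by (simp add: multiset.map_comp o_def)
  qed
  have XS: "vertex_of M ` X \<subseteq> ?S" using assms by blast
  show "degrees_of (vertex_of N ` h ` X) = degrees_of (vertex_of M ` X)"
    using deg[OF XS] img[OF assms] by simp
  have "vertex_of N (root N) = h ` vertex_of M (root M)" using h_vertex[OF M.r] h by simp
  then have "vertex_of N ` h ` X - {vertex_of N (root N)} = (`) h ` vertex_of M ` X - (`) h ` {vertex_of M (root M)}"
    using img[OF assms] by simp
  also have "\<dots> = (`) h ` (vertex_of M ` X - {vertex_of M (root M)})"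
    by (rule inj_on_image_set_diff[OF inj, symmetric]) (use XS M.r in auto)
  finally show "degrees_of (vertex_of N ` h ` X - {vertex_of N (root N)}) =
      degrees_of (vertex_of M ` X - {vertex_of M (root M)})"
    using deg[of "vertex_of M ` X - {vertex_of M (root M)}"] XS by (metis Diff_subset subset_trans)
qed

lemma h_black: "x \<in> flags M \<Longrightarrow> black_of N (h x) = black_of M x"
proof -
  assume x: "x \<in> flags M"
  have "vertex_colouring M (\<lambda>y. black_of N (h y))"
    unfolding vertex_colouring_def using h N.b by simp
  then show ?thesis
    using colouring_unique[OF M.bip M.ne, of "\<lambda>y. black_of N (h y)"] h(4) N.black x by simp
qed

lemma h_profile: "profile N = profile M"
proof -
  have "{x \<in> flags N. black_of N x} = h ` {x \<in> flags M. black_of M x}"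
    "{x \<in> flags N. \<not> black_of N x} = h ` {x \<in> flags M. \<not> black_of M x}"
    using h_black h_img by (auto simp: set_eq_iff image_iff) (metis h_black imageE)+
  moreover have "card (vertex_of N (root N)) = card (vertex_of M (root M))"
    using h_vertex[OF M.r] h(4) h_inj M.vertex_A[OF M.r] by (metis card_image inj_on_subset)
  ultimately show ?thesis
    using degrees_image[of "{x \<in> flags M. black_of M x}"] degrees_image[of "{x \<in> flags M. \<not> black_of M x}"]
      M.ne N.ne
    unfolding profile_def by simp
qed

text \<open>Rigidity of rooted maps: agreement at the root spreads along \<open>side\<close>,
  \<open>far\<close> and \<open>corner\<close>. Because of it, the flags of a representative
  parametrize the ways to attach an edge without repetition.\<close>

lemma iso_unique:
  assumes "flag_iso g M N" "x \<in> flags M"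
  shows "g x = h x"
proof -
  have "flags M \<subseteq> {x \<in> flags M. g x = h x}"
    by (rule M.connected_subset[OF _ M.r])
      (use assms(1) h M.r M.s M.f M.c in \<open>auto simp: flag_iso_def\<close>)
  then show ?thesis using assms(2) by blast
qed

end

lemma iso_mapsI:
  assumes "bipartite_map M" "bipartite_map N" "flag_iso h M N" "flags M \<noteq> {}"
  shows "iso_maps M N h"
proof -
  have "flags N \<noteq> {}" using assms(3,4) by (auto simp: flag_iso_def bij_betw_def)
  then show ?thesis using assms by unfold_locales
qed

lemma flag_iso_empty:
  assumes "flag_iso h M N"
  shows "flags M = {} \<longleftrightarrow> flags N = {}"
  using assms by (auto simp: flag_iso_def bij_betw_def)

lemma profile_cong:
  assumes "bipartite_map M" "bipartite_map N" "abs_rooted_map M = abs_rooted_map N"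
  shows "profile M = profile N"
proof -
  obtain h where h: "flag_iso h M N" using assms abs_eq_iff by blast
  show ?thesis
  proof (cases "flags M = {}")
    case True
    then show ?thesis using flag_iso_empty[OF h] by (simp add: profile_def)
  next
    case False
    then show ?thesis using iso_maps.h_profile[OF iso_mapsI[OF assms(1,2) h]] by simp
  qed
qed

text \<open>A map can be rebuilt from its deletion and the two corners where the root edge was attached.\<close>

lemma extend_iso:
  assumes "edged_map M" "edged_map N"
  defines "E \<equiv> root_edge M" and "E' \<equiv> root_edge N"
  assumes g: "bij_betw g (flags M - E) (flags N - E')"
    and hom: "\<And>x. x \<in> flags M - E \<Longrightarrow> g (side M x) = side N (g x)"
      "\<And>x. x \<in> flags M - E \<Longrightarrow> g (far M x) = far N (g x)"
      "\<And>x. x \<in> flags M - E \<Longrightarrow> g (corner_deleted M x) = corner_deleted N (g x)"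
    and at_root: "corner M (side M (root M)) \<in> E \<longleftrightarrow> corner N (side N (root N)) \<in> E'"
      "corner M (side M (root M)) \<notin> E \<Longrightarrow> g (corner M (side M (root M))) = corner N (side N (root N))"
    and at_far: "corner M (far M (root M)) \<in> E \<longleftrightarrow> corner N (far N (root N)) \<in> E'"
      "corner M (far M (root M)) \<notin> E \<Longrightarrow> g (corner M (far M (root M))) = corner N (far N (root N))"
  shows "\<exists>h. flag_iso h M N \<and> (\<forall>x\<in>flags M - E. h x = g x)"
proof -
  interpret M: edged_map M by fact
  interpret N: edged_map N by fact
  note [simp] = E_def E'_def
  let ?r = "root M" and ?r' = "root N"
  define h where "h x = (if x = ?r then ?r' else if x = side M ?r then side N ?r' else
      if x = far M ?r then far N ?r' else if x = side M (far M ?r) then side N (far N ?r') else g x)" for x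
  have E: "E = {?r, side M ?r, far M ?r, side M (far M ?r)}" by (auto simp: root_edge_def)
  have E': "E' = {?r', side N ?r', far N ?r', side N (far N ?r')}" by (auto simp: root_edge_def)
  have dist: "side M ?r \<noteq> ?r" "far M ?r \<noteq> ?r" "far M ?r \<noteq> side M ?r"
    "side M (far M ?r) \<noteq> ?r" "side M (far M ?r) \<noteq> side M ?r" "side M (far M ?r) \<noteq> far M ?r"
    using M.E_colours M.s M.f M.r by metis+
  have dist': "side N ?r' \<noteq> ?r'" "far N ?r' \<noteq> ?r'" "far N ?r' \<noteq> side N ?r'"
    "side N (far N ?r') \<noteq> ?r'" "side N (far N ?r') \<noteq> side N ?r'" "side N (far N ?r') \<noteq> far N ?r'"
    using N.E_colours N.s N.f N.r by metis+
  have hE: "h ?r = ?r'" "h (side M ?r) = side N ?r'" "h (far M ?r) = far N ?r'"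
    "h (side M (far M ?r)) = side N (far N ?r')"
    using dist by (simp_all add: h_def)
  have hg: "h x = g x" if "x \<notin> E" for x using that unfolding h_def E by auto
  have gN: "g x \<in> flags N - E'" if "x \<in> flags M - E" for x using bij_betwE[OF g] that by blast
  have bijE: "bij_betw h E E'"
    unfolding bij_betw_def
  proof
    show "inj_on h E" unfolding E inj_on_def using hE dist' by auto
    show "h ` E = E'" unfolding E E' using hE by auto
  qed
  have "bij_betw h (flags M - E) (flags N - E')"
    using g by (rule bij_betw_cong[THEN iffD1, rotated]) (use hg in auto)
  from bij_betw_combine[OF bijE this] have bij: "bij_betw h (flags M) (flags N)"
    using M.E_A N.E_A by (simp add: Un_absorb1)
  have side_E: "h (side M e) = side N (h e)" and far_E: "h (far M e) = far N (h e)" if e: "e \<in> E" for e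
  proof -
    have A: "far M ?r \<in> flags M" "far N ?r' \<in> flags N" using M.r N.r M.f N.f by auto
    consider "e = ?r" | "e = side M ?r" | "e = far M ?r" | "e = side M (far M ?r)"
      using e by (auto simp: M.E)
    then show "h (side M e) = side N (h e)" "h (far M e) = far N (h e)"
      using hE A by (cases; simp add: M.s M.f M.sf(1) M.r N.s N.f N.sf(1) N.r)+
  qed
  have hEE': "h e \<in> E'" if "e \<in> E" for e using bijE that by (auto simp: bij_betw_def)
  \<comment> \<open>\<open>?C e\<close> says that \<open>h\<close> will respect
    \<open>corner\<close> at \<open>e\<close>. If that corner leads back to the root edge, the end
    has degree 1 and \<open>E_c\<close> fixes the partner as the other side.\<close>
  let ?C = "\<lambda>e. (corner M e \<in> E \<longrightarrow> corner N (h e) \<in> E') \<and>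
      (corner M e \<notin> E \<longrightarrow> corner N (h e) \<notin> E' \<and> g (corner M e) = corner N (h e))"
  \<comment> \<open>The two sides of a half-edge face flags that \<open>corner_deleted\<close>
    links, and \<open>g\<close> respects this link. So the assumptions at one side of each end
    determine the other side.\<close>
  have C_side: "?C (side M e)" if e: "e \<in> E" and C: "?C e" for e
  proof (cases "corner M e \<in> E")
    case True
    have "corner M (side M e) = e"
      using M.E_c[of e] True e M.c(3)[of e] M.E_A by auto
    moreover have "corner N (side N (h e)) = h e"
      using N.E_c[of "h e"] True C hEE'[OF e] N.c(3)[of "h e"] N.E_A by auto
    ultimately show ?thesis using e hEE'[OF e] side_E[OF e] by simp
  next
    case False
    have 1: "corner M (side M e) \<notin> E"
      using shortcut_not_in[OF M.s_inv M.c_inv M.E_A M.E_s M.E_c, of e] e False by simp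
    have 2: "corner N (side N (h e)) \<notin> E'"
      using shortcut_not_in[OF N.s_inv N.c_inv N.E_A N.E_s N.E_c, of "h e"] hEE'[OF e] C False by simp
    have eA: "e \<in> flags M" "h e \<in> flags N" using e hEE' M.E_A N.E_A by auto
    have "corner M (side M e) = corner_deleted M (corner M e)"
      using M.c(3) eA e by (simp add: M.corner_deleted shortcut_def)
    moreover have "corner N (side N (h e)) = corner_deleted N (corner N (h e))"
      using N.c(3) eA hEE'[OF e] by (simp add: N.corner_deleted shortcut_def)
    moreover have "corner M e \<in> flags M - E" using False M.c(1) eA by blast
    ultimately have "g (corner M (side M e)) = corner N (side N (h e))"
      using hom(3) C False by simp
    then show ?thesis using 1 2 side_E[OF e] by simp
  qed
  have rE: "?r \<in> E" "side M ?r \<in> E" "far M ?r \<in> E" by (simp_all add: E[unfolded E_def])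
  have "?C (side M ?r)" using at_root hE by auto
  moreover from C_side[OF rE(2) this] have "?C ?r" using M.s(3)[OF M.r] by simp
  moreover have "?C (far M ?r)" using at_far hE by auto
  moreover from C_side[OF rE(3) this] have "?C (side M (far M ?r))" .
  ultimately have C: "?C e" if "e \<in> E" for e
  proof -
    have "e = ?r \<or> e = side M ?r \<or> e = far M ?r \<or> e = side M (far M ?r)"
      using that by (auto simp: M.E)
    then show ?thesis
      using \<open>?C ?r\<close> \<open>?C (side M ?r)\<close> \<open>?C (far M ?r)\<close> \<open>?C (side M (far M ?r))\<close>
      by (elim disjE) (simp_all only: simp_thms)
  qed
  have corner: "h (corner M x) = corner N (h x)" if x: "x \<in> flags M" for x
  proof (cases "x \<in> E")
    case True
    show ?thesis
    proof (cases "corner M x \<in> E")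
      case True
      have "corner M x = side M x" "corner N (h x) = side N (h x)"
        using M.E_c[of x] N.E_c[of "h x"] True C[OF \<open>x \<in> E\<close>] hEE' \<open>x \<in> E\<close> by auto
      then show ?thesis using side_E[OF \<open>x \<in> E\<close>] by simp
    next
      case False
      then show ?thesis using C[OF \<open>x \<in> E\<close>] hg by simp
    qed
  next
    case False
    then have xE: "x \<in> flags M - E" using x by blast
    show ?thesis
    proof (cases "corner M x \<in> E")
      case True
      then have "g x = corner N (h (corner M x))" using C[OF True] M.c(3)[OF x] False by simp
      moreover have "h (corner M x) \<in> flags N" using hEE'[OF True] N.E_A by auto
      ultimately show ?thesis using N.c(3) hg[OF False] by simp
    next
      case 2: False
      have "corner N (g x) \<notin> E'"
      proof
        assume "corner N (g x) \<in> E'"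
        then obtain e where e: "e \<in> E" "corner N (g x) = h e" using bijE by (auto simp: bij_betw_def)
        have "corner N (h e) = g x" using e(2)[symmetric] N.c(3) gN[OF xE] by simp
        moreover have "g x \<notin> E'" using gN[OF xE] by blast
        ultimately have ce: "corner M e \<notin> E" "g (corner M e) = g x" using C[OF e(1)] by auto
        have "corner M e \<in> flags M - E" using ce M.c(1) e M.E_A by auto
        then have "corner M e = x" using ce(2) g xE by (auto simp: bij_betw_def dest: inj_onD)
        then have "corner M x = e" using M.c(3) e M.E_A by auto
        then show False using 2 e by blast
      qed
      then show ?thesis
        using hom(3)[OF xE] 2 hg[OF 2] hg[OF False] by (simp add: M.corner_deleted N.corner_deleted shortcut_def)
    qed
  qed
  have side: "h (side M x) = side N (h x)" if x: "x \<in> flags M" for x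
  proof (cases "x \<in> E")
    case False
    then have "side M x \<notin> E" using M.E_s[of "side M x"] M.s(3)[OF x] by auto
    then show ?thesis using hg False hom(1) x by simp
  qed (rule side_E)
  have far: "h (far M x) = far N (h x)" if x: "x \<in> flags M" for x
  proof (cases "x \<in> E")
    case False
    then have "far M x \<notin> E" using M.E_f[of "far M x"] M.f(3)[OF x] by auto
    then show ?thesis using hg False hom(2) x by simp
  qed (rule far_E)
  show ?thesis
    using bij side far corner hE(1) hg by (intro exI[of _ h]) (auto simp: flag_iso_def)
qed

section \<open>Attaching a root edge\<close>

text \<open>
  The new edge has the flags \<open>k, k + 1, k + 2, k + 3\<close>. Its ends are inserted next to the flags
  \<open>\<rho>\<close> and \<open>y\<close>, or become vertices of degree 1 where no flag is given.
\<close>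

definition fresh_flag :: "flag_map \<Rightarrow> nat" where
  "fresh_flag N = Suc (Max (insert 0 (flags N)))"

definition new_flags :: "flag_map \<Rightarrow> nat set" where
  "new_flags N = (let k = fresh_flag N in {k, k + 1, k + 2, k + 3})"

text \<open>The order of the cases follows the rooting of deletions: \<open>root_component\<close>
  is rooted at the flag facing the other side of the root, here \<open>k + 1\<close>, and
  \<open>other_component\<close> at the flag facing \<open>far\<close> of the root, here
  \<open>k + 2\<close>. These must be the given flags \<open>\<rho>\<close> and
  \<open>y\<close>.\<close>

definition neighbour :: "flag_map \<Rightarrow> nat option \<Rightarrow> nat option \<Rightarrow> nat \<Rightarrow> nat option" where
  "neighbour N \<rho> y x = (let k = fresh_flag N in
     if x = k then map_option (corner N) \<rho> else if x = k + 1 then \<rho>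
     else if x = k + 2 then y else map_option (corner N) y)"

definition side_attached :: "flag_map \<Rightarrow> nat \<Rightarrow> nat" where
  "side_attached N x = (let k = fresh_flag N in
     if x \<in> flags N then side N x else if x = k then k + 1 else if x = k + 1 then k
     else if x = k + 2 then k + 3 else k + 2)"

definition far_attached :: "flag_map \<Rightarrow> nat \<Rightarrow> nat" where
  "far_attached N x = (let k = fresh_flag N in
     if x \<in> flags N then far N x else if x = k then k + 2 else if x = k + 1 then k + 3
     else if x = k + 2 then k else k + 1)"

text \<open>On old flags \<open>corner\<close> has to invert \<open>neighbour\<close>; by
  \<open>nb_unique\<close> the choice leaves no freedom.\<close>

definition attach :: "flag_map \<Rightarrow> nat option \<Rightarrow> nat option \<Rightarrow> flag_map" where
  "attach N \<rho> y =
     \<lparr>flags = flags N \<union> new_flags N, side = side_attached N, far = far_attached N,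
      corner = (\<lambda>x. if x \<in> flags N
         then (if \<exists>e\<in>new_flags N. neighbour N \<rho> y e = Some x
               then SOME e. e \<in> new_flags N \<and> neighbour N \<rho> y e = Some x else corner N x)
         else (case neighbour N \<rho> y x of None \<Rightarrow> side_attached N x | Some z \<Rightarrow> z)),
      root = fresh_flag N\<rparr>"

text \<open>Covers both a connected map and the disjoint union of two maps: \<open>conn\<close> says
  that every nonempty closed set of flags contains a place of attachment. The colouring
  \<open>d\<close> makes the two ends of the new edge differ; on a second component it is the
  reverse of the colouring given by the root.\<close>

locale attachment =
  fixes N :: flag_map and \<rho> y :: "nat option" and d :: "nat \<Rightarrow> bool"
  assumes fin: "finite (flags N)"
    and inv: "free_involution (flags N) (side N)" "free_involution (flags N) (far N)"
      "free_involution (flags N) (corner N)"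
    and comm: "\<And>x. x \<in> flags N \<Longrightarrow> side N (far N x) = far N (side N x) \<and> side N (far N x) \<noteq> x"
    and col: "vertex_colouring N d"
    and \<rho>: "\<And>z. \<rho> = Some z \<Longrightarrow> z \<in> flags N \<and> d z"
    and y: "\<And>z. y = Some z \<Longrightarrow> z \<in> flags N \<and> \<not> d z"
    and conn: "\<And>B x. x \<in> B \<Longrightarrow> B \<subseteq> flags N \<Longrightarrow>
      (\<And>z. z \<in> B \<Longrightarrow> side N z \<in> B \<and> far N z \<in> B \<and> corner N z \<in> B) \<Longrightarrow>
      \<exists>z\<in>B. \<rho> = Some z \<or> y = Some z"
begin

abbreviation "new \<equiv> new_flags N"
abbreviation "nb \<equiv> neighbour N \<rho> y"
definition "k = fresh_flag N"
definition "k1 = k + 1"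
definition "k2 = k + 2"
definition "k3 = k + 3"
abbreviation "M \<equiv> attach N \<rho> y"

lemma N_inv: "x \<in> flags N \<Longrightarrow> side N x \<in> flags N" "x \<in> flags N \<Longrightarrow> side N x \<noteq> x" "x \<in> flags N \<Longrightarrow> side N (side N x) = x"
  "x \<in> flags N \<Longrightarrow> far N x \<in> flags N" "x \<in> flags N \<Longrightarrow> far N x \<noteq> x" "x \<in> flags N \<Longrightarrow> far N (far N x) = x"
  "x \<in> flags N \<Longrightarrow> corner N x \<in> flags N" "x \<in> flags N \<Longrightarrow> corner N x \<noteq> x" "x \<in> flags N \<Longrightarrow> corner N (corner N x) = x"
  using inv by (simp_all add: free_involution_def)

lemma k_distinct [simp]: "k \<noteq> k1" "k \<noteq> k2" "k \<noteq> k3" "k1 \<noteq> k" "k1 \<noteq> k2" "k1 \<noteq> k3"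
  "k2 \<noteq> k" "k2 \<noteq> k1" "k2 \<noteq> k3" "k3 \<noteq> k" "k3 \<noteq> k1" "k3 \<noteq> k2"
  by (simp_all add: k1_def k2_def k3_def)

lemma new_def: "new = {k, k1, k2, k3}"
  by (simp add: new_flags_def Let_def k_def k1_def k2_def k3_def)

lemma nb_def: "nb x = (if x = k then map_option (corner N) \<rho> else if x = k1 then \<rho>
    else if x = k2 then y else map_option (corner N) y)"
  by (simp add: neighbour_def Let_def k_def k1_def k2_def)

lemma fresh: "x \<in> flags N \<Longrightarrow> x < k"
  using fin unfolding k_def fresh_flag_def by (simp add: less_Suc_eq_le)

lemma fresh' [simp]: "k \<notin> flags N" "k1 \<notin> flags N" "k2 \<notin> flags N" "k3 \<notin> flags N"
  using fresh[of k] fresh[of k1] fresh[of k2] fresh[of k3] by (auto simp: k1_def k2_def k3_def)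

lemma new_disjoint: "x \<in> flags N \<Longrightarrow> x \<notin> new"
  by (auto simp: new_def)

lemma attach_flags: "flags M = flags N \<union> new" and attach_root: "root M = k"
  by (simp_all add: attach_def k_def)

lemma attach_side: "x \<in> flags N \<Longrightarrow> side M x = side N x"
    "side M k = k1" "side M k1 = k" "side M k2 = k3" "side M k3 = k2"
  and attach_far: "x \<in> flags N \<Longrightarrow> far M x = far N x"
    "far M k = k2" "far M k1 = k3" "far M k2 = k" "far M k3 = k1"
proof -
  have "side M x = (if x \<in> flags N then side N x else if x = k then k1 else if x = k1 then k
      else if x = k2 then k3 else k2)" for x
    by (simp add: attach_def side_attached_def Let_def k_def k1_def k2_def k3_def)
  moreover have "far M x = (if x \<in> flags N then far N x else if x = k then k2 else if x = k1 then k3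
      else if x = k2 then k else k1)" for x
    by (simp add: attach_def far_attached_def Let_def k_def k1_def k2_def k3_def)
  ultimately show "x \<in> flags N \<Longrightarrow> side M x = side N x"
    "side M k = k1" "side M k1 = k" "side M k2 = k3" "side M k3 = k2"
    "x \<in> flags N \<Longrightarrow> far M x = far N x"
    "far M k = k2" "far M k1 = k3" "far M k2 = k" "far M k3 = k1"
    by simp_all
qed

lemma attach_corner: "corner M x = (if x \<in> flags N
    then (if \<exists>e\<in>new. nb e = Some x then SOME e. e \<in> new \<and> nb e = Some x else corner N x)
    else (case nb x of None \<Rightarrow> side M x | Some z \<Rightarrow> z))"
  by (simp add: attach_def split: option.split)

lemma newE:
  assumes "e \<in> new"
  obtains "e = k" | "e = k1" | "e = k2" | "e = k3"
  using assms by (auto simp: new_def)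

lemma new_ops: "e \<in> new \<Longrightarrow> side M e \<in> new \<and> side M e \<noteq> e \<and> side M (side M e) = e"
  "e \<in> new \<Longrightarrow> far M e \<in> new \<and> far M e \<noteq> e \<and> far M (far M e) = e"
  "e \<in> new \<Longrightarrow> side M (far M e) = far M (side M e) \<and> side M (far M e) \<noteq> e"
  by (erule newE; simp add: attach_side attach_far new_def)+

lemma nb_side:
  assumes "e \<in> new"
  shows "nb (side M e) = map_option (corner N) (nb e)"
proof -
  have "map_option (corner N) (map_option (corner N) \<rho>) = \<rho>"
    using \<rho> N_inv(9) by (cases \<rho>) auto
  moreover have "map_option (corner N) (map_option (corner N) y) = y"
    using y N_inv(9) by (cases y) auto
  ultimately show ?thesis by (rule_tac newE[OF assms]) (simp_all add: attach_side nb_def)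
qed

lemma d_N: "x \<in> flags N \<Longrightarrow> d (side N x) = d x" "x \<in> flags N \<Longrightarrow> d (corner N x) = d x"
  "x \<in> flags N \<Longrightarrow> d (far N x) = (\<not> d x)"
  using col by (simp_all add: vertex_colouring_def)

lemma nb_SomeD:
  assumes "e \<in> new" "nb e = Some z"
  shows "z \<in> flags N" "d z = (e = k \<or> e = k1)"
  using assms \<rho> y N_inv(7) d_N(2) by (auto simp: nb_def elim!: newE split: if_splits)

text \<open>Colours separate the two ends of the new edge, and the two sides of one end face flags
  that \<open>corner\<close> of the old map exchanges, hence different ones.\<close>

lemma nb_unique:
  assumes "e \<in> new" "nb e = Some z" "e' \<in> new" "nb e' = Some z"
  shows "e' = e"
proof -
  have "(e = k \<or> e = k1) = (e' = k \<or> e' = k1)" using nb_SomeD assms by blast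
  moreover have "e' \<noteq> side M e"
  proof
    assume "e' = side M e"
    then have "nb e' = Some (corner N z)" using nb_side[OF assms(1)] assms(2) by simp
    then show False using N_inv(8)[OF nb_SomeD(1)[OF assms(1,2)]] assms(4) by simp
  qed
  ultimately show ?thesis using assms(1,3) by (auto elim!: newE simp: attach_side)
qed

lemma corner_nb: "e \<in> new \<Longrightarrow> nb e = Some z \<Longrightarrow> corner M z = e"
proof -
  assume e: "e \<in> new" "nb e = Some z"
  have "(SOME e. e \<in> new \<and> nb e = Some z) = e"
    using e nb_unique by (intro some_equality) auto
  then show ?thesis using e nb_SomeD(1) by (auto simp: attach_corner)
qed

lemma corner_new: "e \<in> new \<Longrightarrow> corner M e = (case nb e of None \<Rightarrow> side M e | Some z \<Rightarrow> z)"
  using new_disjoint by (auto simp: attach_corner)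

lemma corner_old: "x \<in> flags N \<Longrightarrow> (\<And>e. e \<in> new \<Longrightarrow> nb e \<noteq> Some x) \<Longrightarrow> corner M x = corner N x"
  by (auto simp: attach_corner)

lemma not_nb_corner:
  assumes x: "x \<in> flags N" "\<And>e. e \<in> new \<Longrightarrow> nb e \<noteq> Some x" and e: "e \<in> new"
  shows "nb e \<noteq> Some (corner N x)"
proof
  assume "nb e = Some (corner N x)"
  then have "nb (side M e) = Some x" using nb_side[OF e] N_inv(9) x by simp
  then show False using x(2) new_ops(1)[OF e] by blast
qed

lemma corner_inv: "free_involution (flags M) (corner M)"
  unfolding free_involution_def attach_flags
proof
  fix x assume "x \<in> flags N \<union> new"
  then consider "x \<in> new" "nb x = None" | z where "x \<in> new" "nb x = Some z"
    | e where "x \<in> flags N" "e \<in> new" "nb e = Some x"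
    | "x \<in> flags N" "\<And>e. e \<in> new \<Longrightarrow> nb e \<noteq> Some x" by blast
  then show "corner M x \<in> flags N \<union> new \<and> corner M x \<noteq> x \<and> corner M (corner M x) = x"
  proof cases
    case 1
    then have "nb (side M x) = None" using nb_side by simp
    then show ?thesis using 1 new_ops(1)[of x] corner_new[of x] corner_new[of "side M x"] by simp
  next
    case (2 z)
    then have "corner M x = z" by (simp add: corner_new)
    then show ?thesis using corner_nb[OF 2] nb_SomeD(1)[OF 2] new_disjoint 2 by auto
  next
    case (3 e)
    have "corner M x = e" "corner M e = x" using corner_nb[OF 3(2,3)] 3 by (simp_all add: corner_new)
    then show ?thesis using 3 new_disjoint by auto
  next
    case 4
    have "corner M (corner N x) = corner N (corner N x)"
      using N_inv(7)[OF 4(1)] not_nb_corner[OF 4] by (rule corner_old)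
    then show ?thesis using corner_old[OF 4] N_inv 4 by simp
  qed
qed

lemma side_inv: "free_involution (flags M) (side M)" and far_inv: "free_involution (flags M) (far M)"
  unfolding free_involution_def attach_flags using N_inv new_ops attach_side(1) attach_far(1) by auto

text \<open>Where the new edge sits in an old corner, the step across that corner is replaced by
  three: to the new flag, to its other side, and on to the old flag beyond.\<close>

lemma closed_old:
  assumes "\<And>x. x \<in> B \<Longrightarrow> x \<in> flags M \<Longrightarrow> side M x \<in> B" "\<And>x. x \<in> B \<Longrightarrow> x \<in> flags M \<Longrightarrow> corner M x \<in> B"
    "x \<in> B" "x \<in> flags N"
  shows "corner N x \<in> B"
proof (cases "\<exists>e\<in>new. nb e = Some x")
  case True
  then obtain e where e: "e \<in> new" "nb e = Some x" by blast
  have "e \<in> B" using assms(2)[OF assms(3)] assms(4) corner_nb[OF e] attach_flags by auto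
  then have "side M e \<in> B" using assms(1) e attach_flags by auto
  then have "corner M (side M e) \<in> B" using assms(2) new_ops(1) e attach_flags by auto
  then show ?thesis using corner_new[of "side M e"] new_ops(1) e nb_side by simp
next
  case False
  then show ?thesis using assms(2)[OF assms(3)] assms(4) corner_old attach_flags by auto
qed

text \<open>\<open>conn\<close> is used twice: the old part of \<open>B\<close> contains a place of
  attachment, which leads to the new edge; and if old flags were missing from \<open>B\<close>,
  these would form a closed set that contains a place of attachment, although the new edge in
  \<open>B\<close> leads to every such place.\<close>

lemma attach_connected:
  assumes x: "x \<in> flags M" "x \<in> B"
    and B: "\<And>x. x \<in> B \<Longrightarrow> x \<in> flags M \<Longrightarrow> side M x \<in> B" "\<And>x. x \<in> B \<Longrightarrow> x \<in> flags M \<Longrightarrow> corner M x \<in> B"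
      "\<And>x. x \<in> B \<Longrightarrow> x \<in> flags M \<Longrightarrow> far M x \<in> B"
  shows "flags M \<subseteq> B"
proof -
  have old: "side N z \<in> B" "far N z \<in> B" "corner N z \<in> B" if "z \<in> B" "z \<in> flags N" for z
    using that B(1)[of z] B(3)[of z] closed_old[OF B(1,2) that] attach_side(1) attach_far(1) attach_flags by auto
  have "\<exists>e\<in>new. e \<in> B"
  proof (cases "x \<in> new")
    case False
    then have "x \<in> B \<inter> flags N" using x attach_flags by auto
    then have "\<exists>z\<in>B \<inter> flags N. \<rho> = Some z \<or> y = Some z"
      by (rule conn) (use old N_inv in auto)
    then obtain z where z: "z \<in> B" "z \<in> flags N" "\<rho> = Some z \<or> y = Some z" by blast
    have "nb k1 = \<rho>" "nb k2 = y" by (simp_all add: nb_def)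
    then have "corner M z = k1 \<or> corner M z = k2"
      using z(3) corner_nb[of k1 z] corner_nb[of k2 z] by (auto simp: new_def)
    moreover have "corner M z \<in> B" using B(2) z attach_flags by auto
    ultimately show ?thesis by (auto simp: new_def)
  qed (use x in blast)
  then obtain e where e: "e \<in> new" "e \<in> B" by blast
  have in_M: "k \<in> flags M" "k1 \<in> flags M" "k2 \<in> flags M" "k3 \<in> flags M"
    by (simp_all add: attach_flags new_def)
  have "side M e \<in> B" "far M e \<in> B" using B(1,3) e attach_flags by auto
  moreover from this(2) have "side M (far M e) \<in> B" using B(1) e new_ops(2) attach_flags by auto
  moreover have "new = {e, side M e, far M e, side M (far M e)}"
    using e(1) by (cases rule: newE) (auto simp: new_def attach_side attach_far)
  ultimately have new: "new \<subseteq> B" using e(2) by simp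
  have "flags N \<subseteq> B"
  proof (rule ccontr)
    assume "\<not> flags N \<subseteq> B"
    then obtain u where "u \<in> flags N - B" by blast
    moreover have "side N z \<in> flags N - B \<and> far N z \<in> flags N - B \<and> corner N z \<in> flags N - B"
      if "z \<in> flags N - B" for z
      using that old(1)[of "side N z"] old(2)[of "far N z"] old(3)[of "corner N z"] N_inv by auto
    ultimately have "\<exists>z\<in>flags N - B. \<rho> = Some z \<or> y = Some z" by (intro conn) auto
    then obtain z where z: "z \<notin> B" "\<rho> = Some z \<or> y = Some z" by blast
    have "corner M k1 \<in> B" "corner M k2 \<in> B" using B(2) new in_M by (auto simp: new_def)
    then show False using z by (auto simp: corner_new new_def nb_def split: option.splits)
  qed
  then show ?thesis using new attach_flags by blast
qed

lemma attach_bipartite: "bipartite_map M"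
proof -
  have conn: "connected_avoiding {} M"
    unfolding connected_avoiding_def
  proof (intro ballI)
    fix x z assume x: "x \<in> flags M" and z: "z \<in> flags M"
    have "flags M \<subseteq> (steps_avoiding {} M)\<^sup>* `` {x}"
      by (rule attach_connected[OF x]) (auto simp: steps_avoiding_def intro: rtrancl_into_rtrancl)
    then show "(x, z) \<in> (steps_avoiding {} M)\<^sup>*" using z by blast
  qed
  let ?d = "\<lambda>x. if x \<in> new then x = k \<or> x = k1 else d x"
  have "vertex_colouring M ?d"
    unfolding vertex_colouring_def attach_flags
  proof
    fix x assume "x \<in> flags N \<union> new"
    then consider "x \<in> new" "nb x = None" | z where "x \<in> new" "nb x = Some z"
      | e where "x \<in> flags N" "e \<in> new" "nb e = Some x"
      | "x \<in> flags N" "\<And>e. e \<in> new \<Longrightarrow> nb e \<noteq> Some x" by blast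
    then show "?d (side M x) = ?d x \<and> ?d (corner M x) = ?d x \<and> ?d (far M x) = (\<not> ?d x)"
    proof cases
      case 1
      then have "?d (corner M x) = ?d (side M x)" by (simp add: corner_new)
      moreover have "?d (side M x) = ?d x \<and> ?d (far M x) = (\<not> ?d x)"
        using 1(1) by (cases rule: newE) (simp_all add: attach_side attach_far new_def)
      ultimately show ?thesis by simp
    next
      case (2 z)
      then have "?d (corner M x) = ?d x" using nb_SomeD[OF 2] new_disjoint by (auto simp: corner_new)
      moreover have "?d (side M x) = ?d x \<and> ?d (far M x) = (\<not> ?d x)"
        using 2(1) by (cases rule: newE) (simp_all add: attach_side attach_far new_def)
      ultimately show ?thesis by simp
    next
      case (3 e)
      have "?d (corner M x) = ?d x" using 3 corner_nb[OF 3(2,3)] nb_SomeD[OF 3(2,3)] new_disjoint by auto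
      then show ?thesis using 3 d_N N_inv new_disjoint attach_side(1) attach_far(1) by auto
    next
      case 4
      then show ?thesis
        using corner_old[OF 4] d_N N_inv new_disjoint attach_side(1) attach_far(1) by auto
    qed
  qed
  moreover have "\<forall>x\<in>flags M. side M (far M x) = far M (side M x) \<and> side M (far M x) \<noteq> x"
  proof
    fix x assume "x \<in> flags M"
    then consider "x \<in> flags N" | "x \<in> new" using attach_flags by blast
    then show "side M (far M x) = far M (side M x) \<and> side M (far M x) \<noteq> x"
    proof cases
      case 1
      then have "side M (far M x) = side N (far N x)" "far M (side M x) = far N (side N x)"
        using N_inv(1,4) attach_side(1) attach_far(1) by simp_all
      then show ?thesis using comm[OF 1] by metis
    qed (rule new_ops(3))
  qed
  moreover have "finite (flags M)" "root M \<in> flags M" using fin by (simp_all add: attach_flags new_def attach_root)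
  ultimately show ?thesis unfolding bipartite_map_def using conn side_inv far_inv corner_inv by blast
qed

lemma attach_root_edge: "root_edge M = new"
  by (simp add: root_edge_def attach_root attach_side attach_far new_def insert_commute)

sublocale M: edged_map M
  using attach_bipartite attach_flags by unfold_locales (auto simp: new_def)

lemma attach_corner_deleted:
  assumes "x \<in> flags N"
  shows "corner_deleted M x = corner N x"
proof (cases "\<exists>e\<in>new. nb e = Some x")
  case True
  then obtain e where e: "e \<in> new" "nb e = Some x" by blast
  have "corner_deleted M x = corner M (side M e)"
    using e corner_nb[OF e] by (simp add: M.corner_deleted shortcut_def attach_root_edge)
  then show ?thesis using corner_new[of "side M e"] new_ops(1) e nb_side by simp
next
  case False
  then have "corner M x = corner N x" using corner_old assms by blast
  then show ?thesis
    using new_disjoint N_inv(7)[OF assms] by (simp add: M.corner_deleted shortcut_def attach_root_edge)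
qed

lemma attach_corners: "corner M k1 = (case \<rho> of None \<Rightarrow> k | Some z \<Rightarrow> z)"
  "corner M k2 = (case y of None \<Rightarrow> k3 | Some z \<Rightarrow> z)"
  using corner_new[of k1] corner_new[of k2] unfolding attach_side by (simp_all add: new_def nb_def)

end

section \<open>Attaching an edge at a white corner\<close>

definition attach_white :: "flag_map \<Rightarrow> nat \<Rightarrow> flag_map" where
  "attach_white N w = attach N (Some (root N)) (Some w)"

text \<open>The old map connects the two ends of the new edge, which is thus no bridge. The last
  conclusion lets \<open>w\<close> be read off from the result; injectivity in
  \<open>nonbridge_bij\<close> rests on it.\<close>

lemma attach_white:
  assumes "bipartite_map N" "w \<in> flags N" "\<not> black_of N w"
  defines "M \<equiv> attach_white N w"
  shows "bipartite_map M" "flags M \<noteq> {}" "\<not> root_bridge M" "flag_iso id N (root_component M)"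
    "corner M (far M (root M)) = w"
proof -
  interpret N: edged_map N using assms by unfold_locales auto
  interpret attachment N "Some (root N)" "Some w" "black_of N"
  proof unfold_locales
    show "finite (flags N)" by (rule N.fin)
    show "free_involution (flags N) (side N)" "free_involution (flags N) (far N)"
      "free_involution (flags N) (corner N)" by (fact N.s_inv N.f_inv N.c_inv)+
    show "side N (far N x) = far N (side N x) \<and> side N (far N x) \<noteq> x" if "x \<in> flags N" for x
      using N.sf[OF that] by metis
    show "vertex_colouring N (black_of N)" by (rule N.black)
    show "z \<in> flags N \<and> black_of N z" if "Some (root N) = Some z" for z using that N.r N.black by simp
    show "z \<in> flags N \<and> \<not> black_of N z" if "Some w = Some z" for z using that assms by simp
    fix B x assume "x \<in> B" "B \<subseteq> flags N"
      "\<And>z. z \<in> B \<Longrightarrow> side N z \<in> B \<and> far N z \<in> B \<and> corner N z \<in> B"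
    then have "flags N \<subseteq> B" using N.connected_subset[of x B] by blast
    then show "\<exists>z\<in>B. Some (root N) = Some z \<or> Some w = Some z" using N.r by blast
  qed
  have M: "M = attach N (Some (root N)) (Some w)" by (simp add: M_def attach_white_def)
  show "bipartite_map M" "flags M \<noteq> {}" unfolding M by (rule M.bip M.ne)+
  show "corner M (far M (root M)) = w" unfolding M by (simp add: attach_root attach_far attach_corners)
  have "far M (root M) \<in> reach M (root M)"
  proof -
    let ?B = "reach M (root M)"
    have sc: "side M x \<in> ?B" "corner M x \<in> ?B" if "x \<in> ?B" "x \<in> flags M" for x
      using that unfolding M by (rule M.reach_step)+
    have k: "k \<in> ?B" using M.reach_self by (simp add: M attach_root)
    have "side M k \<in> ?B" by (rule sc(1)[OF k]) (simp add: M attach_flags new_def)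
    then have "k1 \<in> ?B" by (simp add: M attach_side)
    then have "corner M k1 \<in> ?B" by (rule sc(2)) (simp add: M attach_flags new_def)
    then have r: "root N \<in> ?B" by (simp add: M attach_corners)
    have "flags N \<subseteq> ?B"
    proof (rule N.connected_subset[OF r N.r])
      fix z assume z: "z \<in> ?B" "z \<in> flags N"
      show "corner N z \<in> ?B" by (rule closed_old[OF _ _ z]) (use sc in \<open>auto simp: M\<close>)
      show "side N z \<in> ?B" using sc(1)[OF z(1)] z by (simp add: M attach_side attach_flags)
      show "far N z \<in> ?B"
        using M.reach_step(3)[of z "root M"] z new_disjoint[OF z(2)]
        by (simp add: M attach_far attach_flags attach_root_edge)
    qed
    then have "w \<in> ?B" using assms by blast
    then have "corner M w \<in> ?B" by (rule sc(2)) (use assms(2) in \<open>simp add: M attach_flags\<close>)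
    moreover have "corner M w = k2" unfolding M by (rule corner_nb) (simp_all add: new_def nb_def)
    ultimately show ?thesis by (simp add: M attach_root attach_far)
  qed
  then show nb: "\<not> root_bridge M" unfolding M M.bridge_iff by simp
  show "flag_iso id N (root_component M)"
  proof (rule flag_iso_cong)
    show "flags (root_component M) = flags N"
      using M.nonbridge_reach nb new_disjoint
      by (auto simp: M M.root_component_simps attach_flags attach_root_edge)
    show "root (root_component M) = root N"
      by (simp add: M M.root_component_simps attach_root attach_side attach_corners)
  qed (simp_all add: M M.root_component_simps attach_side attach_far attach_corner_deleted)
qed

section \<open>Joining two maps by a bridge\<close>

definition disjoint_union :: "flag_map \<Rightarrow> flag_map \<Rightarrow> flag_map" where
  "disjoint_union M N =
     \<lparr>flags = flags M \<union> flags N, side = (\<lambda>x. if x \<in> flags M then side M x else side N x),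
      far = (\<lambda>x. if x \<in> flags M then far M x else far N x),
      corner = (\<lambda>x. if x \<in> flags M then corner M x else corner N x), root = root M\<rparr>"

text \<open>\<open>None\<close> stands for the single vertex, which has no flag to attach to; the
  end of the new edge then takes its place.\<close>

definition root_option :: "flag_map \<Rightarrow> nat option" where
  "root_option M = (if flags M = {} then None else Some (root M))"

lemma root_option_Some: "root_option M = Some z \<longleftrightarrow> flags M \<noteq> {} \<and> z = root M"
  by (auto simp: root_option_def)

text \<open>The edge joins the root corners of the two maps. The root of \<open>M2\<close> becomes
  the white end, which is why \<open>?d\<close> reverses the colours of \<open>M2\<close>.\<close>

lemma ex_bridge_disjoint:
  assumes bip: "bipartite_map M1" "bipartite_map M2" and disj: "flags M1 \<inter> flags M2 = {}"
  shows "\<exists>M. bipartite_map M \<and> flags M \<noteq> {} \<and> root_bridge M \<and>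
    flag_iso id M1 (root_component M) \<and> flag_iso id M2 (other_component M)"
proof -
  let ?N = "disjoint_union M1 M2"
  let ?d = "\<lambda>x. if x \<in> flags M1 then black_of M1 x else \<not> black_of M2 x"
  have em: "edged_map L" if "bipartite_map L" "x \<in> flags L" for L x
    using that by unfold_locales auto
  note M1 = edged_map.s[OF em[OF bip(1)]] edged_map.f[OF em[OF bip(1)]] edged_map.c[OF em[OF bip(1)]]
    edged_map.sf[OF em[OF bip(1)]] edged_map.b[OF em[OF bip(1)]]
  note M2 = edged_map.s[OF em[OF bip(2)]] edged_map.f[OF em[OF bip(2)]] edged_map.c[OF em[OF bip(2)]]
    edged_map.sf[OF em[OF bip(2)]] edged_map.b[OF em[OF bip(2)]]
  have not1: "x \<notin> flags M1" if "x \<in> flags M2" for x using that disj by blast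
  have conn1: "flags M1 \<subseteq> B" if "x \<in> B" "x \<in> flags M1"
    "\<And>y. y \<in> B \<Longrightarrow> y \<in> flags M1 \<Longrightarrow> side M1 y \<in> B \<and> corner M1 y \<in> B \<and> far M1 y \<in> B" for x B
    using edged_map.connected_subset[OF em[OF bip(1) that(2)] that(1,2)] that(3) by blast
  have conn2: "flags M2 \<subseteq> B" if "x \<in> B" "x \<in> flags M2"
    "\<And>y. y \<in> B \<Longrightarrow> y \<in> flags M2 \<Longrightarrow> side M2 y \<in> B \<and> corner M2 y \<in> B \<and> far M2 y \<in> B" for x B
    using edged_map.connected_subset[OF em[OF bip(2) that(2)] that(1,2)] that(3) by blast
  have roots: "flags M1 \<noteq> {} \<Longrightarrow> root M1 \<in> flags M1 \<and> black_of M1 (root M1)"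
    "flags M2 \<noteq> {} \<Longrightarrow> root M2 \<in> flags M2 \<and> black_of M2 (root M2)"
    using edged_map.r[OF em] edged_map.black(2)[OF em] bip by blast+
  interpret attachment ?N "root_option M1" "root_option M2" ?d
  proof unfold_locales
    show "finite (flags ?N)" using bip by (simp add: disjoint_union_def bipartite_map_def)
    show "free_involution (flags ?N) (side ?N)" "free_involution (flags ?N) (far ?N)"
      "free_involution (flags ?N) (corner ?N)"
      unfolding free_involution_def using M1(1-9) M2(1-9) not1
      by (auto simp: disjoint_union_def)
    show "side ?N (far ?N x) = far ?N (side ?N x) \<and> side ?N (far ?N x) \<noteq> x" if "x \<in> flags ?N" for x
      using that M1(1,4,10,11) M2(1,4,10,11) not1 by (auto simp: disjoint_union_def)
    show "vertex_colouring ?N ?d"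
      unfolding vertex_colouring_def using M1(1,4,7,12-14) M2(1,4,7,12-14) not1
      by (auto simp: disjoint_union_def)
    show "z \<in> flags ?N \<and> ?d z" if "root_option M1 = Some z" for z
      using that roots(1) by (auto simp: root_option_Some disjoint_union_def)
    show "z \<in> flags ?N \<and> \<not> ?d z" if "root_option M2 = Some z" for z
      using that roots(2) not1 by (auto simp: root_option_Some disjoint_union_def)
    fix B x assume B: "x \<in> B" "B \<subseteq> flags ?N"
      "\<And>z. z \<in> B \<Longrightarrow> side ?N z \<in> B \<and> far ?N z \<in> B \<and> corner ?N z \<in> B"
    show "\<exists>z\<in>B. root_option M1 = Some z \<or> root_option M2 = Some z"
    proof (cases "x \<in> flags M1")
      case True
      have "flags M1 \<subseteq> B" by (rule conn1[OF B(1) True]) (use B(3) in \<open>force simp: disjoint_union_def\<close>)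
      then show ?thesis using roots(1) True by (intro bexI[of _ "root M1"]) (auto simp: root_option_Some)
    next
      case False
      then have x: "x \<in> flags M2" using B by (auto simp: disjoint_union_def)
      have "flags M2 \<subseteq> B"
      proof (rule conn2[OF B(1) x])
        fix z assume "z \<in> B" "z \<in> flags M2"
        then show "side M2 z \<in> B \<and> corner M2 z \<in> B \<and> far M2 z \<in> B"
          using B(3)[of z] not1 by (simp add: disjoint_union_def)
      qed
      then show ?thesis using roots(2) x by (intro bexI[of _ "root M2"]) (auto simp: root_option_Some)
    qed
  qed
  let ?M = "attach ?N (root_option M1) (root_option M2)"
  have N1: "side ?N x = side M1 x" "far ?N x = far M1 x" "corner ?N x = corner M1 x" "x \<in> flags ?N"
    if "x \<in> flags M1" for x using that by (simp_all add: disjoint_union_def)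
  have N2: "side ?N x = side M2 x" "far ?N x = far M2 x" "corner ?N x = corner M2 x" "x \<in> flags ?N"
    if "x \<in> flags M2" for x using that not1 by (simp_all add: disjoint_union_def)
  have old: "side ?N x \<in> reach ?M z" "far ?N x \<in> reach ?M z" "corner ?N x \<in> reach ?M z"
    if "x \<in> reach ?M z" "x \<in> flags ?N" for x z
  proof -
    have xM: "x \<in> flags ?M" using that attach_flags by blast
    show "side ?N x \<in> reach ?M z" using M.reach_step(1)[OF that(1) xM] attach_side(1)[OF that(2)] by simp
    show "far ?N x \<in> reach ?M z"
      using M.reach_step(3)[OF that(1) xM] attach_far(1)[OF that(2)] new_disjoint[OF that(2)] attach_root_edge by simp
    show "corner ?N x \<in> reach ?M z" by (rule closed_old[OF _ _ that]) (auto intro: M.reach_step)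
  qed
  have kM: "k \<in> flags ?M" "k1 \<in> flags ?M" "k2 \<in> flags ?M" "k3 \<in> flags ?M"
    by (simp_all add: attach_flags new_def)
  \<comment> \<open>From the black end no step leads out of \<open>M1\<close> and the two flags of
    this end unless it uses the new edge. Hence \<open>k2\<close> is out of reach and the edge is a
    bridge.\<close>
  have up1: "reach ?M k \<subseteq> flags M1 \<union> {k, k1}"
  proof (rule M.reach_subset)
    fix x assume x: "x \<in> flags M1 \<union> {k, k1}"
    show "side ?M x \<in> flags M1 \<union> {k, k1}" using x N1 M1(1) attach_side by auto
    show "far ?M x \<in> flags M1 \<union> {k, k1}" if "x \<notin> root_edge ?M"
      using x that N1 M1(4) attach_far attach_root_edge by (auto simp: new_def)
    show "corner ?M x \<in> flags M1 \<union> {k, k1}"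
    proof (cases "x \<in> flags M1")
      case True
      show ?thesis
      proof (cases "\<exists>e\<in>new. nb e = Some x")
        case True
        then obtain e where e: "e \<in> new" "nb e = Some x" by blast
        have "black_of M1 x = (e = k \<or> e = k1)" using nb_SomeD(2)[OF e] \<open>x \<in> flags M1\<close> by simp
        moreover have "nb e = Some x \<Longrightarrow> e = k2 \<or> e = k3 \<Longrightarrow> x \<in> flags M2"
          using roots(2) M2(7) N2(3) by (auto simp: nb_def root_option_Some)
        ultimately show ?thesis using corner_nb[OF e] e not1 \<open>x \<in> flags M1\<close> by (auto simp: new_def)
      next
        case False
        then show ?thesis using corner_old[of x] N1 True M1(7) by auto
      qed
    next
      case False
      then have xk: "x = k \<or> x = k1" "x \<in> new" using x by (auto simp: new_def)
      then show ?thesis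
        using corner_new[OF xk(2)] roots(1) M1(7) N1(3) attach_side
        by (auto simp: nb_def root_option_Some split: option.splits)
    qed
  qed simp
  have "k2 \<notin> reach ?M k" using up1 fresh[of k2] N1(4)[of k2] by auto
  then have bridge: "root_bridge ?M" unfolding M.bridge_iff by (simp add: attach_root attach_far)
  have low1: "flags M1 \<subseteq> reach ?M k"
  proof (cases "flags M1 = {}")
    case False
    have "k1 \<in> reach ?M k" using M.reach_step(1)[OF M.reach_self kM(1)] by (simp add: attach_side)
    then have "corner ?M k1 \<in> reach ?M k" by (rule M.reach_step(2)[OF _ kM(2)])
    moreover have "root_option M1 = Some (root M1)" using False by (simp add: root_option_def)
    then have "corner ?M k1 = root M1" using attach_corners(1) by simp
    ultimately have "root M1 \<in> reach ?M k" by simp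
    then show ?thesis by (rule conn1) (use roots(1) False old N1 in \<open>auto, metis+\<close>)
  qed simp
  have low2: "flags M2 \<subseteq> reach ?M k2"
  proof (cases "flags M2 = {}")
    case False
    have "corner ?M k2 \<in> reach ?M k2" by (rule M.reach_step(2)[OF M.reach_self kM(3)])
    moreover have "root_option M2 = Some (root M2)" using False by (simp add: root_option_def)
    then have "corner ?M k2 = root M2" using attach_corners(2) by simp
    ultimately have "root M2 \<in> reach ?M k2" by simp
    then show ?thesis by (rule conn2) (use roots(2) False old N2 in \<open>auto, metis+\<close>)
  qed simp
  have disj': "reach ?M k \<inter> reach ?M k2 = {}"
    using M.bridge_disjoint[OF bridge] by (simp add: attach_root attach_far)
  have F1: "reach ?M k - new = flags M1"
    using up1 low1 new_disjoint N1(4) by (auto simp: new_def)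
  have F2: "reach ?M k2 - new = flags M2"
  proof
    have "reach ?M k2 \<subseteq> flags ?M" by (rule M.reach_A[OF kM(3)])
    then show "reach ?M k2 - new \<subseteq> flags M2"
      using low1 disj' attach_flags by (auto simp: disjoint_union_def)
    show "flags M2 \<subseteq> reach ?M k2 - new" using low2 new_disjoint N2(4) by blast
  qed
  have iso1: "flag_iso id M1 (root_component ?M)"
  proof (rule flag_iso_cong)
    show "flags (root_component ?M) = flags M1"
      using F1 by (simp add: M.root_component_simps(1) attach_root attach_far attach_root_edge)
    show "root (root_component ?M) = root M1" if "flags M1 \<noteq> {}"
    proof -
      have "root_option M1 = Some (root M1)" using that by (simp add: root_option_def)
      then have "corner ?M k1 = root M1" using attach_corners(1) by simp
      then show ?thesis by (simp add: M.root_component_simps(5) attach_root attach_side attach_far)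
    qed
    fix x assume x: "x \<in> flags M1"
    show "side (root_component ?M) x = side M1 x" "far (root_component ?M) x = far M1 x"
      "corner (root_component ?M) x = corner M1 x"
      using attach_side(1)[OF N1(4)[OF x]] attach_far(1)[OF N1(4)[OF x]]
        attach_corner_deleted[OF N1(4)[OF x]] N1[OF x]
      by (simp_all add: M.root_component_simps)
  qed
  have iso2: "flag_iso id M2 (other_component ?M)"
  proof (rule flag_iso_cong)
    show "flags (other_component ?M) = flags M2"
      using F2 by (simp add: M.other_component_simps(1) attach_root attach_far attach_root_edge)
    show "root (other_component ?M) = root M2" if "flags M2 \<noteq> {}"
    proof -
      have "root_option M2 = Some (root M2)" using that by (simp add: root_option_def)
      then have "corner ?M k2 = root M2" using attach_corners(2) by simp
      then show ?thesis by (simp add: M.other_component_simps(5) attach_root attach_side attach_far)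
    qed
    fix x assume x: "x \<in> flags M2"
    show "side (other_component ?M) x = side M2 x" "far (other_component ?M) x = far M2 x"
      "corner (other_component ?M) x = corner M2 x"
      using attach_side(1)[OF N2(4)[OF x]] attach_far(1)[OF N2(4)[OF x]]
        attach_corner_deleted[OF N2(4)[OF x]] N2[OF x]
      by (simp_all add: M.other_component_simps)
  qed
  show ?thesis using M.bip M.ne bridge iso1 iso2 by blast
qed

text \<open>Renames the flags so that two given maps become disjoint.\<close>

definition shift_flags :: "nat \<Rightarrow> flag_map \<Rightarrow> flag_map" where
  "shift_flags m M =
     \<lparr>flags = (\<lambda>x. x + m) ` flags M, side = (\<lambda>x. side M (x - m) + m), far = (\<lambda>x. far M (x - m) + m),
      corner = (\<lambda>x. corner M (x - m) + m), root = root M + m\<rparr>"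

lemma shift_flags:
  assumes "bipartite_map M"
  shows "bipartite_map (shift_flags m M)" "flag_iso (\<lambda>x. x + m) M (shift_flags m M)"
proof -
  let ?S = "shift_flags m M"
  show "flag_iso (\<lambda>x. x + m) M ?S"
    by (auto simp: flag_iso_def shift_flags_def bij_betw_def)
  have step: "(x + m, y + m) \<in> (steps_avoiding {} ?S)\<^sup>*" if "(x, y) \<in> (steps_avoiding {} M)\<^sup>*" for x y
    using that
  proof (induction rule: rtrancl_induct)
    case (step y z)
    then have "(y + m, z + m) \<in> steps_avoiding {} ?S" by (auto simp: steps_avoiding_def shift_flags_def)
    then show ?case using step.IH by (rule rtrancl_into_rtrancl[rotated])
  qed simp
  have "connected_avoiding {} ?S"
    using assms step by (auto simp: connected_avoiding_def bipartite_map_def shift_flags_def)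
  moreover obtain d where "vertex_colouring M d" using assms by (auto simp: bipartite_map_def)
  then have "vertex_colouring ?S (\<lambda>x. d (x - m))" by (auto simp: vertex_colouring_def shift_flags_def)
  ultimately show "bipartite_map ?S"
    using assms unfolding bipartite_map_def by (auto simp: shift_flags_def free_involution_def)
qed

lemma ex_bridge:
  assumes "bipartite_map M1" "bipartite_map M2"
  shows "\<exists>M. bipartite_map M \<and> flags M \<noteq> {} \<and> root_bridge M \<and>
    abs_rooted_map (root_component M) = abs_rooted_map M1 \<and>
    abs_rooted_map (other_component M) = abs_rooted_map M2"
proof -
  let ?m = "Suc (Max (insert 0 (flags M1)))"
  have fin: "finite (flags M1)" using assms by (simp add: bipartite_map_def)
  have "x < ?m" if "x \<in> flags M1" for x using that fin by (simp add: less_Suc_eq_le)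
  then have "flags M1 \<inter> flags (shift_flags ?m M2) = {}" by (force simp: shift_flags_def)
  from ex_bridge_disjoint[OF assms(1) shift_flags(1)[OF assms(2)] this]
  obtain M where M: "bipartite_map M" "flags M \<noteq> {}" "root_bridge M"
    "flag_iso id M1 (root_component M)" "flag_iso id (shift_flags ?m M2) (other_component M)" by blast
  interpret edged_map M using M by unfold_locales
  have "flag_iso (id \<circ> (\<lambda>x. x + ?m)) M2 (other_component M)"
    by (rule flag_iso_compose[OF shift_flags(2)[OF assms(2)] M(5)])
  then show ?thesis
    using M abs_eq_iff[OF assms(1) root_component_bipartite] abs_eq_iff[OF assms(2) other_component_bipartite]
    by metis
qed

section \<open>The recursion for rooted maps with given vertex degrees\<close>

lemma rep_bipartite: "bipartite_map (rep_rooted_map X)"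
  and abs_rep: "abs_rooted_map (rep_rooted_map X) = X"
  using Quotient3_rep_reflp[OF Quotient3_rooted_map, of X] Quotient3_abs_rep[OF Quotient3_rooted_map, of X]
  by (simp_all add: map_iso_def)

definition degs :: "rooted_map \<Rightarrow> nat \<times> nat multiset \<times> nat multiset" where
  "degs X = profile (rep_rooted_map X)"

definition bridge_class :: "rooted_map \<Rightarrow> bool" where
  "bridge_class X \<longleftrightarrow> root_bridge (rep_rooted_map X)"

definition maps_with :: "nat \<Rightarrow> nat multiset \<Rightarrow> nat multiset \<Rightarrow> rooted_map set" where
  "maps_with i \<mu> \<nu> = {X. degs X = (i, \<mu>, \<nu>)}"

lemma iso_rep:
  assumes "bipartite_map M"
  obtains h where "flag_iso h M (rep_rooted_map (abs_rooted_map M))"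
  using abs_eq_iff[OF assms rep_bipartite[of "abs_rooted_map M"]] abs_rep by metis

lemma degs_abs: "bipartite_map M \<Longrightarrow> degs (abs_rooted_map M) = profile M"
  unfolding degs_def using rep_bipartite by (rule profile_cong) (simp_all add: abs_rep)

lemma bridge_class_abs:
  assumes "bipartite_map M" "flags M \<noteq> {}"
  shows "bridge_class (abs_rooted_map M) = root_bridge M"
proof -
  obtain h where "flag_iso h M (rep_rooted_map (abs_rooted_map M))" by (rule iso_rep[OF assms(1)])
  then show ?thesis
    unfolding bridge_class_def
    using iso_maps.h_bridge[OF iso_mapsI[OF assms(1) rep_bipartite _ assms(2)]] by blast
qed

context edged_map
begin

lemma component_colour:
  assumes "x \<in> flags (root_component M)"
  shows "black_of (root_component M) x = b x"
proof -
  let ?R = "root_component M"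
  have FA: "flags ?R \<subseteq> A" using reach_A[OF r] by (auto simp: root_component_simps)
  have "vertex_colouring ?R b"
    unfolding vertex_colouring_def
  proof
    fix y assume "y \<in> flags ?R"
    then have yA: "y \<in> A" using FA by blast
    have "b (corner_deleted M y) = b y"
      using yA c s b by (auto simp: corner_deleted shortcut_def)
    then show "b (side ?R y) = b y \<and> b (corner ?R y) = b y \<and> b (far ?R y) = (\<not> b y)"
      using b yA by (auto simp: root_component_simps)
  qed
  moreover have "b (root ?R)" using E_colours b r s by (simp add: root_component_simps)
  ultimately show ?thesis using colouring_unique[OF root_component_bipartite _ _ _ assms] assms by auto
qed

lemma nonbridge_component:
  assumes "\<not> root_bridge M"
  shows "flags (root_component M) = A - E" "c (f r) \<in> A - E" "c (s r) \<in> A - E"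
    "vertex_of (root_component M) (c (f r)) = vertex_of M (f r) - E"
proof -
  show flags: "flags (root_component M) = A - E"
    using nonbridge_reach[OF assms] by (simp add: root_component_simps)
  show cf: "c (f r) \<in> A - E" "c (s r) \<in> A - E"
    using nonbridge_corner[OF assms] c f s r by (auto simp: E)
  have "vertex_of (root_component M) (c (f r)) = vertex_of M (c (f r)) - E"
    unfolding vertex_of_def[of "root_component M"] root_component_simps by (rule vertex_deleted[OF cf(1)])
  then show "vertex_of (root_component M) (c (f r)) = vertex_of M (f r) - E"
    using vertex_eq[OF f(1)[OF r] vertex_c] by simp
qed

end

section \<open>Bijections given by root deletion\<close>

lemma nonbridge_unique:
  assumes "edged_map M" "edged_map N" "\<not> root_bridge M" "\<not> root_bridge N"
    and g: "flag_iso g (root_component M) (root_component N)"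
    and far: "g (corner M (far M (root M))) = corner N (far N (root N))"
  shows "\<exists>h. flag_iso h M N"
proof -
  interpret M: edged_map M by fact
  interpret N: edged_map N by fact
  note F = M.nonbridge_component[OF assms(3)] N.nonbridge_component[OF assms(4)]
  have "flags (root_component M) \<noteq> {}" using F by auto
  then have g': "bij_betw g (flags M - root_edge M) (flags N - root_edge N)"
    "g (corner M (side M (root M))) = corner N (side N (root N))"
    "\<And>x. x \<in> flags M - root_edge M \<Longrightarrow> g (side M x) = side N (g x)"
    "\<And>x. x \<in> flags M - root_edge M \<Longrightarrow> g (far M x) = far N (g x)"
    "\<And>x. x \<in> flags M - root_edge M \<Longrightarrow> g (corner_deleted M x) = corner_deleted N (g x)"
    using g F(1) F(5) unfolding flag_iso_def M.root_component_simps(2-5) N.root_component_simps(2-5)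
    by simp_all
  have "\<exists>h. flag_iso h M N \<and> (\<forall>x\<in>flags M - root_edge M. h x = g x)"
    by (rule extend_iso[OF assms(1,2) g'(1,3-5)]) (use F g' far in auto)
  then show ?thesis by blast
qed

text \<open>The roots of the two components mark the corners where the root edge was attached, so
  the two isomorphisms together meet the conditions of \<open>extend_iso\<close>.\<close>

lemma bridge_unique:
  assumes "edged_map M" "edged_map N" "root_bridge M" "root_bridge N"
    and g1: "flag_iso g1 (root_component M) (root_component N)"
    and g2: "flag_iso g2 (other_component M) (other_component N)"
  shows "\<exists>h. flag_iso h M N"
proof -
  interpret M: edged_map M by fact
  interpret N: edged_map N by fact
  let ?F1 = "flags (root_component M)" and ?F2 = "flags (other_component M)"
  let ?G1 = "flags (root_component N)" and ?G2 = "flags (other_component N)"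
  define g where "g x = (if x \<in> ?F1 then g1 x else g2 x)" for x
  have F: "flags M - root_edge M = ?F1 \<union> ?F2" "?F1 \<inter> ?F2 = {}"
    using M.reach_cover M.bridge_disjoint[OF assms(3)]
    by (auto simp: M.root_component_simps M.other_component_simps)
  have G: "flags N - root_edge N = ?G1 \<union> ?G2" "?G1 \<inter> ?G2 = {}"
    using N.reach_cover N.bridge_disjoint[OF assms(4)]
    by (auto simp: N.root_component_simps N.other_component_simps)
  have g12: "x \<in> ?F1 \<Longrightarrow> g x = g1 x" "x \<in> ?F2 \<Longrightarrow> g x = g2 x" for x
    using F(2) by (auto simp: g_def)
  have "bij_betw g ?F1 ?G1" "bij_betw g ?F2 ?G2"
    using g1 g2 bij_betw_cong[of ?F1 g g1 ?G1] bij_betw_cong[of ?F2 g g2 ?G2] g12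
    by (auto simp: flag_iso_def)
  then have bij: "bij_betw g (flags M - root_edge M) (flags N - root_edge N)"
    unfolding F(1) G(1) using G(2) by (rule bij_betw_combine)
  have closed: "side M x \<in> ?F1 \<and> far M x \<in> ?F1 \<and> corner_deleted M x \<in> ?F1" if "x \<in> ?F1" for x
    using M.root_component_bipartite that
    by (simp add: bipartite_map_def free_involution_def M.root_component_simps)
  have closed2: "side M x \<in> ?F2 \<and> far M x \<in> ?F2 \<and> corner_deleted M x \<in> ?F2" if "x \<in> ?F2" for x
    using M.other_component_bipartite that
    by (simp add: bipartite_map_def free_involution_def M.other_component_simps)
  have h1: "g1 (side M x) = side N (g1 x) \<and> g1 (far M x) = far N (g1 x) \<and>
      g1 (corner_deleted M x) = corner_deleted N (g1 x)" if "x \<in> ?F1" for x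
    using g1 that unfolding flag_iso_def M.root_component_simps(2-5) N.root_component_simps(2-5) by blast
  have h2: "g2 (side M x) = side N (g2 x) \<and> g2 (far M x) = far N (g2 x) \<and>
      g2 (corner_deleted M x) = corner_deleted N (g2 x)" if "x \<in> ?F2" for x
    using g2 that unfolding flag_iso_def M.other_component_simps(2-5) N.other_component_simps(2-5) by blast
  have hom: "g (side M x) = side N (g x) \<and> g (far M x) = far N (g x) \<and>
      g (corner_deleted M x) = corner_deleted N (g x)" if x: "x \<in> flags M - root_edge M" for x
  proof -
    consider "x \<in> ?F1" | "x \<in> ?F2" using x unfolding F(1) by blast
    then show ?thesis
    proof cases
      case 1
      then show ?thesis using h1[OF 1] closed[OF 1] by (simp add: g12(1))
    next
      case 2
      then show ?thesis using h2[OF 2] closed2[OF 2] by (simp add: g12(2))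
    qed
  qed
  have e1: "corner M (side M (root M)) \<in> root_edge M \<longleftrightarrow> ?F1 = {}"
    "corner N (side N (root N)) \<in> root_edge N \<longleftrightarrow> ?G1 = {}"
    "corner M (far M (root M)) \<in> root_edge M \<longleftrightarrow> ?F2 = {}"
    "corner N (far N (root N)) \<in> root_edge N \<longleftrightarrow> ?G2 = {}"
    unfolding M.root_component_simps(1) M.other_component_simps(1)
      N.root_component_simps(1) N.other_component_simps(1)
    using M.component_empty(1) M.neighbour_reach(1) apply blast
    using N.component_empty(1) N.neighbour_reach(1) apply blast
    using M.component_empty(2) M.neighbour_reach(2) apply blast
    using N.component_empty(2) N.neighbour_reach(2) by blast
  have e2: "?F1 = {} \<longleftrightarrow> ?G1 = {}" "?F2 = {} \<longleftrightarrow> ?G2 = {}"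
    using flag_iso_empty g1 g2 by blast+
  have r1: "g (corner M (side M (root M))) = corner N (side N (root N))"
    if "corner M (side M (root M)) \<notin> root_edge M"
  proof -
    have "corner M (side M (root M)) \<in> ?F1"
      using M.neighbour_reach that by (simp add: M.root_component_simps)
    then show ?thesis
      using g1 g12(1) unfolding flag_iso_def M.root_component_simps(5) N.root_component_simps(5) by auto
  qed
  have r2: "g (corner M (far M (root M))) = corner N (far N (root N))"
    if "corner M (far M (root M)) \<notin> root_edge M"
  proof -
    have "corner M (far M (root M)) \<in> ?F2"
      using M.neighbour_reach that by (simp add: M.other_component_simps)
    then show ?thesis
      using g2 g12(2) unfolding flag_iso_def M.other_component_simps(5) N.other_component_simps(5) by auto
  qed
  have "\<exists>h. flag_iso h M N \<and> (\<forall>x\<in>flags M - root_edge M. h x = g x)"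
    by (rule extend_iso[OF assms(1,2) bij]) (use hom r1 r2 e1 e2 in simp_all)
  then show ?thesis by blast
qed

lemma edged_rep:
  assumes "degs X = (Suc i, \<mu>, \<nu>)"
  shows "edged_map (rep_rooted_map X)"
  using assms rep_bipartite by unfold_locales (auto simp: degs_def profile_def)

definition component_pair :: "rooted_map \<Rightarrow> rooted_map \<times> rooted_map" where
  "component_pair X = (abs_rooted_map (root_component (rep_rooted_map X)),
     abs_rooted_map (other_component (rep_rooted_map X)))"

text \<open>The possible second components of a bridge, indexed by their contribution to the black
  and white degrees of the whole map. The root has degree \<open>j\<close> in the component and
  counts in \<nu> as a white vertex of degree \<open>j + 1\<close>; in the profile the colours are
  exchanged.\<close>

definition far_maps :: "nat multiset \<Rightarrow> nat multiset \<Rightarrow> rooted_map set" where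
  "far_maps \<mu> \<nu> = {Y. \<exists>j. j + 1 \<in># \<nu> \<and> degs Y = (j, \<nu> - {#j + 1#}, \<mu>)}"

definition splits :: "'a multiset \<Rightarrow> ('a multiset \<times> 'a multiset) set" where
  "splits \<mu> = {(a, b). a + b = \<mu>}"

text \<open>Injective by \<open>bridge_unique\<close> and onto by \<open>ex_bridge\<close>; the
  union runs over the distributions of the vertices to the two components.\<close>

lemma bridge_bij:
  "bij_betw component_pair {X \<in> maps_with (Suc i) \<mu> \<nu>. bridge_class X}
     (\<Union>((a, a'), (b, b')) \<in> splits \<mu> \<times> splits \<nu>. maps_with i a b \<times> far_maps a' b')"
  (is "bij_betw _ ?S ?T")
  unfolding bij_betw_def
proof
  show "inj_on component_pair ?S"
  proof (rule inj_onI)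
    fix X X' assume X: "X \<in> ?S" and X': "X' \<in> ?S" and eq: "component_pair X = component_pair X'"
    have em: "edged_map (rep_rooted_map X)" "edged_map (rep_rooted_map X')"
      using edged_rep X X' by (auto simp: maps_with_def)
    interpret M: edged_map "rep_rooted_map X" by fact
    interpret N: edged_map "rep_rooted_map X'" by fact
    have "\<exists>h. flag_iso h (root_component (rep_rooted_map X)) (root_component (rep_rooted_map X'))"
      "\<exists>h. flag_iso h (other_component (rep_rooted_map X)) (other_component (rep_rooted_map X'))"
      using eq abs_eq_iff M.root_component_bipartite N.root_component_bipartite
        M.other_component_bipartite N.other_component_bipartite
      by (simp_all add: component_pair_def)
    then have "\<exists>h. flag_iso h (rep_rooted_map X) (rep_rooted_map X')"
      using bridge_unique[OF em] X X' by (auto simp: bridge_class_def)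
    then show "X = X'" using abs_eq_iff[OF rep_bipartite rep_bipartite, of X X'] abs_rep by simp
  qed
  show "component_pair ` ?S = ?T"
  proof (intro subset_antisym subsetI)
    fix p assume "p \<in> component_pair ` ?S"
    then obtain X where X: "p = component_pair X" "X \<in> maps_with (Suc i) \<mu> \<nu>" "bridge_class X" by blast
    interpret M: edged_map "rep_rooted_map X" using edged_rep X(2) by (auto simp: maps_with_def)
    have br: "root_bridge (rep_rooted_map X)" using X(3) by (simp add: bridge_class_def)
    have "profile (rep_rooted_map X) = (Suc i, \<mu>, \<nu>)" using X(2) by (simp add: maps_with_def degs_def)
    from M.profile_bridge[OF br this] obtain j \<mu>1 \<nu>1 \<mu>2 \<nu>2 where
      *: "\<mu> = \<mu>1 + \<mu>2" "\<nu> = add_mset (j + 1) (\<nu>1 + \<nu>2)"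
      "profile (root_component (rep_rooted_map X)) = (i, \<mu>1, \<nu>1)"
      "profile (other_component (rep_rooted_map X)) = (j, \<nu>2, \<mu>2)" by auto
    have "((\<mu>1, \<mu>2), (\<nu>1, add_mset (j + 1) \<nu>2)) \<in> splits \<mu> \<times> splits \<nu>"
      using * by (simp add: splits_def)
    moreover have "fst p \<in> maps_with i \<mu>1 \<nu>1"
      using *(3) degs_abs[OF M.root_component_bipartite] X(1) by (simp add: component_pair_def maps_with_def)
    moreover have "snd p \<in> far_maps \<mu>2 (add_mset (j + 1) \<nu>2)"
      using *(4) degs_abs[OF M.other_component_bipartite] X(1)
      unfolding component_pair_def far_maps_def by (auto intro!: exI[of _ j])
    ultimately show "p \<in> ?T"
      by (intro UN_I[of "((\<mu>1, \<mu>2), (\<nu>1, add_mset (j + 1) \<nu>2))"]) (simp_all add: mem_Times_iff)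
  next
    fix p assume "p \<in> ?T"
    then obtain a a' b b' Y Z where *: "a + a' = \<mu>" "b + b' = \<nu>" "p = (Y, Z)" "Y \<in> maps_with i a b"
      "Z \<in> far_maps a' b'" by (auto simp: splits_def)
    then obtain j where j: "j + 1 \<in># b'" "degs Z = (j, b' - {#j + 1#}, a')" by (auto simp: far_maps_def)
    obtain M where M: "bipartite_map M" "flags M \<noteq> {}" "root_bridge M"
      "abs_rooted_map (root_component M) = abs_rooted_map (rep_rooted_map Y)"
      "abs_rooted_map (other_component M) = abs_rooted_map (rep_rooted_map Z)"
      using ex_bridge[OF rep_bipartite rep_bipartite] by blast
    interpret M: edged_map M using M by unfold_locales
    obtain h where h: "flag_iso h M (rep_rooted_map (abs_rooted_map M))" by (rule iso_rep[OF M(1)])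
    interpret I: iso_maps M "rep_rooted_map (abs_rooted_map M)" h
      by (rule iso_mapsI[OF M(1) rep_bipartite h M(2)])
    have "component_pair (abs_rooted_map M) = (abs_rooted_map (root_component M), abs_rooted_map (other_component M))"
      using I.h_root_component I.h_other_component
        abs_eq_iff[OF M.root_component_bipartite I.N.root_component_bipartite]
        abs_eq_iff[OF M.other_component_bipartite I.N.other_component_bipartite]
      unfolding component_pair_def by metis
    then have cp: "component_pair (abs_rooted_map M) = p" using M *(3) by (simp add: abs_rep)
    have pY: "profile (root_component M) = (i, a, b)"
      using degs_abs[OF M.root_component_bipartite] M(4) *(4) by (simp add: abs_rep maps_with_def)
    have pZ: "profile (other_component M) = (j, b' - {#j + 1#}, a')"
      using degs_abs[OF M.other_component_bipartite] M(5) j(2) by (simp add: abs_rep)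
    obtain i0 \<mu>0 \<nu>0 where p0: "profile M = (i0, \<mu>0, \<nu>0)" by (cases "profile M")
    have "profile M = (Suc i, \<mu>, \<nu>)"
      using M.profile_bridge[OF M(3) p0] pY pZ p0 * j by auto
    then have "abs_rooted_map M \<in> ?S"
      using degs_abs[OF M(1)] bridge_class_abs[OF M(1,2)] M(3) by (simp add: maps_with_def)
    then show "p \<in> component_pair ` ?S" using cp by (metis imageI)
  qed
qed

text \<open>Flags instead of corners: the two flags of a white corner stand for the two ways to
  attach an edge there, which are twists of each other by
  \<open>attach_white_corner\<close>.\<close>

definition white_flags :: "nat \<Rightarrow> flag_map \<Rightarrow> nat set" where
  "white_flags j N = {y \<in> flags N. \<not> black_of N y \<and> card (vertex_of N y) div 2 = j}"

definition shrinks :: "nat multiset \<Rightarrow> nat set" where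
  "shrinks \<nu> = {j. 1 \<le> j \<and> j + 1 \<in># \<nu>}"

text \<open>An isomorphism between two results induces one between the old maps. These then have the
  same representative, on which it is the identity by \<open>iso_unique\<close>, so the flags of
  attachment agree too. Conversely, a map is recovered by reattaching the edge at the flag that
  faced its white end.\<close>

lemma nonbridge_bij:
  "bij_betw (\<lambda>(j, Y, y). abs_rooted_map (attach_white (rep_rooted_map Y) y))
     (SIGMA j:shrinks \<nu>. SIGMA Y:maps_with i \<mu> (add_mset j (\<nu> - {#j + 1#})). white_flags j (rep_rooted_map Y))
     {X \<in> maps_with (Suc i) \<mu> \<nu>. \<not> bridge_class X}"
  (is "bij_betw ?F ?P ?S")
  unfolding bij_betw_def
proof
  have att: "bipartite_map (attach_white N y)" "flags (attach_white N y) \<noteq> {}"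
      "\<not> root_bridge (attach_white N y)" "flag_iso id N (root_component (attach_white N y))"
      "corner (attach_white N y) (far (attach_white N y) (root (attach_white N y))) = y"
    if "bipartite_map N" "y \<in> white_flags j N" for N y j
    using attach_white[OF that(1), of y] that(2) by (auto simp: white_flags_def)
  show "inj_on ?F ?P"
  proof (rule inj_onI)
    fix p p' assume "p \<in> ?P" "p' \<in> ?P" and eq: "?F p = ?F p'"
    then obtain j Y y j' Y' y' where p: "p = (j, Y, y)" "p' = (j', Y', y')"
      and y: "y \<in> white_flags j (rep_rooted_map Y)" "y' \<in> white_flags j' (rep_rooted_map Y')" by auto
    let ?N = "rep_rooted_map Y" and ?N' = "rep_rooted_map Y'"
    note A = att[OF rep_bipartite y(1)] and A' = att[OF rep_bipartite y(2)]
    let ?M = "attach_white ?N y" and ?M' = "attach_white ?N' y'"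
    obtain h where h: "flag_iso h ?M ?M'" using eq abs_eq_iff[OF A(1) A'(1)] p by auto
    interpret I: iso_maps ?M ?M' h by (rule iso_mapsI[OF A(1) A'(1) h A(2)])
    have "flag_iso (h \<circ> id) ?N (root_component ?M')"
      by (rule flag_iso_compose[OF A(4) I.h_root_component])
    then have h': "flag_iso h ?N (root_component ?M')" by simp
    have "abs_rooted_map ?N = abs_rooted_map (root_component ?M')"
      using abs_eq_iff[OF rep_bipartite I.N.root_component_bipartite] h' by blast
    also have "\<dots> = abs_rooted_map ?N'"
      using abs_eq_iff[OF rep_bipartite I.N.root_component_bipartite] A'(4) by metis
    finally have Y: "Y = Y'" by (simp add: abs_rep)
    have ne: "flags ?N \<noteq> {}" using y by (auto simp: white_flags_def)
    interpret J: iso_maps ?N "root_component ?M'" h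
      by (rule iso_mapsI[OF rep_bipartite I.N.root_component_bipartite h' ne])
    have "id y = h y"
      by (rule J.iso_unique[of id]) (use A'(4) Y y in \<open>simp_all add: white_flags_def\<close>)
    moreover have "h y = y'"
      using I.h(2,3,4) I.M.r I.M.f A(5) A'(5) by metis
    ultimately have "y = y'" by simp
    then show "p = p'" using p Y y by (simp add: white_flags_def)
  qed
  show "?F ` ?P = ?S"
  proof (intro subset_antisym subsetI)
    fix X assume "X \<in> ?F ` ?P"
    then obtain j Y y where X: "X = abs_rooted_map (attach_white (rep_rooted_map Y) y)"
      and j: "1 \<le> j" "j + 1 \<in># \<nu>" and Y: "Y \<in> maps_with i \<mu> (add_mset j (\<nu> - {#j + 1#}))"
      and y: "y \<in> white_flags j (rep_rooted_map Y)" by (auto simp: shrinks_def)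
    let ?N = "rep_rooted_map Y" and ?M = "attach_white (rep_rooted_map Y) y"
    note A = att[OF rep_bipartite y]
    interpret M: edged_map ?M using A by unfold_locales
    have ne: "flags ?N \<noteq> {}" using y by (auto simp: white_flags_def)
    interpret J: iso_maps ?N "root_component ?M" id
      by (rule iso_mapsI[OF rep_bipartite M.root_component_bipartite A(4) ne])
    obtain i0 \<mu>0 \<nu>0 where p0: "profile ?M = (i0, \<mu>0, \<nu>0)" by (cases "profile ?M")
    have "vertex_of ?M (far ?M (root ?M)) - root_edge ?M = vertex_of ?N y"
      using M.nonbridge_component(4)[OF A(3)] A(5) J.h_vertex[of y] y by (simp add: white_flags_def)
    then have "card (vertex_of ?M (far ?M (root ?M)) - root_edge ?M) div 2 = j"
      using y by (simp add: white_flags_def)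
    moreover have "profile (root_component ?M) = (i, \<mu>, add_mset j (\<nu> - {#j + 1#}))"
      using J.h_profile Y by (simp add: maps_with_def degs_def)
    ultimately have "profile ?M = (Suc i, \<mu>, \<nu>)"
      using M.profile_nonbridge[OF A(3) p0] p0 j by auto
    then show "X \<in> ?S"
      using X degs_abs[OF A(1)] bridge_class_abs[OF A(1,2)] A(3) by (simp add: maps_with_def)
  next
    fix X assume X: "X \<in> ?S"
    let ?M = "rep_rooted_map X"
    interpret M: edged_map ?M using edged_rep X by (auto simp: maps_with_def)
    have nb: "\<not> root_bridge ?M" using X by (simp add: bridge_class_def)
    note F = M.nonbridge_component[OF nb]
    let ?R = "root_component ?M"
    let ?y = "corner ?M (far ?M (root ?M))"
    have "profile ?M = (Suc i, \<mu>, \<nu>)" using X by (simp add: maps_with_def degs_def)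
    from M.profile_nonbridge[OF nb this] obtain j \<nu>' where
      j: "j = card (vertex_of ?M (far ?M (root ?M)) - root_edge ?M) div 2" "1 \<le> j"
      "\<nu> = add_mset (j + 1) \<nu>'" "profile ?R = (i, \<mu>, add_mset j \<nu>')" by auto
    define Y where "Y = abs_rooted_map ?R"
    let ?N = "rep_rooted_map Y"
    obtain g where g: "flag_iso g ?R ?N" unfolding Y_def by (rule iso_rep[OF M.root_component_bipartite])
    have ne: "flags ?R \<noteq> {}" using F by auto
    interpret G: iso_maps ?R ?N g
      by (rule iso_mapsI[OF M.root_component_bipartite rep_bipartite g ne])
    have yR: "?y \<in> flags ?R" using F by simp
    have "\<not> black_of ?N (g ?y)"
      using G.h_black[OF yR] M.component_colour[OF yR] M.b M.E_colours M.f M.r by simp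
    moreover have "card (vertex_of ?N (g ?y)) div 2 = j"
    proof -
      have "vertex_of ?R ?y \<subseteq> flags ?R" by (rule G.M.vertex_A[OF yR])
      then have "card (g ` vertex_of ?R ?y) = card (vertex_of ?R ?y)"
        using G.h_inj by (metis card_image inj_on_subset)
      then show ?thesis using G.h_vertex[OF yR] F(4) j(1) by simp
    qed
    ultimately have gy: "g ?y \<in> white_flags j ?N" using G.h(5)[OF yR] by (simp add: white_flags_def)
    note A = att[OF rep_bipartite gy]
    have "flag_iso (id \<circ> g) ?R (root_component (attach_white ?N (g ?y)))"
      by (rule flag_iso_compose[OF g A(4)])
    moreover have "edged_map (attach_white ?N (g ?y))" using A by unfold_locales
    ultimately have "\<exists>h. flag_iso h ?M (attach_white ?N (g ?y))"
      by (intro nonbridge_unique[OF M.edged_map_axioms _ nb A(3)]) (use A(5) in auto)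
    then have "X = abs_rooted_map (attach_white ?N (g ?y))"
      using abs_eq_iff[OF rep_bipartite A(1), of X] by (simp add: abs_rep)
    moreover have "Y \<in> maps_with i \<mu> (add_mset j (\<nu> - {#j + 1#}))"
      using j(3,4) degs_abs[OF M.root_component_bipartite] by (simp add: Y_def maps_with_def)
    ultimately show "X \<in> ?F ` ?P"
      using gy j by (intro image_eqI[of _ _ "(j, Y, g ?y)"]) (auto simp: shrinks_def)
  qed
qed

lemma profile_empty: "flags M = {} \<Longrightarrow> profile M = (0, {#}, {#})"
  by (simp add: profile_def)

lemma maps_with_0:
  assumes "bipartite_map M" "flags M = {}"
  shows "maps_with 0 \<mu> \<nu> = (if \<mu> = {#} \<and> \<nu> = {#} then {abs_rooted_map M} else {})"
proof -
  have "degs X = (0, \<mu>, \<nu>) \<longleftrightarrow> \<mu> = {#} \<and> \<nu> = {#} \<and> X = abs_rooted_map M" for X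
  proof
    assume X: "degs X = (0, \<mu>, \<nu>)"
    have 1: "flags (rep_rooted_map X) = {}"
    proof (rule ccontr)
      assume "flags (rep_rooted_map X) \<noteq> {}"
      then interpret N: edged_map "rep_rooted_map X" using rep_bipartite by unfold_locales
      have "card (vertex_of (rep_rooted_map X) (root (rep_rooted_map X))) div 2 = 0"
        using X N.profile_M by (simp add: degs_def)
      moreover have "2 \<le> card (vertex_of (rep_rooted_map X) (root (rep_rooted_map X)))"
        by (rule N.card_vertex_deleted(2)) simp
      ultimately show False by linarith
    qed
    then have "flag_iso id (rep_rooted_map X) M" using assms(2) by (simp add: flag_iso_def)
    then have "abs_rooted_map (rep_rooted_map X) = abs_rooted_map M"
      using abs_eq_iff[OF rep_bipartite assms(1)] by blast
    then show "\<mu> = {#} \<and> \<nu> = {#} \<and> X = abs_rooted_map M"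
      using X profile_empty[OF 1] by (simp add: abs_rep degs_def)
  next
    assume "\<mu> = {#} \<and> \<nu> = {#} \<and> X = abs_rooted_map M"
    then show "degs X = (0, \<mu>, \<nu>)" using degs_abs[OF assms(1)] profile_empty[OF assms(2)] by simp
  qed
  then show ?thesis by (auto simp: maps_with_def)
qed

lemma ex_empty_map: "\<exists>M. bipartite_map M \<and> flags M = {}"
  by (rule exI[of _ "\<lparr>flags = {}, side = id, far = id, corner = id, root = 0\<rparr>"])
    (simp add: bipartite_map_def free_involution_def connected_avoiding_def vertex_colouring_def)

section \<open>Finiteness of the sets of maps\<close>

lemma finite_submultisets: "finite {a. a \<subseteq># \<mu>}"
proof (induction \<mu>)
  case (add x \<mu>)
  have "{a. a \<subseteq># add_mset x \<mu>} \<subseteq> {a. a \<subseteq># \<mu>} \<union> add_mset x ` {a. a \<subseteq># \<mu>}"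
  proof
    fix a assume "a \<in> {a. a \<subseteq># add_mset x \<mu>}"
    then have a: "a \<subseteq># add_mset x \<mu>" by simp
    show "a \<in> {a. a \<subseteq># \<mu>} \<union> add_mset x ` {a. a \<subseteq># \<mu>}"
    proof (cases "x \<in># a")
      case True
      then obtain a' where "a = add_mset x a'" by (metis insert_DiffM)
      then show ?thesis using a by auto
    next
      case False
      then have "count a y \<le> count \<mu> y" for y
        using mset_subset_eq_count[OF a, of y] by (auto simp: not_in_iff split: if_splits)
      then show ?thesis by (simp add: mset_subset_eqI)
    qed
  qed
  then show ?case using add.IH by (meson finite_Un finite_imageI finite_subset)
qed simp

lemma finite_splits: "finite (splits \<mu>)"
proof (rule finite_subset)
  show "splits \<mu> \<subseteq> {a. a \<subseteq># \<mu>} \<times> {a. a \<subseteq># \<mu>}" by (auto simp: splits_def)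
  show "finite ({a. a \<subseteq># \<mu>} \<times> {a. a \<subseteq># \<mu>})" by (intro finite_cartesian_product finite_submultisets)
qed

lemma finite_shrinks: "finite (shrinks \<nu>)"
proof (rule finite_subset)
  show "shrinks \<nu> \<subseteq> (\<lambda>j. j - 1) ` set_mset \<nu>"
    by (force simp: shrinks_def image_iff)
qed simp

lemma finite_far_parts: "finite {j. j + 1 \<in># \<nu>}" for \<nu> :: "nat multiset"
proof (rule finite_subset)
  show "{j. j + 1 \<in># \<nu>} \<subseteq> (\<lambda>j. j - 1) ` set_mset \<nu>"
    by (force simp: image_iff)
qed simp

lemma finite_white_flags: "bipartite_map N \<Longrightarrow> finite (white_flags j N)"
  by (simp add: white_flags_def bipartite_map_def)

lemma far_maps_Union: "far_maps \<mu> \<nu> = (\<Union>j\<in>{j. j + 1 \<in># \<nu>}. maps_with j (\<nu> - {#j + 1#}) \<mu>)"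
  by (auto simp: far_maps_def maps_with_def)

lemma sum_mset_remove: "x \<in># \<nu> \<Longrightarrow> sum_mset \<nu> = x + sum_mset (\<nu> - {#x#})" for \<nu> :: "nat multiset"
  by (metis insert_DiffM sum_mset.add_mset)

text \<open>For maps that exist the measure is twice the number of edges, and deletion lowers it in
  each component. Finiteness matters because a sum over an infinite set would be 0 by
  convention.\<close>

lemma finite_maps_with: "finite (maps_with i \<mu> \<nu>)"
proof (induction "i + sum_mset \<mu> + sum_mset \<nu>" arbitrary: i \<mu> \<nu> rule: less_induct)
  case less
  show ?case
  proof (cases i)
    case 0
    then show ?thesis using maps_with_0 ex_empty_map by (metis finite.emptyI finite.insertI)
  next
    case (Suc i')
    let ?B = "{X \<in> maps_with (Suc i') \<mu> \<nu>. bridge_class X}"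
    let ?NB = "{X \<in> maps_with (Suc i') \<mu> \<nu>. \<not> bridge_class X}"
    have IH: "finite (maps_with k a b)" if "k + sum_mset a + sum_mset b < Suc i' + sum_mset \<mu> + sum_mset \<nu>" for k a b
      using less.hyps[of k a b] that Suc by simp
    have far: "finite (far_maps a' b')" if "(a, a') \<in> splits \<mu>" "(b, b') \<in> splits \<nu>" for a a' b b'
      unfolding far_maps_Union
    proof (rule finite_UN_I[OF finite_far_parts])
      fix j assume "j \<in> {j. j + 1 \<in># b'}"
      then have "sum_mset b' = j + 1 + sum_mset (b' - {#j + 1#})" by (intro sum_mset_remove) simp
      then show "finite (maps_with j (b' - {#j + 1#}) a')"
        using that by (intro IH) (auto simp: splits_def)
    qed
    have "finite (maps_with i' a b)" if "(a, a') \<in> splits \<mu>" "(b, b') \<in> splits \<nu>" for a a' b b'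
      using that by (intro IH) (auto simp: splits_def)
    then have "finite (\<Union>((a, a'), (b, b')) \<in> splits \<mu> \<times> splits \<nu>. maps_with i' a b \<times> far_maps a' b')"
      using far by (intro finite_UN_I) (auto simp: finite_splits)
    then have "finite ?B" using bij_betw_finite[OF bridge_bij] by blast
    moreover have "finite ?NB"
    proof -
      have "finite (maps_with i' \<mu> (add_mset j (\<nu> - {#j + 1#})))" if "j \<in> shrinks \<nu>" for j
      proof (rule IH)
        have "sum_mset \<nu> = j + 1 + sum_mset (\<nu> - {#j + 1#})"
          using that by (intro sum_mset_remove) (simp add: shrinks_def)
        then show "i' + sum_mset \<mu> + sum_mset (add_mset j (\<nu> - {#j + 1#})) < Suc i' + sum_mset \<mu> + sum_mset \<nu>"
          by simp
      qed
      then show ?thesis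
        using bij_betw_finite[OF nonbridge_bij[of \<nu> i' \<mu>]] finite_white_flags[OF rep_bipartite]
        by (simp add: finite_shrinks finite_SigmaI)
    qed
    moreover have "maps_with (Suc i') \<mu> \<nu> = ?B \<union> ?NB" by blast
    ultimately show ?thesis using Suc by (metis finite_Un)
  qed
qed

lemma flag_iso_id:
  assumes "flag_iso id N L" "flag_iso id N L'"
  shows "flag_iso id L L'"
proof -
  have "flags L = flags N" "flags L' = flags N" using assms by (auto simp: flag_iso_def bij_betw_def)
  then show ?thesis using assms by (simp add: flag_iso_def)
qed

text \<open>In the twist, the flag at the white end that comes first after the root is the other
  side of the old one, and beyond the corner it faces \<open>corner N y\<close> instead of
  \<open>y\<close>. By \<open>nonbridge_unique\<close> this flag and the deletion determine the
  map.\<close>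

lemma attach_white_corner:
  assumes N: "bipartite_map N" and y: "y \<in> white_flags j N"
  shows "corner N y \<in> white_flags j N"
    "abs_rooted_map (attach_white N (corner N y)) = abs_rooted_map (twist_root (attach_white N y))"
proof -
  interpret N: edged_map N using N y by unfold_locales (auto simp: white_flags_def)
  have yN: "y \<in> flags N" "\<not> black_of N y" "card (vertex_of N y) div 2 = j"
    using y by (auto simp: white_flags_def)
  show cy: "corner N y \<in> white_flags j N"
    using yN N.c(1) N.b(2) N.vertex_eq[OF yN(1) N.vertex_c] by (simp add: white_flags_def)
  have cyN: "corner N y \<in> flags N" "\<not> black_of N (corner N y)" using cy by (auto simp: white_flags_def)
  note A = attach_white[OF N yN(1,2)] and A' = attach_white[OF N cyN]
  let ?M = "attach_white N y" and ?M' = "attach_white N (corner N y)"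
  let ?T = "twist_root ?M"
  interpret M: edged_map ?M using A by unfold_locales
  interpret M': edged_map ?M' using A' by unfold_locales
  interpret T: edged_map ?T by (rule M.twist_edged)
  have "flag_iso (id \<circ> id) N (root_component ?T)"
    by (rule flag_iso_compose[OF A(4) M.twist_component_iso])
  then have iso: "flag_iso id (root_component ?T) (root_component ?M')"
    by (intro flag_iso_id[OF _ A'(4)]) simp
  have "corner ?T (far ?T (root ?T)) = corner N y"
  proof -
    have rE: "root ?M \<in> root_edge ?M" by (simp add: M.E)
    have "corner ?M y = far ?M (root ?M)" using A(5) M.c(3) M.f M.r by metis
    then have "corner_deleted ?M y = corner ?M (side ?M (far ?M (root ?M)))"
      by (simp add: M.corner_deleted shortcut_def M.E)
    moreover have "corner N y = corner_deleted ?M y"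
      using A(4) yN by (simp add: flag_iso_def M.root_component_simps)
    ultimately show ?thesis using rE by (simp add: M.twist_simps)
  qed
  then have "\<exists>h. flag_iso h ?T ?M'"
    using nonbridge_unique[OF T.edged_map_axioms M'.edged_map_axioms _ A'(3) iso] A(3) A'(5)
    by (simp add: M.twist_bridge)
  then show "abs_rooted_map ?M' = abs_rooted_map ?T"
    using abs_eq_iff[OF T.bip M'.bip] by simp
qed

lemma count_degrees_of:
  assumes "finite S"
  shows "count (degrees_of S) j = card {V \<in> S. card V div 2 = j}"
proof -
  have "count (degrees_of S) j = (\<Sum>V\<in>{V \<in> S. card V div 2 = j}. 1)"
    unfolding count_image_mset using assms by (intro sum.cong) auto
  then show ?thesis by simp
qed

lemma card_white_flags:
  assumes N: "bipartite_map N" and p: "profile N = (i, \<mu>, \<nu>)"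
  shows "card (white_flags j N) = 2 * (j * count \<nu> j)"
proof (cases "flags N = {}")
  case True
  then show ?thesis using p by (auto simp: white_flags_def profile_def)
next
  case False
  interpret N: edged_map N using N False by unfold_locales
  let ?W = "vertex_of N ` {x \<in> flags N. \<not> black_of N x}"
  let ?J = "{V \<in> ?W. card V div 2 = j}"
  have "white_flags j N = \<Union>?J"
  proof (intro subset_antisym subsetI)
    fix y assume "y \<in> white_flags j N"
    then show "y \<in> \<Union>?J" using N.vertex_self by (auto simp: white_flags_def)
  next
    fix y assume "y \<in> \<Union>?J"
    then obtain x where x: "x \<in> flags N" "\<not> black_of N x" "card (vertex_of N x) div 2 = j" "y \<in> vertex_of N x"
      by auto
    then show "y \<in> white_flags j N"
      using subsetD[OF N.vertex_A[OF x(1)] x(4)] N.vertex_colour[OF x(1,4)] N.vertex_eq[OF x(1,4)]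
      by (simp add: white_flags_def)
  qed
  moreover have "card (\<Union>?J) = (\<Sum>V\<in>?J. card V)"
  proof (rule card_Union_disjoint)
    show "pairwise disjnt ?J"
    proof (rule pairwiseI)
      fix U V assume "U \<in> ?J" "V \<in> ?J" "U \<noteq> V"
      then obtain x z where "x \<in> flags N" "z \<in> flags N" "U = vertex_of N x" "V = vertex_of N z" by auto
      then show "disjnt U V" using N.vertex_eq \<open>U \<noteq> V\<close> unfolding disjnt_iff by metis
    qed
    show "finite V" if "V \<in> ?J" for V using that N.finite_vertex by auto
  qed
  moreover have "card V = 2 * j" if V: "V \<in> ?J" for V
  proof -
    have "even (card V)" "card V div 2 = j" using V N.even_vertex by auto
    then show ?thesis by presburger
  qed
  then have "(\<Sum>V\<in>?J. card V) = (\<Sum>V\<in>?J. 2 * j)" by (rule sum.cong[OF refl])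
  ultimately have "card (white_flags j N) = (\<Sum>V\<in>?J. 2 * j)" by (simp only:)
  then have "card (white_flags j N) = card ?J * (2 * j)" by (simp only: sum_constant of_nat_id)
  moreover have "count \<nu> j = card ?J"
    using p False N.fin by (simp add: profile_def count_degrees_of[symmetric])
  ultimately show ?thesis by simp
qed

section \<open>Generating series in powers of \<beta>\<close>

context
  fixes \<eta> :: "rooted_map \<Rightarrow> nat" and \<beta> :: "'a :: field_char_0"
  assumes \<eta>: "measure_of_non_orientability \<eta>"
begin

definition degree_series :: "nat \<Rightarrow> nat multiset \<Rightarrow> nat multiset \<Rightarrow> 'a" where
  "degree_series i \<mu> \<nu> = (\<Sum>X\<in>maps_with i \<mu> \<nu>. \<beta> ^ \<eta> X)"

definition far_series :: "nat multiset \<Rightarrow> nat multiset \<Rightarrow> 'a" where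
  "far_series \<mu> \<nu> = (\<Sum>j | j + 1 \<in># \<nu>. degree_series j (\<nu> - {#j + 1#}) \<mu>)"

lemma degree_series_0: "degree_series 0 \<mu> \<nu> = (if \<mu> = {#} \<and> \<nu> = {#} then 1 else 0)"
proof -
  obtain M where M: "bipartite_map M" "flags M = {}" using ex_empty_map by blast
  have "\<eta> (abs_rooted_map M) = 0"
    using \<eta> M unfolding measure_of_non_orientability_def by metis
  then show ?thesis by (simp add: degree_series_def maps_with_0[OF M])
qed

lemma far_maps_sum: "(\<Sum>X\<in>far_maps \<mu> \<nu>. \<beta> ^ \<eta> X) = far_series \<mu> \<nu>"
  unfolding far_maps_Union far_series_def degree_series_def
proof (rule sum.UNION_disjoint)
  show "finite {j. j + 1 \<in># \<nu>}" by (rule finite_far_parts)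
qed (auto simp: finite_maps_with, auto simp: maps_with_def)

lemma bridge_sum:
  "(\<Sum>X | X \<in> maps_with (Suc i) \<mu> \<nu> \<and> bridge_class X. \<beta> ^ \<eta> X) =
    (\<Sum>((a, a'), (b, b')) \<in> splits \<mu> \<times> splits \<nu>. degree_series i a b * far_series a' b')"
proof -
  let ?S = "{X \<in> maps_with (Suc i) \<mu> \<nu>. bridge_class X}"
  let ?h = "\<lambda>p. \<beta> ^ \<eta> (fst p) * \<beta> ^ \<eta> (snd p)"
  let ?I = "splits \<mu> \<times> splits \<nu>"
  let ?T = "\<lambda>((a, a'), (b, b')). maps_with i a b \<times> far_maps a' b'"
  have fin_far: "finite (far_maps a b)" for a b
    unfolding far_maps_Union using finite_far_parts finite_maps_with by blast
  have "(\<Sum>X\<in>?S. \<beta> ^ \<eta> X) = (\<Sum>X\<in>?S. ?h (component_pair X))"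
  proof (rule sum.cong[OF refl])
    fix X assume X: "X \<in> ?S"
    interpret M: edged_map "rep_rooted_map X" using edged_rep X by (auto simp: maps_with_def)
    have "root_bridge (rep_rooted_map X)" using X by (simp add: bridge_class_def)
    from M.measure_bridge[OF \<eta> this] show "\<beta> ^ \<eta> X = ?h (component_pair X)"
      by (simp add: abs_rep component_pair_def power_add)
  qed
  also have "\<dots> = (\<Sum>p\<in>(\<Union>x\<in>?I. ?T x). ?h p)"
    by (rule sum.reindex_bij_betw[OF bridge_bij])
  also have "\<dots> = (\<Sum>x\<in>?I. \<Sum>p\<in>?T x. ?h p)"
  proof (rule sum.UNION_disjoint)
    show "finite ?I" by (simp add: finite_splits)
    show "\<forall>x\<in>?I. finite (?T x)" using finite_maps_with fin_far by auto
    show "\<forall>x\<in>?I. \<forall>y\<in>?I. x \<noteq> y \<longrightarrow> ?T x \<inter> ?T y = {}"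
    proof (intro ballI impI)
      fix x y assume xy: "x \<in> ?I" "y \<in> ?I" "x \<noteq> y"
      obtain a a' b b' where x: "x = ((a, a'), (b, b'))" by (metis prod.exhaust)
      obtain c c' d d' where y: "y = ((c, c'), (d, d'))" by (metis prod.exhaust)
      \<comment> \<open>Within a splitting, \<open>a\<close> determines \<open>a'\<close> and
        \<open>b\<close> determines \<open>b'\<close>; the profile of the first component thus
        separates the sets.\<close>
      have "\<not> (a = c \<and> b = d)" using xy unfolding x y splits_def by auto
      then show "?T x \<inter> ?T y = {}" unfolding x y by (auto simp: maps_with_def)
    qed
  qed
  also have "\<dots> = (\<Sum>((a, a'), (b, b')) \<in> ?I. degree_series i a b * far_series a' b')"
  proof (rule sum.cong[OF refl])
    fix x assume "x \<in> ?I"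
    obtain a a' b b' where x: "x = ((a, a'), (b, b'))" by (metis prod.exhaust)
    show "(\<Sum>p\<in>?T x. ?h p) = (\<lambda>((a, a'), (b, b')). degree_series i a b * far_series a' b') x"
      unfolding x by (simp add: sum_product sum.cartesian_product degree_series_def far_maps_sum[symmetric] split_def)
  qed
  finally show ?thesis .
qed

text \<open>Since \<open>corner\<close> permutes the white flags, twice the sum is the sum over
  pairs \<open>y\<close>, \<open>corner y\<close>. Each pair contributes
  \<open>(1 + \<beta>) * \<beta> ^ \<eta> Y\<close>, and there are
  \<open>2 * (j * count \<nu> j)\<close> flags.\<close>

lemma white_sum:
  assumes "degs Y = (i, \<mu>, \<nu>)"
  shows "(\<Sum>y\<in>white_flags j (rep_rooted_map Y). \<beta> ^ \<eta> (abs_rooted_map (attach_white (rep_rooted_map Y) y))) =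
    (1 + \<beta>) * of_nat (j * count \<nu> j) * \<beta> ^ \<eta> Y"
proof -
  let ?N = "rep_rooted_map Y"
  let ?W = "white_flags j ?N"
  let ?g = "\<lambda>y. \<beta> ^ \<eta> (abs_rooted_map (attach_white ?N y))"
  note N = rep_bipartite[of Y]
  have pair: "?g y + ?g (corner ?N y) = (1 + \<beta>) * \<beta> ^ \<eta> Y" if y: "y \<in> ?W" for y
  proof -
    have y': "y \<in> flags ?N" "\<not> black_of ?N y" using y by (auto simp: white_flags_def)
    note A = attach_white[OF N y']
    interpret M: edged_map "attach_white ?N y" using A by unfold_locales
    have "abs_rooted_map (root_component (attach_white ?N y)) = Y"
      using A(4) abs_eq_iff[OF N M.root_component_bipartite] abs_rep[of Y] by metis
    then show ?thesis using M.measure_twist[OF \<eta> A(3), of \<beta>] attach_white_corner(2)[OF N y] by simp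
  qed
  have "bij_betw (corner ?N) ?W ?W"
  proof (rule free_involution_bij_betw)
    have "free_involution (flags ?N) (corner ?N)" using N by (simp add: bipartite_map_def)
    then show "free_involution ?W (corner ?N)"
      using attach_white_corner(1)[OF N] by (auto simp: free_involution_def white_flags_def)
  qed
  then have "(\<Sum>y\<in>?W. ?g (corner ?N y)) = (\<Sum>y\<in>?W. ?g y)"
    by (rule sum.reindex_bij_betw[of "corner ?N" ?W ?W ?g])
  then have "2 * (\<Sum>y\<in>?W. ?g y) = (\<Sum>y\<in>?W. ?g y + ?g (corner ?N y))"
    by (simp add: sum.distrib)
  also have "\<dots> = of_nat (card ?W) * ((1 + \<beta>) * \<beta> ^ \<eta> Y)" using pair by simp
  also have "\<dots> = 2 * ((1 + \<beta>) * of_nat (j * count \<nu> j) * \<beta> ^ \<eta> Y)"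
    using card_white_flags[OF N, of i \<mu> \<nu> j] assms by (simp add: degs_def)
  finally show ?thesis by simp
qed

text \<open>The factor \<open>count \<nu> j + 1\<close> is the multiplicity of \<open>j\<close>
  after a part \<open>j + 1\<close> has been replaced by \<open>j\<close>.\<close>

lemma nonbridge_sum:
  "(\<Sum>X | X \<in> maps_with (Suc i) \<mu> \<nu> \<and> \<not> bridge_class X. \<beta> ^ \<eta> X) =
    (\<Sum>j\<in>shrinks \<nu>. (1 + \<beta>) * of_nat (j * (count \<nu> j + 1)) *
       degree_series i \<mu> (add_mset j (\<nu> - {#j + 1#})))"
proof -
  let ?F = "\<lambda>(j :: nat, Y, y). abs_rooted_map (attach_white (rep_rooted_map Y) y)"
  let ?Q = "\<lambda>j. SIGMA Y:maps_with i \<mu> (add_mset j (\<nu> - {#j + 1#})). white_flags j (rep_rooted_map Y)"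
  let ?S = "{X \<in> maps_with (Suc i) \<mu> \<nu>. \<not> bridge_class X}"
  have "(\<Sum>X\<in>?S. \<beta> ^ \<eta> X) = (\<Sum>p\<in>(SIGMA j:shrinks \<nu>. ?Q j). \<beta> ^ \<eta> (?F p))"
    by (rule sum.reindex_bij_betw[OF nonbridge_bij, symmetric])
  also have "\<dots> = (\<Sum>j\<in>shrinks \<nu>. \<Sum>q\<in>?Q j. \<beta> ^ \<eta> (?F (j, q)))"
    using finite_shrinks finite_maps_with finite_white_flags[OF rep_bipartite]
    by (subst sum.Sigma) (auto intro!: sum.cong)
  also have "\<dots> = (\<Sum>j\<in>shrinks \<nu>. \<Sum>Y\<in>maps_with i \<mu> (add_mset j (\<nu> - {#j + 1#})).
      \<Sum>y\<in>white_flags j (rep_rooted_map Y). \<beta> ^ \<eta> (?F (j, Y, y)))"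
    using finite_maps_with finite_white_flags[OF rep_bipartite]
    by (intro sum.cong refl) (subst sum.Sigma, auto intro!: sum.cong)
  also have "\<dots> = (\<Sum>j\<in>shrinks \<nu>. (1 + \<beta>) * of_nat (j * (count \<nu> j + 1)) *
       degree_series i \<mu> (add_mset j (\<nu> - {#j + 1#})))"
  proof (rule sum.cong[OF refl])
    fix j assume "j \<in> shrinks \<nu>"
    have "(\<Sum>y\<in>white_flags j (rep_rooted_map Y). \<beta> ^ \<eta> (?F (j, Y, y))) =
        (1 + \<beta>) * of_nat (j * (count \<nu> j + 1)) * \<beta> ^ \<eta> Y"
      if "Y \<in> maps_with i \<mu> (add_mset j (\<nu> - {#j + 1#}))" for Y
      using white_sum[of Y i \<mu> "add_mset j (\<nu> - {#j + 1#})" j] that by (simp add: maps_with_def)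
    then show "(\<Sum>Y\<in>maps_with i \<mu> (add_mset j (\<nu> - {#j + 1#})).
        \<Sum>y\<in>white_flags j (rep_rooted_map Y). \<beta> ^ \<eta> (?F (j, Y, y))) =
      (1 + \<beta>) * of_nat (j * (count \<nu> j + 1)) * degree_series i \<mu> (add_mset j (\<nu> - {#j + 1#}))"
      by (simp only: degree_series_def sum_distrib_left cong: sum.cong)
  qed
  finally show ?thesis .
qed

lemma degree_series_Suc:
  "degree_series (Suc i) \<mu> \<nu> =
    (\<Sum>((a, a'), (b, b')) \<in> splits \<mu> \<times> splits \<nu>. degree_series i a b * far_series a' b') +
    (\<Sum>j\<in>shrinks \<nu>. (1 + \<beta>) * of_nat (j * (count \<nu> j + 1)) *
       degree_series i \<mu> (add_mset j (\<nu> - {#j + 1#})))"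
proof -
  have "maps_with (Suc i) \<mu> \<nu> = {X \<in> maps_with (Suc i) \<mu> \<nu>. bridge_class X} \<union>
      {X \<in> maps_with (Suc i) \<mu> \<nu>. \<not> bridge_class X}" by blast
  then have "degree_series (Suc i) \<mu> \<nu> =
      (\<Sum>X\<in>{X \<in> maps_with (Suc i) \<mu> \<nu>. bridge_class X} \<union>
        {X \<in> maps_with (Suc i) \<mu> \<nu>. \<not> bridge_class X}. \<beta> ^ \<eta> X)"
    unfolding degree_series_def by simp
  also have "\<dots> = (\<Sum>X | X \<in> maps_with (Suc i) \<mu> \<nu> \<and> bridge_class X. \<beta> ^ \<eta> X) +
      (\<Sum>X | X \<in> maps_with (Suc i) \<mu> \<nu> \<and> \<not> bridge_class X. \<beta> ^ \<eta> X)"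
    by (rule sum.union_disjoint) (use finite_maps_with in auto)
  finally show ?thesis unfolding bridge_sum nonbridge_sum .
qed

end

section \<open>Convolution of functions of pairs of multisets\<close>

text \<open>A formal series in variables p_k and q_k, given by the coefficient of p_\<mu> q_\<nu>;
  \<open>conv\<close> is the product of such series.\<close>

type_synonym 'a pair_fun = "nat multiset \<times> nat multiset \<Rightarrow> 'a"

definition psplits :: "nat multiset \<times> nat multiset \<Rightarrow>
    ((nat multiset \<times> nat multiset) \<times> (nat multiset \<times> nat multiset)) set" where
  "psplits x = {(y, z). y + z = x}"

definition conv :: "'a :: comm_ring_1 pair_fun \<Rightarrow> 'a pair_fun \<Rightarrow> 'a pair_fun" where
  "conv f g x = (\<Sum>(y, z)\<in>psplits x. f y * g z)"

lemma psplits_bij: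
  "bij_betw (\<lambda>((a, a'), (b, b')). ((a, b), (a', b'))) (splits \<mu> \<times> splits \<nu>) (psplits (\<mu>, \<nu>))"
  by (rule bij_betw_byWitness[where f' = "\<lambda>((a, b), (a', b')). ((a, a'), (b, b'))"])
    (auto simp: splits_def psplits_def)

lemma finite_psplits: "finite (psplits x)"
  using bij_betw_finite[OF psplits_bij, of "fst x" "snd x"] by (simp add: finite_splits)

lemma conv_cong:
  assumes "\<And>y z. y + z = x \<Longrightarrow> f y * g z = f' y * g' z"
  shows "conv f g x = conv f' g' x"
  unfolding conv_def using assms by (intro sum.cong) (auto simp: psplits_def)

lemma conv_commute: "conv f g = conv g f"
proof
  fix x
  show "conv f g x = conv g f x"
    unfolding conv_def
    by (rule sum.reindex_bij_witness[where i = prod.swap and j = prod.swap])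
      (auto simp: psplits_def add.commute mult.commute)
qed

lemma conv_assoc: "conv (conv f g) h = conv f (conv g h)"
proof
  fix x :: "nat multiset \<times> nat multiset"
  let ?T = "{(a, b, c). a + b + c = x}"
  have "conv (conv f g) h x = (\<Sum>p\<in>psplits x. \<Sum>q\<in>psplits (fst p). f (fst q) * g (snd q) * h (snd p))"
    by (simp add: conv_def split_def sum_distrib_right)
  also have "\<dots> = (\<Sum>(p, q)\<in>(SIGMA p:psplits x. psplits (fst p)). f (fst q) * g (snd q) * h (snd p))"
    by (rule sum.Sigma) (simp_all add: finite_psplits)
  also have "\<dots> = (\<Sum>(a, b, c)\<in>?T. f a * g b * h c)"
    by (rule sum.reindex_bij_witness[where j = "\<lambda>(p, q). (fst q, snd q, snd p)"
          and i = "\<lambda>(a, b, c). ((a + b, c), (a, b))"])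
      (auto simp: psplits_def)
  also have "\<dots> = (\<Sum>(p, q)\<in>(SIGMA p:psplits x. psplits (snd p)). f (fst p) * (g (fst q) * h (snd q)))"
    by (rule sum.reindex_bij_witness[where i = "\<lambda>(p, q). (fst p, fst q, snd q)"
          and j = "\<lambda>(a, b, c). ((a, b + c), (b, c))"])
      (auto simp: psplits_def add.assoc mult.assoc)
  also have "\<dots> = (\<Sum>p\<in>psplits x. \<Sum>q\<in>psplits (snd p). f (fst p) * (g (fst q) * h (snd q)))"
    by (rule sum.Sigma[symmetric]) (simp_all add: finite_psplits)
  also have "\<dots> = conv f (conv g h) x"
    by (simp add: conv_def split_def sum_distrib_left)
  finally show "conv (conv f g) h x = conv f (conv g h) x" .
qed

lemma conv_add_left: "conv (\<lambda>x. f x + g x) h x = conv f h x + conv g h x"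
  by (simp add: conv_def split_def sum.distrib algebra_simps)

lemma conv_add_right: "conv h (\<lambda>x. f x + g x) x = conv h f x + conv h g x"
  by (simp add: conv_def split_def sum.distrib algebra_simps)

lemma conv_sum_left: "conv (\<lambda>x. \<Sum>j\<in>J. t j * f j x) h x = (\<Sum>j\<in>J. t j * conv (f j) h x)"
proof -
  have "conv (\<lambda>x. \<Sum>j\<in>J. t j * f j x) h x = (\<Sum>p\<in>psplits x. \<Sum>j\<in>J. t j * (f j (fst p) * h (snd p)))"
    by (simp add: conv_def split_def sum_distrib_left sum_distrib_right mult_ac)
  also have "\<dots> = (\<Sum>j\<in>J. \<Sum>p\<in>psplits x. t j * (f j (fst p) * h (snd p)))" by (rule sum.swap)
  finally show ?thesis by (simp add: conv_def split_def sum_distrib_left)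
qed

lemma conv_swap: "conv (f \<circ> prod.swap) (g \<circ> prod.swap) x = conv f g (prod.swap x)"
  unfolding conv_def
  by (cases x, hypsubst, rule sum.reindex_bij_witness[where i = "map_prod prod.swap prod.swap" and j = "map_prod prod.swap prod.swap"])
    (auto simp: psplits_def)

lemma conv_unit: "conv (\<lambda>x. if x = 0 then 1 else 0) g x = g x"
proof -
  have "conv (\<lambda>x. if x = 0 then 1 else 0) g x = (\<Sum>p\<in>{(0 :: nat multiset \<times> nat multiset, x)}. (if fst p = 0 then 1 else 0) * g (snd p))"
    unfolding conv_def split_def
    by (rule sum.mono_neutral_right) (auto simp: finite_psplits[unfolded psplits_def] psplits_def)
  then show ?thesis by simp
qed

lemma sum_psplits_add_mset:
  "(\<Sum>p\<in>{p \<in> psplits (\<mu>, add_mset k \<nu>). k \<in># snd (fst p)}. F p) =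
   (\<Sum>p\<in>psplits (\<mu>, \<nu>). F ((fst (fst p), add_mset k (snd (fst p))), snd p))"
proof -
  have remove: "b - {#k#} + b' = \<nu>" if "k \<in># b" "b + b' = add_mset k \<nu>" for b b'
    using that by (metis add_mset_remove_trivial insert_DiffM union_mset_add_mset_left)
  show ?thesis
    by (rule sum.reindex_bij_witness[where i = "\<lambda>p. ((fst (fst p), add_mset k (snd (fst p))), snd p)"
          and j = "\<lambda>p. ((fst (fst p), snd (fst p) - {#k#}), snd p)"])
      (auto simp: psplits_def intro: remove)
qed

text \<open>Multiplication by the variable \<open>q\<^sub>k\<close>, and differentiation with respect to it.\<close>

definition times_q :: "nat \<Rightarrow> 'a :: comm_ring_1 pair_fun \<Rightarrow> 'a pair_fun" where
  "times_q k f = (\<lambda>(\<mu>, \<nu>). if k \<in># \<nu> then f (\<mu>, \<nu> - {#k#}) else 0)"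

definition deriv_q :: "nat \<Rightarrow> 'a :: comm_ring_1 pair_fun \<Rightarrow> 'a pair_fun" where
  "deriv_q k f = (\<lambda>(\<mu>, \<nu>). of_nat (count \<nu> k + 1) * f (\<mu>, add_mset k \<nu>))"

lemma conv_times_q: "conv (times_q k f) g x = times_q k (conv f g) x"
proof (cases "k \<in># snd x")
  case True
  obtain \<mu> \<nu> where x: "x = (\<mu>, add_mset k \<nu>)" using True by (metis insert_DiffM prod.collapse)
  have "conv (times_q k f) g x = (\<Sum>p\<in>{p \<in> psplits x. k \<in># snd (fst p)}. times_q k f (fst p) * g (snd p))"
    unfolding conv_def split_def
    by (rule sum.mono_neutral_right) (auto simp: finite_psplits times_q_def split: if_splits)
  also have "\<dots> = (\<Sum>p\<in>psplits (\<mu>, \<nu>). f (fst p) * g (snd p))"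
    unfolding x sum_psplits_add_mset by (simp add: times_q_def)
  finally show ?thesis by (simp add: conv_def split_def times_q_def x)
next
  case False
  have "times_q k f y * g z = 0" if "y + z = x" for y z
    using that False by (auto simp: times_q_def split_def)
  then show ?thesis using False unfolding conv_def by (auto simp: times_q_def split_def psplits_def intro!: sum.neutral)
qed

text \<open>The Leibniz rule. Both products are rewritten as sums over the splittings of
  \<open>(\<mu>, add_mset k \<nu>)\<close>, weighted by the multiplicity of \<open>k\<close> in the
  first or in the second part; these two multiplicities add up to
  \<open>count \<nu> k + 1\<close>.\<close>

lemma conv_deriv_q: "conv (deriv_q k f) g x + conv f (deriv_q k g) x = deriv_q k (conv f g) x"
proof -
  obtain \<mu> \<nu> where x: "x = (\<mu>, \<nu>)" by (cases x)
  let ?X = "(\<mu>, add_mset k \<nu>)"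
  let ?n = "\<lambda>y :: nat multiset \<times> nat multiset. of_nat (count (snd y) k)"
  have left: "conv (deriv_q k f) g x = (\<Sum>p\<in>psplits ?X. ?n (fst p) * f (fst p) * g (snd p))" for f g :: "'a pair_fun"
  proof -
    have "(\<Sum>p\<in>psplits ?X. ?n (fst p) * f (fst p) * g (snd p)) =
        (\<Sum>p\<in>{p \<in> psplits ?X. k \<in># snd (fst p)}. ?n (fst p) * f (fst p) * g (snd p))"
      by (rule sum.mono_neutral_right) (auto simp: finite_psplits not_in_iff)
    also have "\<dots> = (\<Sum>p\<in>psplits x. deriv_q k f (fst p) * g (snd p))"
      unfolding x sum_psplits_add_mset by (simp add: deriv_q_def split_def)
    finally show ?thesis by (simp add: conv_def split_def)
  qed
  have right: "conv f (deriv_q k g) x = (\<Sum>p\<in>psplits ?X. ?n (snd p) * f (fst p) * g (snd p))"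
  proof -
    have "conv f (deriv_q k g) x = (\<Sum>p\<in>psplits ?X. ?n (fst p) * g (fst p) * f (snd p))"
      using left[of g f] conv_commute by metis
    also have "\<dots> = (\<Sum>p\<in>psplits ?X. ?n (snd p) * f (fst p) * g (snd p))"
      by (rule sum.reindex_bij_witness[where i = prod.swap and j = prod.swap])
        (auto simp: psplits_def add.commute mult_ac)
    finally show ?thesis .
  qed
  have "?n (fst p) * f (fst p) * g (snd p) + ?n (snd p) * f (fst p) * g (snd p) =
      of_nat (count \<nu> k + 1) * (f (fst p) * g (snd p))" if "p \<in> psplits ?X" for p
  proof -
    have "snd (fst p) + snd (snd p) = add_mset k \<nu>" using that by (auto simp: psplits_def)
    then have "count (snd (fst p)) k + count (snd (snd p)) k = count \<nu> k + 1"
      by (metis Suc_eq_plus1 count_add_mset count_union)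
    then have "(of_nat (count \<nu> k + 1) :: 'a) = ?n (fst p) + ?n (snd p)" by (metis of_nat_add)
    then show ?thesis by (simp add: algebra_simps)
  qed
  then show ?thesis
    unfolding left right by (simp add: sum.distrib[symmetric] deriv_q_def x conv_def split_def sum_distrib_left
        cong: sum.cong)
qed

section \<open>Solving the recursion\<close>

lemma z_part_add_mset: "z_part (add_mset k \<nu>) = z_part \<nu> * (k * (count \<nu> k + 1))"
proof -
  let ?t = "\<lambda>\<nu> i. i ^ count \<nu> i * fact (count \<nu> i) :: nat"
  have "z_part (add_mset k \<nu>) = ?t (add_mset k \<nu>) k * (\<Prod>i\<in>set_mset \<nu> - {k}. ?t (add_mset k \<nu>) i)"
    unfolding z_part_def set_mset_add_mset_insert by (rule prod.insert_remove) simp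
  also have "(\<Prod>i\<in>set_mset \<nu> - {k}. ?t (add_mset k \<nu>) i) = (\<Prod>i\<in>set_mset \<nu> - {k}. ?t \<nu> i)"
    by (rule prod.cong) auto
  also have "?t (add_mset k \<nu>) k = ?t \<nu> k * (k * (count \<nu> k + 1))" by (simp add: algebra_simps)
  finally have "z_part (add_mset k \<nu>) = (?t \<nu> k * (\<Prod>i\<in>set_mset \<nu> - {k}. ?t \<nu> i)) * (k * (count \<nu> k + 1))"
    by simp
  also have "?t \<nu> k * (\<Prod>i\<in>set_mset \<nu> - {k}. ?t \<nu> i) = z_part \<nu>"
  proof (cases "k \<in># \<nu>")
    case True
    then show ?thesis unfolding z_part_def by (intro prod.remove[symmetric]) auto
  next
    case False
    then show ?thesis by (simp add: z_part_def not_in_iff)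
  qed
  finally show ?thesis .
qed

lemma z_part_pos: "0 \<notin># \<nu> \<Longrightarrow> 0 < z_part \<nu>"
  unfolding z_part_def by (intro prod_pos) (auto intro: gr0I)

text \<open>The recursion of \<open>degree_series_Suc\<close>, freed from maps, with \<alpha> for 1
  + \<beta>.\<close>

locale degree_recursion =
  fixes w :: "nat \<Rightarrow> 'a :: field_char_0 pair_fun" and \<alpha> :: 'a
  assumes \<alpha>: "\<alpha> \<noteq> 0"
    and w_0: "w 0 = (\<lambda>x. if x = 0 then 1 else 0)"
    and w_Suc: "\<And>i x. w (Suc i) x =
      conv (w i) (\<lambda>(\<mu>, \<nu>). \<Sum>j | j + 1 \<in># \<nu>. w j (\<nu> - {#j + 1#}, \<mu>)) x +
      (\<Sum>j\<in>shrinks (snd x). \<alpha> * of_nat (j * (count (snd x) j + 1)) *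
         w i (fst x, add_mset j (snd x - {#j + 1#})))"
begin

text \<open>The coefficient of p_\<mu> in g_n, extended by 0 to multisets that contain 0.\<close>

definition wt :: "nat multiset \<Rightarrow> 'a" where
  "wt \<mu> = (if 0 \<in># \<mu> then 0 else 1 / (of_nat (z_part \<mu>) * \<alpha> ^ size \<mu>))"

text \<open>As a series, \<open>V i\<close> is the sum over n \<ge> i of n! \<alpha>^n g_(n-i)(x)
  g_n(y).\<close>

definition V :: "nat \<Rightarrow> 'a pair_fun" where
  "V i = (\<lambda>(\<mu>, \<nu>). if sum_mset \<mu> + i = sum_mset \<nu>
     then fact (sum_mset \<nu>) * \<alpha> ^ sum_mset \<nu> * wt \<mu> * wt \<nu> else 0)"

text \<open>The series of the second components of bridges: the sum of q_(j+1) times w_j with the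
  two sets of variables exchanged.\<close>

definition U :: "'a pair_fun" where
  "U = (\<lambda>(\<mu>, \<nu>). \<Sum>j | j + 1 \<in># \<nu>. w j (\<nu> - {#j + 1#}, \<mu>))"

definition L :: "'a pair_fun \<Rightarrow> 'a pair_fun" where
  "L f x = (\<Sum>j\<in>shrinks (snd x). \<alpha> * of_nat (j * (count (snd x) j + 1)) *
     f (fst x, add_mset j (snd x - {#j + 1#})))"

lemma w_Suc': "w (Suc i) = (\<lambda>x. conv (w i) U x + L (w i) x)"
  by (rule ext) (simp add: w_Suc U_def L_def)

text \<open>In terms of g = exp(sum of p_k / (\<alpha> k)), the sum of all g_n, this is the
  differential equation \<alpha> k dg/dp_k = g, read off at p_\<nu>.\<close>

lemma wt_add_mset:
  assumes "0 < k"
  shows "wt (add_mset k \<nu>) * (\<alpha> * of_nat (k * (count \<nu> k + 1))) = wt \<nu>"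
proof (cases "0 \<in># \<nu>")
  case False
  define t :: 'a where "t = of_nat (k * (count \<nu> k + 1))"
  define z :: 'a where "z = of_nat (z_part \<nu>)"
  have "z \<noteq> 0" unfolding z_def using z_part_pos[OF False] by simp
  have "t \<noteq> 0" unfolding t_def of_nat_eq_0_iff using assms by simp
  have "wt (add_mset k \<nu>) = 1 / ((z * t) * (\<alpha> * \<alpha> ^ size \<nu>))"
    using assms False by (simp only: wt_def z_part_add_mset of_nat_mult z_def t_def size_add_mset power_Suc) simp
  moreover have "wt \<nu> = 1 / (z * \<alpha> ^ size \<nu>)" using False by (simp add: wt_def z_def)
  ultimately show ?thesis unfolding t_def[symmetric] using \<open>z \<noteq> 0\<close> \<open>t \<noteq> 0\<close> \<alpha> by simp
qed (simp add: wt_def)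

lemma wt_remove:
  assumes "k \<in># \<nu>" "0 < k"
  shows "wt (\<nu> - {#k#}) = \<alpha> * of_nat (k * count \<nu> k) * wt \<nu>"
  using wt_add_mset[OF assms(2), of "\<nu> - {#k#}"] assms(1) by (simp add: mult_ac)

lemma sum_mset_count:
  assumes "finite B" "set_mset \<nu> \<subseteq> B"
  shows "sum_mset \<nu> = (\<Sum>k\<in>B. count \<nu> k * k)"
  using assms(2)
proof (induction \<nu>)
  case (add x \<nu>)
  have "(\<Sum>k\<in>B. count (add_mset x \<nu>) k * k) = (\<Sum>k\<in>B. count \<nu> k * k + (if k = x then x else 0))"
    by (rule sum.cong) auto
  then show ?case using add assms(1) by (simp add: sum.distrib)
qed simp

lemma sum_parts: "(\<Sum>j | j + 1 \<in># \<nu>. (j + 1) * count \<nu> (j + 1)) = sum_mset \<nu>"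
proof -
  have "sum_mset \<nu> = (\<Sum>k\<in>set_mset \<nu>. count \<nu> k * k)" by (rule sum_mset_count) simp_all
  also have "\<dots> = (\<Sum>k\<in>Suc ` {j. j + 1 \<in># \<nu>}. count \<nu> k * k)"
  proof (rule sum.mono_neutral_right)
    show "\<forall>k\<in>set_mset \<nu> - Suc ` {j. j + 1 \<in># \<nu>}. count \<nu> k * k = 0"
    proof
      fix k assume "k \<in> set_mset \<nu> - Suc ` {j. j + 1 \<in># \<nu>}"
      then show "count \<nu> k * k = 0" by (cases k) auto
    qed
  qed auto
  also have "\<dots> = (\<Sum>j | j + 1 \<in># \<nu>. (j + 1) * count \<nu> (j + 1))"
    by (subst sum.reindex) (auto simp: mult.commute)
  finally show ?thesis by simp
qed

text \<open>Euler's identity: multiplying g by p_k equals applying \<alpha> k p_k d/dp_k, and over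
  all k these operators multiply a term of degree n by \<alpha> n.\<close>

lemma wt_sum: "(\<Sum>j | j + 1 \<in># \<nu>. wt (\<nu> - {#j + 1#})) = \<alpha> * of_nat (sum_mset \<nu>) * wt \<nu>"
proof -
  have "(\<Sum>j | j + 1 \<in># \<nu>. wt (\<nu> - {#j + 1#})) =
      (\<Sum>j | j + 1 \<in># \<nu>. \<alpha> * wt \<nu> * of_nat ((j + 1) * count \<nu> (j + 1)))"
    by (rule sum.cong) (simp_all add: wt_remove mult_ac)
  also have "\<dots> = \<alpha> * wt \<nu> * of_nat (\<Sum>j | j + 1 \<in># \<nu>. (j + 1) * count \<nu> (j + 1))"
    by (simp only: sum_distrib_left of_nat_sum)
  finally show ?thesis unfolding sum_parts by (simp add: mult_ac)
qed

lemma sum_remove: "j + 1 \<in># \<nu> \<Longrightarrow> sum_mset \<nu> = j + 1 + sum_mset (\<nu> - {#j + 1#})" for \<nu> :: "nat multiset"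
  by (rule sum_mset_remove)

lemma V_shrink:
  assumes "j \<in> shrinks \<nu>"
  shows "\<alpha> * of_nat (j * (count \<nu> j + 1)) * V i (\<mu>, add_mset j (\<nu> - {#j + 1#})) =
    (if sum_mset \<mu> + Suc i = sum_mset \<nu>
     then fact (sum_mset \<nu> - 1) * \<alpha> ^ (sum_mset \<nu> - 1) * wt \<mu> * wt (\<nu> - {#j + 1#}) else 0)"
proof -
  have j: "0 < j" "j + 1 \<in># \<nu>" using assms by (auto simp: shrinks_def)
  have s: "sum_mset (add_mset j (\<nu> - {#j + 1#})) = sum_mset \<nu> - 1" "0 < sum_mset \<nu>"
    using sum_remove[OF j(2)] by simp_all
  have "count (\<nu> - {#j + 1#}) j = count \<nu> j" by simp
  then have "\<alpha> * of_nat (j * (count \<nu> j + 1)) * wt (add_mset j (\<nu> - {#j + 1#})) = wt (\<nu> - {#j + 1#})"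
    using wt_add_mset[OF j(1), of "\<nu> - {#j + 1#}"] by (simp add: mult_ac)
  moreover have "sum_mset \<mu> + i = sum_mset \<nu> - 1 \<longleftrightarrow> sum_mset \<mu> + Suc i = sum_mset \<nu>" using s(2) by auto
  ultimately show ?thesis unfolding V_def prod.case s(1) by (auto simp: mult_ac)
qed

text \<open>With n = |\<nu>|, \<open>V_shrink\<close> makes each term of \<open>L\<close> with j
  \<ge> 1 equal to (n-1)! \<alpha>^(n-1) \<open>wt \<mu>\<close> times
  \<open>wt (\<nu> - {#j + 1#})\<close>, and \<open>times_q 1\<close> supplies the missing term j =
  0. By \<open>wt_sum\<close> the whole sum gains the factor \<alpha> n.\<close>

lemma V_Suc: "V (Suc i) x = L (V i) x + times_q 1 (V i) x"
proof -
  obtain \<mu> \<nu> where x: "x = (\<mu>, \<nu>)" by (cases x)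
  let ?J = "{j. j + 1 \<in># \<nu>}"
  let ?t = "\<lambda>j. if sum_mset \<mu> + Suc i = sum_mset \<nu>
     then fact (sum_mset \<nu> - 1) * \<alpha> ^ (sum_mset \<nu> - 1) * wt \<mu> * wt (\<nu> - {#j + 1#}) else 0"
  have "L (V i) x = (\<Sum>j\<in>shrinks \<nu>. ?t j)"
    unfolding L_def x fst_conv snd_conv by (rule sum.cong[OF refl V_shrink])
  moreover have "times_q 1 (V i) x = (\<Sum>j\<in>?J - shrinks \<nu>. ?t j)"
  proof (cases "1 \<in># \<nu>")
    case True
    then have "?J - shrinks \<nu> = {0}" by (auto simp: shrinks_def)
    moreover have "sum_mset \<nu> = 1 + sum_mset (\<nu> - {#1#})" using sum_remove[of 0 \<nu>] True by simp
    ultimately show ?thesis using True by (auto simp: times_q_def V_def x)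
  next
    case False
    then have "?J - shrinks \<nu> = {}" by (auto simp: shrinks_def) (metis One_nat_def Suc_le_eq gr0I)
    then have "(\<Sum>j\<in>?J - shrinks \<nu>. ?t j) = 0" by (simp only: sum.empty)
    then show ?thesis using False by (simp add: times_q_def x)
  qed
  moreover have "(\<Sum>j\<in>?J. ?t j) = (\<Sum>j\<in>?J - shrinks \<nu>. ?t j) + (\<Sum>j\<in>shrinks \<nu>. ?t j)"
    by (rule sum.subset_diff) (auto simp: shrinks_def finite_far_parts[simplified])
  moreover have "(\<Sum>j\<in>?J. ?t j) = V (Suc i) x"
  proof (cases "sum_mset \<mu> + Suc i = sum_mset \<nu>")
    case True
    then obtain n where n: "sum_mset \<nu> = Suc n" by (metis add_Suc_right)
    have "(\<Sum>j\<in>?J. ?t j) = fact n * \<alpha> ^ n * wt \<mu> * (\<Sum>j\<in>?J. wt (\<nu> - {#j + 1#}))"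
      using True n by (simp add: sum_distrib_left)
    also have "\<dots> = V (Suc i) x"
      unfolding wt_sum using True n by (simp add: V_def x mult_ac)
    finally show ?thesis .
  next
    case False
    then show ?thesis by (simp add: V_def x)
  qed
  ultimately show ?thesis by (metis (no_types, lifting) add.commute)
qed

text \<open>In \<open>U\<close> and \<open>L\<close> the range of summation depends on the argument.
  Here and in \<open>L_restrict\<close> it becomes a fixed larger set, on the rest of which
  \<open>times_q\<close> vanishes; then \<open>U\<close> and \<open>L\<close> are finite sums of
  series and \<open>conv_sum_left\<close> applies. For \<open>L\<close> these are the terms \<alpha>
  j q_(j+1) d/dq_j of the derivation.\<close>

lemma U_restrict: "snd x \<subseteq># \<nu> \<Longrightarrow>
    U x = (\<Sum>j | j + 1 \<in># \<nu>. 1 * times_q (j + 1) (w j \<circ> prod.swap) x)"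
  unfolding U_def times_q_def split_def
  by (rule sum.mono_neutral_cong_left) (auto simp: finite_far_parts[simplified] dest: mset_subset_eqD)

lemma L_restrict: "snd x \<subseteq># \<nu> \<Longrightarrow>
    L f x = (\<Sum>j\<in>shrinks \<nu>. \<alpha> * of_nat j * times_q (j + 1) (deriv_q j f) x)"
  unfolding L_def times_q_def deriv_q_def split_def
  by (rule sum.mono_neutral_cong_left[OF finite_shrinks])
    (auto simp: shrinks_def mult_ac algebra_simps dest: mset_subset_eqD)

lemma conv_L: "conv (L f) g x + conv f (L g) x = L (conv f g) x"
proof -
  let ?J = "shrinks (snd x)"
  have le: "snd y \<subseteq># snd x" "snd z \<subseteq># snd x" if "y + z = x" for y z using that by auto
  have left: "conv (L f) g x = (\<Sum>j\<in>?J. \<alpha> * of_nat j * times_q (j + 1) (conv (deriv_q j f) g) x)" for f g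
  proof -
    have "conv (L f) g x = conv (\<lambda>x. \<Sum>j\<in>?J. \<alpha> * of_nat j * times_q (j + 1) (deriv_q j f) x) g x"
      by (rule conv_cong) (simp add: L_restrict[OF le(1)])
    also have "\<dots> = (\<Sum>j\<in>?J. \<alpha> * of_nat j * conv (times_q (j + 1) (deriv_q j f)) g x)"
      by (rule conv_sum_left)
    finally show ?thesis by (simp only: conv_times_q)
  qed
  have "conv f (L g) x = (\<Sum>j\<in>?J. \<alpha> * of_nat j * times_q (j + 1) (conv f (deriv_q j g)) x)"
    using left[of g f] by (simp only: conv_commute[of "L g"] conv_commute[of "deriv_q _ g"])
  moreover have "times_q (j + 1) (conv (deriv_q j f) g) x + times_q (j + 1) (conv f (deriv_q j g)) x =
      times_q (j + 1) (deriv_q j (conv f g)) x" for j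
    unfolding times_q_def split_def conv_deriv_q[symmetric] by simp
  ultimately show ?thesis
    unfolding left L_restrict[OF subset_mset.order_refl] by (simp add: sum.distrib[symmetric] distrib_left[symmetric])
qed

lemma V_0_swap: "V 0 \<circ> prod.swap = V 0"
  by (rule ext) (auto simp: V_def split_def mult_ac)

text \<open>Once U Psi = V_1 is known up to the current degree, w_(i+1) Psi = w_i (L Psi + q_1 Psi)
  + (L w_i) Psi, which is L (w_i Psi) + q_1 w_i Psi since \<open>L\<close> is a derivation, and
  hence V_(i+1). Every use of the claim for another index has a smaller total degree:
  \<open>U\<close>, \<open>L\<close> and \<open>times_q\<close> each use up part of \<nu>.\<close>

lemma conv_w_V: "conv (w i) (V 0) x = V i x"
proof (induction "sum_mset (fst x) + sum_mset (snd x)" arbitrary: i x rule: less_induct)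
  case less
  show ?case
  proof (cases i)
    case 0
    then show ?thesis by (simp add: w_0 conv_unit)
  next
    case (Suc i)
    have U: "conv U (V 0) y = V 1 y" if "y + z = x" for y z
    proof -
      obtain \<mu> \<nu> where y: "y = (\<mu>, \<nu>)" by (cases y)
      have "conv U (V 0) y = conv (\<lambda>y. \<Sum>j | j + 1 \<in># \<nu>. 1 * times_q (j + 1) (w j \<circ> prod.swap) y) (V 0) y"
      proof (rule conv_cong)
        fix a b assume "a + b = y"
        then have "snd a \<subseteq># \<nu>" unfolding y by (metis mset_subset_eq_add_left snd_add snd_conv)
        then show "U a * V 0 b = (\<Sum>j | j + 1 \<in># \<nu>. 1 * times_q (j + 1) (w j \<circ> prod.swap) a) * V 0 b"
          by (simp only: U_restrict)
      qed
      also have "\<dots> = (\<Sum>j | j + 1 \<in># \<nu>. 1 * conv (times_q (j + 1) (w j \<circ> prod.swap)) (V 0) y)"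
        by (rule conv_sum_left)
      also have "\<dots> = (\<Sum>j | j + 1 \<in># \<nu>. V j (\<nu> - {#j + 1#}, \<mu>))"
      proof (rule sum.cong[OF refl])
        fix j assume "j \<in> {j. j + 1 \<in># \<nu>}"
        then have j: "j + 1 \<in># \<nu>" by simp
        have "conv (times_q (j + 1) (w j \<circ> prod.swap)) (V 0) y = conv (w j \<circ> prod.swap) (V 0 \<circ> prod.swap) (\<mu>, \<nu> - {#j + 1#})"
          unfolding conv_times_q y V_0_swap times_q_def[of "j + 1" "conv _ _"] prod.case using j by simp
        also have "\<dots> = conv (w j) (V 0) (\<nu> - {#j + 1#}, \<mu>)" by (simp add: conv_swap)
        also have "\<dots> = V j (\<nu> - {#j + 1#}, \<mu>)"
          using sum_remove[OF j] that y by (intro less.hyps) auto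
        finally show "1 * conv (times_q (j + 1) (w j \<circ> prod.swap)) (V 0) y = V j (\<nu> - {#j + 1#}, \<mu>)" by simp
      qed
      \<comment> \<open>The degree condition of \<open>V j\<close> with exchanged arguments, after j
        cancels, is |\<nu>| = |\<mu>| + 1, the same for all j.\<close>
      also have "\<dots> = (\<Sum>j | j + 1 \<in># \<nu>. if sum_mset \<mu> + 1 = sum_mset \<nu>
          then fact (sum_mset \<mu>) * \<alpha> ^ sum_mset \<mu> * wt \<mu> * wt (\<nu> - {#j + 1#}) else 0)"
      proof (rule sum.cong[OF refl])
        fix j assume "j \<in> {j. j + 1 \<in># \<nu>}"
        then have "sum_mset \<nu> = j + 1 + sum_mset (\<nu> - {#j + 1#})" by (intro sum_remove) simp
        then show "V j (\<nu> - {#j + 1#}, \<mu>) = (if sum_mset \<mu> + 1 = sum_mset \<nu>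
          then fact (sum_mset \<mu>) * \<alpha> ^ sum_mset \<mu> * wt \<mu> * wt (\<nu> - {#j + 1#}) else 0)"
          by (auto simp: V_def mult_ac)
      qed
      also have "\<dots> = (if sum_mset \<mu> + 1 = sum_mset \<nu>
          then fact (sum_mset \<mu>) * \<alpha> ^ sum_mset \<mu> * wt \<mu> * (\<Sum>j | j + 1 \<in># \<nu>. wt (\<nu> - {#j + 1#})) else 0)"
        by (simp add: sum_distrib_left)
      also have "\<dots> = V 1 y"
      proof (cases "sum_mset \<mu> + 1 = sum_mset \<nu>")
        case True
        then have "sum_mset \<nu> = Suc (sum_mset \<mu>)" by simp
        then show ?thesis unfolding wt_sum by (simp add: V_def y mult_ac)
      qed (simp add: V_def y)
      finally show ?thesis .
    qed
    have "conv (w (Suc i)) (V 0) x = conv (conv (w i) U) (V 0) x + conv (L (w i)) (V 0) x"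
      unfolding w_Suc' by (rule conv_add_left)
    also have "conv (conv (w i) U) (V 0) x = conv (w i) (conv U (V 0)) x" by (simp only: conv_assoc)
    also have "\<dots> = conv (w i) (V 1) x"
      by (rule conv_cong) (metis U add.commute)
    also have "\<dots> = conv (w i) (\<lambda>y. L (V 0) y + times_q 1 (V 0) y) x"
      by (rule conv_cong) (simp add: V_Suc)
    also have "\<dots> = conv (w i) (L (V 0)) x + conv (w i) (times_q 1 (V 0)) x"
      by (rule conv_add_right)
    also have "conv (w i) (times_q 1 (V 0)) x = times_q 1 (conv (w i) (V 0)) x"
      using conv_times_q[of 1 "V 0" "w i" x] by (simp only: conv_commute[of "w i"])
    also have "conv (w i) (L (V 0)) x + times_q 1 (conv (w i) (V 0)) x + conv (L (w i)) (V 0) x =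
        L (conv (w i) (V 0)) x + times_q 1 (conv (w i) (V 0)) x"
      using conv_L[of "w i" "V 0" x] by (simp add: algebra_simps)
    also have "L (conv (w i) (V 0)) x = L (V i) x"
      unfolding L_def
    proof (rule sum.cong[OF refl])
      fix j assume "j \<in> shrinks (snd x)"
      then have "sum_mset (snd x) = j + 1 + sum_mset (snd x - {#j + 1#})"
        by (intro sum_remove) (simp add: shrinks_def)
      then show "\<alpha> * of_nat (j * (count (snd x) j + 1)) * conv (w i) (V 0) (fst x, add_mset j (snd x - {#j + 1#})) =
          \<alpha> * of_nat (j * (count (snd x) j + 1)) * V i (fst x, add_mset j (snd x - {#j + 1#}))"
        by (subst less.hyps) auto
    qed
    also have "times_q 1 (conv (w i) (V 0)) x = times_q 1 (V i) x"
    proof (cases "1 \<in># snd x")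
      case True
      then have "sum_mset (snd x) = 1 + sum_mset (snd x - {#1#})" using sum_remove[of 0 "snd x"] by simp
      then have "conv (w i) (V 0) (fst x, snd x - {#1#}) = V i (fst x, snd x - {#1#})"
        by (intro less.hyps) simp
      then show ?thesis by (simp add: times_q_def split_def)
    qed (simp add: times_q_def split_def)
    finally show ?thesis using Suc V_Suc by simp
  qed
qed

text \<open>The series of all rooted maps with at least one edge, where the root degree is counted
  among the black degrees again.\<close>

definition total :: "'a pair_fun" where
  "total = (\<lambda>(\<mu>, \<nu>). \<Sum>j | j + 1 \<in># \<mu>. w (j + 1) (\<mu> - {#j + 1#}, \<nu>))"

text \<open>The product is the sum of p_(j+1) V_(j+1), to which \<open>wt_sum\<close> applies in the
  black variables. The arguments are swapped because \<open>times_q\<close> acts on the second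
  component.\<close>

lemma conv_total: "conv total (V 0) x = \<alpha> * of_nat (sum_mset (fst x)) * V 0 x"
proof -
  obtain \<mu> \<nu> where x: "x = (\<mu>, \<nu>)" by (cases x)
  let ?J = "{j. j + 1 \<in># \<mu>}"
  have restr: "total (prod.swap y) = (\<Sum>j\<in>?J. 1 * times_q (j + 1) (w (j + 1) \<circ> prod.swap) y)"
    if "snd y \<subseteq># \<mu>" for y
    unfolding total_def times_q_def split_def using that
    by (intro sum.mono_neutral_cong_left) (auto simp: finite_far_parts[simplified] dest: mset_subset_eqD)
  have "conv total (V 0) x = conv (total \<circ> prod.swap) (V 0 \<circ> prod.swap) (\<nu>, \<mu>)"
    by (simp add: conv_swap x)
  also have "\<dots> = conv (\<lambda>y. \<Sum>j\<in>?J. 1 * times_q (j + 1) (w (j + 1) \<circ> prod.swap) y) (V 0 \<circ> prod.swap) (\<nu>, \<mu>)"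
  proof (rule conv_cong)
    fix a b :: "nat multiset \<times> nat multiset" assume "a + b = (\<nu>, \<mu>)"
    then have "snd a \<subseteq># \<mu>" by (metis mset_subset_eq_add_left snd_add snd_conv)
    then show "(total \<circ> prod.swap) a * (V 0 \<circ> prod.swap) b =
        (\<Sum>j\<in>?J. 1 * times_q (j + 1) (w (j + 1) \<circ> prod.swap) a) * (V 0 \<circ> prod.swap) b"
      by (simp only: o_apply restr)
  qed
  also have "\<dots> = (\<Sum>j\<in>?J. 1 * conv (times_q (j + 1) (w (j + 1) \<circ> prod.swap)) (V 0 \<circ> prod.swap) (\<nu>, \<mu>))"
    by (rule conv_sum_left)
  also have "\<dots> = (\<Sum>j\<in>?J. if sum_mset \<mu> = sum_mset \<nu>
      then fact (sum_mset \<nu>) * \<alpha> ^ sum_mset \<nu> * wt \<nu> * wt (\<mu> - {#j + 1#}) else 0)"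
  proof (rule sum.cong[OF refl])
    fix j assume "j \<in> ?J"
    then have j: "j + 1 \<in># \<mu>" by simp
    have "conv (times_q (j + 1) (w (j + 1) \<circ> prod.swap)) (V 0 \<circ> prod.swap) (\<nu>, \<mu>) =
        conv (w (j + 1) \<circ> prod.swap) (V 0 \<circ> prod.swap) (\<nu>, \<mu> - {#j + 1#})"
      unfolding conv_times_q times_q_def[of "j + 1" "conv _ _"] prod.case using j by simp
    also have "\<dots> = V (j + 1) (\<mu> - {#j + 1#}, \<nu>)" by (simp add: conv_swap conv_w_V)
    also have "\<dots> = (if sum_mset \<mu> = sum_mset \<nu>
      then fact (sum_mset \<nu>) * \<alpha> ^ sum_mset \<nu> * wt \<nu> * wt (\<mu> - {#j + 1#}) else 0)"
      using sum_remove[OF j] by (auto simp: V_def mult_ac)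
    finally show "1 * conv (times_q (j + 1) (w (j + 1) \<circ> prod.swap)) (V 0 \<circ> prod.swap) (\<nu>, \<mu>) =
      (if sum_mset \<mu> = sum_mset \<nu>
      then fact (sum_mset \<nu>) * \<alpha> ^ sum_mset \<nu> * wt \<nu> * wt (\<mu> - {#j + 1#}) else 0)" by simp
  qed
  also have "\<dots> = (if sum_mset \<mu> = sum_mset \<nu>
      then fact (sum_mset \<nu>) * \<alpha> ^ sum_mset \<nu> * wt \<nu> * (\<Sum>j\<in>?J. wt (\<mu> - {#j + 1#})) else 0)"
    by (simp add: sum_distrib_left)
  also have "\<dots> = \<alpha> * of_nat (sum_mset (fst x)) * V 0 x"
  proof (cases "sum_mset \<mu> = sum_mset \<nu>")
    case True
    define n where "n = sum_mset \<nu>"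
    have "sum_mset \<nu> = n" "sum_mset \<mu> = n" using True by (simp_all add: n_def)
    then show ?thesis unfolding wt_sum by (simp add: V_def x mult_ac)
  qed (simp add: V_def x)
  finally show ?thesis .
qed

end

section \<open>Coefficients of power sums\<close>

text \<open>\<open>series_times\<close> is the usual product of series because its sums are finite;
  an infinite one would be 0 by convention.\<close>

lemma finite_decompositions: "finite {(a, b). a + b = (e :: nat \<Rightarrow>\<^sub>0 nat)}"
proof -
  let ?S = "{a. \<exists>b. a + b = e}"
  let ?B = "{..Max (insert 0 (Poly_Mapping.lookup e ` Poly_Mapping.keys e))}"
  have le: "Poly_Mapping.lookup a i \<le> Poly_Mapping.lookup e i" if "a \<in> ?S" for a i
    using that by (auto simp: lookup_add)
  have "Poly_Mapping.lookup ` ?S \<subseteq>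
      {f. \<forall>i. (i \<in> Poly_Mapping.keys e \<longrightarrow> f i \<in> ?B) \<and> (i \<notin> Poly_Mapping.keys e \<longrightarrow> f i = 0)}"
  proof (intro subsetI CollectI allI conjI impI)
    fix f i assume "f \<in> Poly_Mapping.lookup ` ?S"
    then obtain a where a: "a \<in> ?S" "f = Poly_Mapping.lookup a" by blast
    show "f i \<in> ?B" if "i \<in> Poly_Mapping.keys e"
    proof -
      have "Poly_Mapping.lookup e i \<le> Max (insert 0 (Poly_Mapping.lookup e ` Poly_Mapping.keys e))"
        using that by (intro Max_ge) auto
      then show ?thesis using le[OF a(1), of i] a(2) by simp
    qed
    show "f i = 0" if "i \<notin> Poly_Mapping.keys e"
      using le[OF a(1), of i] a(2) that by (simp add: in_keys_iff)
  qed
  moreover have "finite {f. \<forall>i. (i \<in> Poly_Mapping.keys e \<longrightarrow> f i \<in> ?B) \<and> (i \<notin> Poly_Mapping.keys e \<longrightarrow> f i = 0)}"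
    by (rule finite_set_of_finite_funs) simp_all
  ultimately have "finite (Poly_Mapping.lookup ` ?S)" by (rule finite_subset)
  then have "finite ?S"
    by (rule finite_imageD) (rule inj_onI, rule poly_mapping_eqI, simp)
  moreover have "{(a, b). a + b = e} \<subseteq> (\<lambda>a. (a, e - a)) ` ?S"
  proof
    fix p assume "p \<in> {(a, b). a + b = e}"
    then have "fst p + snd p = e" by (simp add: split_def)
    moreover from this have "snd p = e - fst p" by (metis add_diff_cancel_left')
    ultimately have "p = (fst p, e - fst p)" "fst p \<in> ?S" by (metis prod.collapse, blast)
    then show "p \<in> (\<lambda>a. (a, e - a)) ` ?S" by (rule image_eqI)
  qed
  ultimately show ?thesis by (meson finite_imageI finite_subset)
qed

lemma decompose_single:
  assumes "k \<le> Poly_Mapping.lookup e i"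
  shows "Poly_Mapping.single i k + (e - Poly_Mapping.single i k) = (e :: nat \<Rightarrow>\<^sub>0 nat)"
  by (rule poly_mapping_eqI) (use assms in \<open>auto simp: lookup_add lookup_minus lookup_single when_def\<close>)

lemma series_times_power_sum:
  assumes "0 < k"
  shows "series_times (power_sum k) g e =
    (\<Sum>i | k \<le> Poly_Mapping.lookup e i. g (e - Poly_Mapping.single i k))"
proof -
  let ?I = "{i. k \<le> Poly_Mapping.lookup e i}"
  let ?p = "\<lambda>i. (Poly_Mapping.single i k, e - Poly_Mapping.single i k)"
  have "series_times (power_sum k) g e = (\<Sum>p\<in>{(a, b). a + b = e}. power_sum k (fst p) * g (snd p))"
    by (simp add: series_times_def split_def)
  also have "\<dots> = (\<Sum>p\<in>?p ` ?I. power_sum k (fst p) * g (snd p))"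
  proof (rule sum.mono_neutral_right[OF finite_decompositions])
    show "?p ` ?I \<subseteq> {(a, b). a + b = e}" using decompose_single by auto
    show "\<forall>p\<in>{(a, b). a + b = e} - ?p ` ?I. power_sum k (fst p) * g (snd p) = 0"
    proof
      fix p assume p: "p \<in> {(a, b). a + b = e} - ?p ` ?I"
      have "\<nexists>i. fst p = Poly_Mapping.single i k"
      proof
        assume "\<exists>i. fst p = Poly_Mapping.single i k"
        then obtain i where i: "fst p = Poly_Mapping.single i k" ..
        have e: "e = Poly_Mapping.single i k + snd p" using p i by auto
        then have "k \<le> Poly_Mapping.lookup e i" by (simp add: lookup_add)
        moreover have "p = ?p i" using i e by (intro prod_eqI) simp_all
        ultimately show False using p by blast
      qed
      then show "power_sum k (fst p) * g (snd p) = 0" by (simp add: power_sum_def)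
    qed
  qed
  also have "\<dots> = (\<Sum>i\<in>?I. g (e - Poly_Mapping.single i k))"
  proof (subst sum.reindex)
    show "inj_on ?p ?I"
    proof (rule inj_onI)
      fix i j assume "?p i = ?p j"
      then have "Poly_Mapping.keys (Poly_Mapping.single i k) = Poly_Mapping.keys (Poly_Mapping.single j k)" by simp
      then show "i = j" using assms by simp
    qed
    have "power_sum k (Poly_Mapping.single i k) = 1" for i unfolding power_sum_def by auto
    then show "(\<Sum>i\<in>?I. ((\<lambda>p. power_sum k (fst p) * g (snd p)) \<circ> ?p) i) =
        (\<Sum>i\<in>?I. g (e - Poly_Mapping.single i k))" by simp
  qed
  finally show ?thesis .
qed

lemma size_exponents: "size (exponents e) = card (Poly_Mapping.keys e)"
  by (simp add: exponents_def)

lemma sum_exponents: "sum_mset (exponents e) = (\<Sum>i\<in>Poly_Mapping.keys e. Poly_Mapping.lookup e i)"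
  by (simp add: exponents_def sum_unfold_sum_mset)

lemma exponents_minus_single:
  assumes "0 < k" "k \<le> Poly_Mapping.lookup e i"
  defines "b \<equiv> e - Poly_Mapping.single i k"
  shows "sum_mset (exponents e) = k + sum_mset (exponents b)"
    and "Poly_Mapping.lookup e i = k \<Longrightarrow> exponents e = add_mset k (exponents b)"
    and "Poly_Mapping.lookup e i \<noteq> k \<Longrightarrow> size (exponents e) = size (exponents b)"
proof -
  have lb: "Poly_Mapping.lookup b j = (if j = i then Poly_Mapping.lookup e i - k else Poly_Mapping.lookup e j)" for j
    by (simp add: b_def lookup_minus lookup_single when_def)
  have i: "i \<in> Poly_Mapping.keys e" using assms by (simp add: in_keys_iff)
  have kb: "Poly_Mapping.keys b - {i} = Poly_Mapping.keys e - {i}" by (auto simp: in_keys_iff lb)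
  have kb': "Poly_Mapping.keys b \<subseteq> Poly_Mapping.keys e" using kb i by blast
  have "sum_mset (exponents b) = (\<Sum>j\<in>Poly_Mapping.keys e. Poly_Mapping.lookup b j)"
    unfolding sum_exponents using kb' by (intro sum.mono_neutral_left) (auto simp: in_keys_iff)
  also have "\<dots> = Poly_Mapping.lookup b i + (\<Sum>j\<in>Poly_Mapping.keys e - {i}. Poly_Mapping.lookup b j)"
    using i by (intro sum.remove) simp_all
  also have "(\<Sum>j\<in>Poly_Mapping.keys e - {i}. Poly_Mapping.lookup b j) =
      (\<Sum>j\<in>Poly_Mapping.keys e - {i}. Poly_Mapping.lookup e j)"
    by (rule sum.cong) (auto simp: lb)
  finally show "sum_mset (exponents e) = k + sum_mset (exponents b)"
    unfolding sum_exponents using assms(2) i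
    by (simp add: lb sum.remove[of "Poly_Mapping.keys e" i])
  show "exponents e = add_mset k (exponents b)" if "Poly_Mapping.lookup e i = k"
  proof -
    have "Poly_Mapping.keys b = Poly_Mapping.keys e - {i}"
      using kb that by (auto simp: in_keys_iff lb)
    moreover have "mset_set (Poly_Mapping.keys e) = add_mset i (mset_set (Poly_Mapping.keys e - {i}))"
      using i by (intro mset_set.remove) simp_all
    moreover have "image_mset (Poly_Mapping.lookup b) (mset_set (Poly_Mapping.keys e - {i})) =
        image_mset (Poly_Mapping.lookup e) (mset_set (Poly_Mapping.keys e - {i}))"
      by (rule image_mset_cong) (simp add: lb)
    ultimately show ?thesis using that by (simp add: exponents_def)
  qed
  show "size (exponents e) = size (exponents b)" if "Poly_Mapping.lookup e i \<noteq> k"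
  proof -
    have "i \<in> Poly_Mapping.keys b" using that assms(2) by (simp add: in_keys_iff lb)
    then have "Poly_Mapping.keys b = Poly_Mapping.keys e" using kb i by blast
    then show ?thesis by (simp add: size_exponents)
  qed
qed

section \<open>Monomials in products of power sums\<close>

definition power_sum_list :: "nat list \<Rightarrow> series" where
  "power_sum_list ks = foldr series_times (map power_sum ks) series_one"

lemma power_sum_part_list: "power_sum_part \<mu> = power_sum_list (sorted_list_of_multiset \<mu>)"
  by (simp add: power_sum_part_def power_sum_list_def)

lemma power_sum_list_Nil: "power_sum_list [] = series_one"
  by (simp add: power_sum_list_def)

lemma power_sum_list_Cons:
  "0 < k \<Longrightarrow> power_sum_list (k # ks) e =
    (\<Sum>i | k \<le> Poly_Mapping.lookup e i. power_sum_list ks (e - Poly_Mapping.single i k))"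
  by (simp add: power_sum_list_def series_times_power_sum)

lemma finite_large_exponents: "0 < k \<Longrightarrow> finite {i. k \<le> Poly_Mapping.lookup e i}" for k :: nat
  by (rule finite_subset[of _ "Poly_Mapping.keys e"]) (auto simp: in_keys_iff)

text \<open>Each factor p_k either brings in a new variable or raises the exponent of one already
  present. So the exponents arise by merging parts, and every merger lowers their number: the power
  sums are triangular with respect to the number of parts.\<close>

lemma power_sum_list_support:
  assumes "0 \<notin> set ks" "power_sum_list ks e \<noteq> 0"
  shows "sum_mset (exponents e) = sum_list ks \<and>
    (exponents e = mset ks \<or> size (exponents e) < length ks)"
  using assms
proof (induction ks arbitrary: e)
  case Nil
  then show ?case by (simp add: power_sum_list_Nil series_one_def exponents_def split: if_splits)
next
  case (Cons k ks)
  have k: "0 < k" using Cons.prems by auto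
  from Cons.prems(2) obtain i where i: "k \<le> Poly_Mapping.lookup e i"
    "power_sum_list ks (e - Poly_Mapping.single i k) \<noteq> 0"
    unfolding power_sum_list_Cons[OF k] by (metis (mono_tags, lifting) mem_Collect_eq sum.neutral)
  note ex = exponents_minus_single[OF k i(1)]
  have IH: "sum_mset (exponents (e - Poly_Mapping.single i k)) = sum_list ks"
    "exponents (e - Poly_Mapping.single i k) = mset ks \<or> size (exponents (e - Poly_Mapping.single i k)) < length ks"
    using Cons.IH[OF _ i(2)] Cons.prems(1) by auto
  show ?case
  proof (cases "Poly_Mapping.lookup e i = k")
    case True
    then show ?thesis using ex(1) ex(2)[OF True] IH by auto
  next
    case False
    then have "size (exponents e) < Suc (length ks)" using ex(3)[OF False] IH(2) by auto
    then show ?thesis using ex(1) IH by simp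
  qed
qed

text \<open>\<open>scalar\<close> is an ordered field: polynomials in \<alpha> are ordered by the
  sign of the leading coefficient. Nonnegativity excludes cancellation in
  \<open>power_sum_list_pos\<close>.\<close>

lemma power_sum_list_nonneg: "0 \<notin> set ks \<Longrightarrow> 0 \<le> power_sum_list ks e"
proof (induction ks arbitrary: e)
  case Nil
  then show ?case by (simp add: power_sum_list_Nil series_one_def)
next
  case (Cons k ks)
  then have "0 < k" by auto
  then show ?case unfolding power_sum_list_Cons[OF \<open>0 < k\<close>] using Cons by (intro sum_nonneg) auto
qed

lemma power_sum_list_pos: "0 \<notin> set ks \<Longrightarrow> exponents e = mset ks \<Longrightarrow> 0 < power_sum_list ks e"
proof (induction ks arbitrary: e)
  case Nil
  then have "Poly_Mapping.keys e = {}" using size_exponents[of e] by simp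
  then have "e = 0" by (auto simp: poly_mapping_eq_iff fun_eq_iff in_keys_iff)
  then show ?case by (simp add: power_sum_list_Nil series_one_def)
next
  case (Cons k ks)
  then have k: "0 < k" by auto
  have "k \<in># exponents e" using Cons.prems by simp
  then obtain i where i: "i \<in> Poly_Mapping.keys e" "Poly_Mapping.lookup e i = k"
    by (auto simp: exponents_def)
  have "exponents e = add_mset k (exponents (e - Poly_Mapping.single i k))"
    using exponents_minus_single(2)[OF k _ i(2)] i by simp
  then have "exponents (e - Poly_Mapping.single i k) = mset ks" using Cons.prems(2) by simp
  then have "0 < power_sum_list ks (e - Poly_Mapping.single i k)" using Cons by auto
  then show ?case
    unfolding power_sum_list_Cons[OF k] using Cons.prems(1) i
    by (intro sum_pos2[where i = i] finite_large_exponents[OF k] power_sum_list_nonneg) auto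
qed

text \<open>The coefficient of the n-th power of the first variable is the value at (1, 0, 0, ...)
  of the part of degree n, where each p_k equals 1.\<close>

lemma power_sum_list_single:
  "0 \<notin> set ks \<Longrightarrow> power_sum_list ks (Poly_Mapping.single 0 n) = (if sum_list ks = n then 1 else 0)"
proof (induction ks arbitrary: n)
  case Nil
  have "Poly_Mapping.single 0 n = (0 :: nat \<Rightarrow>\<^sub>0 nat) \<longleftrightarrow> n = 0"
    by (metis lookup_single_eq lookup_zero single_zero)
  then show ?case by (auto simp: power_sum_list_Nil series_one_def)
next
  case (Cons k ks)
  then have k: "0 < k" by auto
  show ?case
  proof (cases "k \<le> n")
    case True
    then have "{i. k \<le> Poly_Mapping.lookup (Poly_Mapping.single 0 n) i} = {0 :: nat}"
      using k by (auto simp: lookup_single when_def split: if_splits)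
    moreover have "Poly_Mapping.single 0 n - Poly_Mapping.single 0 k = (Poly_Mapping.single 0 (n - k) :: nat \<Rightarrow>\<^sub>0 nat)"
      by (rule poly_mapping_eqI) (simp add: lookup_minus lookup_single when_def)
    ultimately show ?thesis unfolding power_sum_list_Cons[OF k] using Cons True by auto
  next
    case False
    then have "{i. k \<le> Poly_Mapping.lookup (Poly_Mapping.single 0 n) i} = ({} :: nat set)"
      using k by (auto simp: lookup_single when_def split: if_splits)
    then show ?thesis unfolding power_sum_list_Cons[OF k] using False by auto
  qed
qed

text \<open>A squarefree monomial of degree n arises in the n-th power of p_1 once for each order of
  its variables.\<close>

lemma power_sum_list_ones:
  "exponents e = replicate_mset n 1 \<Longrightarrow> power_sum_list (replicate n 1) e = fact n"
proof (induction n arbitrary: e)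
  case 0
  then show ?case using power_sum_list_pos[of "[]" e] by (auto simp: power_sum_list_Nil series_one_def split: if_splits)
next
  case (Suc n)
  have one: "Poly_Mapping.lookup e i = 1" if "i \<in> Poly_Mapping.keys e" for i
  proof -
    have "Poly_Mapping.lookup e i \<in># exponents e" using that by (simp add: exponents_def)
    then show ?thesis unfolding Suc.prems by (simp del: replicate_mset_Suc add: in_replicate_mset)
  qed
  have I: "{i. 1 \<le> Poly_Mapping.lookup e i} = Poly_Mapping.keys e" by (auto simp: in_keys_iff)
  have card: "card (Poly_Mapping.keys e) = Suc n" using size_exponents[of e] Suc.prems by simp
  have "power_sum_list (replicate n 1) (e - Poly_Mapping.single i 1) = fact n"
    if "i \<in> Poly_Mapping.keys e" for i
  proof (rule Suc.IH)
    have "exponents e = add_mset 1 (exponents (e - Poly_Mapping.single i 1))"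
      by (rule exponents_minus_single(2)) (simp_all add: one[OF that])
    then show "exponents (e - Poly_Mapping.single i 1) = replicate_mset n 1" using Suc.prems by simp
  qed
  then have "power_sum_list (1 # replicate n 1) e = (\<Sum>i\<in>Poly_Mapping.keys e. fact n)"
    by (simp only: power_sum_list_Cons[OF zero_less_one] I cong: sum.cong)
  then show ?case by (simp add: card)
qed

lemma ex_exponents: "0 \<notin># \<mu> \<Longrightarrow> \<exists>e. exponents e = \<mu>"
proof (induction \<mu>)
  case empty
  have "exponents 0 = {#}" by (simp add: exponents_def)
  then show ?case ..
next
  case (add k \<mu>)
  then obtain e where e: "exponents e = \<mu>" by auto
  have k: "0 < k" using add.prems by auto
  obtain i where i: "i \<notin> Poly_Mapping.keys e" using ex_new_if_finite[OF infinite_UNIV_nat finite_keys] by blast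
  let ?e = "e + Poly_Mapping.single i k"
  have l: "Poly_Mapping.lookup ?e i = k" using i by (simp add: lookup_add in_keys_iff)
  have "?e - Poly_Mapping.single i k = e" by simp
  then have "exponents ?e = add_mset k \<mu>"
    using exponents_minus_single(2)[OF k _ l] l e by simp
  then show ?case ..
qed

lemma sorted_list_props: "set (sorted_list_of_multiset \<mu>) = set_mset \<mu>"
  "sum_list (sorted_list_of_multiset \<mu>) = sum_mset \<mu>" "length (sorted_list_of_multiset \<mu>) = size \<mu>"
  for \<mu> :: "nat multiset"
  by (metis mset_sorted_list_of_multiset set_mset_mset, metis mset_sorted_list_of_multiset sum_mset_sum_list,
      metis mset_sorted_list_of_multiset size_mset)

lemma power_sum_part_support:
  assumes "0 \<notin># \<mu>" "power_sum_part \<mu> e \<noteq> 0"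
  shows "sum_mset (exponents e) = sum_mset \<mu>" "exponents e = \<mu> \<or> size (exponents e) < size \<mu>"
  using power_sum_list_support[of "sorted_list_of_multiset \<mu>" e] assms
  by (simp_all add: power_sum_part_list sorted_list_props)

lemma power_sum_part_diagonal: "0 \<notin># \<mu> \<Longrightarrow> exponents e = \<mu> \<Longrightarrow> power_sum_part \<mu> e \<noteq> 0"
  using power_sum_list_pos[of "sorted_list_of_multiset \<mu>" e] by (simp add: power_sum_part_list sorted_list_props)

lemma power_sum_part_single:
  "0 \<notin># \<mu> \<Longrightarrow> power_sum_part \<mu> (Poly_Mapping.single 0 n) = (if sum_mset \<mu> = n then 1 else 0)"
  by (simp add: power_sum_part_list power_sum_list_single sorted_list_props)

lemma sorted_list_of_replicate_mset: "sorted_list_of_multiset (replicate_mset n x) = replicate n x"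
proof -
  have "insort x (replicate m x) = x # replicate m x" for m by (cases m) auto
  then show ?thesis by (induction n) simp_all
qed

lemma power_sum_part_ones:
  "exponents e = replicate_mset n 1 \<Longrightarrow> power_sum_part (replicate_mset n 1) e = fact n"
  by (simp only: power_sum_part_list power_sum_list_ones sorted_list_of_replicate_mset)

section \<open>Jack symmetric functions of one part\<close>

text \<open>The variable has leading coefficient 1. Positivity of \<alpha> makes the inner product
  definite.\<close>

lemma jack_alpha_pos: "0 < jack_alpha"
proof -
  have "0 < [:0, 1 :: rat:]" by (simp add: less_poly_def pos_poly_def)
  then show ?thesis by (simp add: jack_alpha_def to_fract_def zero_less_Fract_iff)
qed

lemma finite_partitions: "finite (partitions n)"
proof (rule finite_subset)
  show "partitions n \<subseteq> mset ` {xs. set xs \<subseteq> {..n} \<and> length xs \<le> n}"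
  proof
    fix \<mu> assume "\<mu> \<in> partitions n"
    then have \<mu>: "0 \<notin># \<mu>" "sum_mset \<mu> = n" by (auto simp: partitions_def)
    obtain xs where xs: "mset xs = \<mu>" by (metis ex_mset)
    have "length xs \<le> sum_list xs" if "0 \<notin> set xs" for xs :: "nat list"
      using that by (induction xs) auto
    moreover have "sum_list xs = n" using \<mu>(2) xs by (metis sum_mset_sum_list)
    moreover have "0 \<notin> set xs" using \<mu>(1) xs by (metis set_mset_mset)
    moreover have "x \<le> sum_list xs" if "x \<in> set xs" for x by (rule member_le_sum_list) (use that in auto)
    ultimately have "set xs \<subseteq> {..n} \<and> length xs \<le> n" by auto
    then show "\<mu> \<in> mset ` {xs. set xs \<subseteq> {..n} \<and> length xs \<le> n}" using xs by blast
  qed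
  show "finite (mset ` {xs. set xs \<subseteq> {..n} \<and> length xs \<le> n})"
    by (intro finite_imageI finite_lists_length_le) simp
qed

lemma partitionsD: "\<mu> \<in> partitions n \<Longrightarrow> 0 \<notin># \<mu>" "\<mu> \<in> partitions n \<Longrightarrow> sum_mset \<mu> = n"
  by (simp_all add: partitions_def)

lemma ones_partition: "replicate_mset n 1 \<in> partitions n"
  by (simp add: partitions_def in_replicate_mset sum_mset_replicate_mset)

lemma size_le_sum: "0 \<notin># \<mu> \<Longrightarrow> size \<mu> \<le> sum_mset \<mu>" for \<mu> :: "nat multiset"
  by (induction \<mu>) auto

lemma largest_sum_ge:
  assumes "0 \<notin># \<rho>"
  shows "min k (sum_mset \<rho>) \<le> largest_sum k \<rho>"
proof -
  let ?xs = "rev (sorted_list_of_multiset \<rho>)"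
  have pos: "length ys \<le> sum_list ys" if "0 \<notin> set ys" for ys :: "nat list"
    using that by (induction ys) auto
  have set: "set ?xs = set_mset \<rho>" "sum_list ?xs = sum_mset \<rho>"
    by (simp_all add: sorted_list_props sum_list_rev)
  show ?thesis
  proof (cases "k \<le> length ?xs")
    case True
    have "0 \<notin> set (take k ?xs)" using set(1) assms by (metis in_set_takeD)
    from pos[OF this] show ?thesis using True by (simp add: largest_sum_def)
  next
    case False
    then have "take k ?xs = ?xs" by simp
    then show ?thesis using set(2) by (simp only: largest_sum_def)
  qed
qed

lemma dominance_ones:
  assumes "\<rho> \<in> partitions n"
  shows "dominance_le (replicate_mset n 1) \<rho>"
proof -
  have "largest_sum k (replicate_mset n 1) \<le> min k n" for k
    by (simp add: largest_sum_def sorted_list_of_replicate_mset sum_list_replicate)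
  then show ?thesis
    using largest_sum_ge[OF partitionsD(1)[OF assms]] partitionsD(2)[OF assms]
      partitionsD(2)[OF ones_partition, of n]
    unfolding dominance_le_def by (metis order_trans)
qed

text \<open>The partition (n), the maximum in dominance order; for n = 0 it has to be empty, as
  \<open>{#0#}\<close> is not a partition.\<close>

definition top_part :: "nat \<Rightarrow> nat multiset" where
  "top_part n = (if n = 0 then {#} else {#n#})"

lemma top_part_partition: "top_part n \<in> partitions n"
  by (simp add: top_part_def partitions_def)

lemma dominance_top:
  assumes "\<rho> \<in> partitions n" "dominance_le (top_part n) \<rho>"
  shows "\<rho> = top_part n"
proof (cases "n = 0")
  case True
  then have "sum_mset \<rho> = 0" "0 \<notin># \<rho>" using assms(1) by (auto simp: partitions_def)
  then have "size \<rho> \<le> 0" using size_le_sum[of \<rho>] by metis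
  then have "\<rho> = {#}" by simp
  then show ?thesis using True by (simp add: top_part_def)
next
  case False
  let ?xs = "rev (sorted_list_of_multiset \<rho>)"
  have "largest_sum 1 {#n#} \<le> largest_sum 1 \<rho>"
    using assms(2) False unfolding dominance_le_def top_part_def by metis
  then have le: "n \<le> sum_list (take 1 ?xs)" by (simp add: largest_sum_def)
  then have "?xs \<noteq> []" using False by auto
  then obtain x ys where xs: "?xs = x # ys" by (cases ?xs) auto
  have "sum_list ?xs = n" using partitionsD(2)[OF assms(1)] by (simp add: sorted_list_props sum_list_rev)
  then have "sum_list ys = 0" "x = n" using le xs by auto
  moreover have "0 \<notin> set ys"
  proof -
    have "set ?xs = set_mset \<rho>" by (simp add: sorted_list_props)
    then show ?thesis using partitionsD(1)[OF assms(1)] xs by (metis list.set_intros(2))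
  qed
  ultimately have "?xs = [n]" using xs by (cases ys) auto
  then have "sorted_list_of_multiset \<rho> = [n]" by simp
  then have "\<rho> = {#n#}" by (metis mset_sorted_list_of_multiset mset_single_iff)
  then show ?thesis using False by (simp add: top_part_def)
qed

text \<open>Orthogonal vectors of nonzero norm are independent, and functions supported on
  \<open>P\<close> are spanned by the unit vectors of \<open>P\<close>. In \<open>J_top\<close> this
  leaves no room for a nonzero vector orthogonal to all Jack functions of degree n.\<close>

lemma card_orthogonal_family:
  fixes v :: "'i \<Rightarrow> 'k \<Rightarrow> scalar" and Z :: "'k \<Rightarrow> scalar"
  assumes P: "finite P" and I: "finite I"
    and supp: "\<And>i k. i \<in> I \<Longrightarrow> k \<notin> P \<Longrightarrow> v i k = 0"
    and orth: "\<And>i j. i \<in> I \<Longrightarrow> j \<in> I \<Longrightarrow> i \<noteq> j \<Longrightarrow> (\<Sum>k\<in>P. v i k * v j k * Z k) = 0"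
    and nonzero: "\<And>i. i \<in> I \<Longrightarrow> (\<Sum>k\<in>P. v i k * v i k * Z k) \<noteq> 0"
  shows "card I \<le> card P"
proof -
  interpret vs: vector_space "\<lambda>(c :: scalar) (f :: 'k \<Rightarrow> scalar) x. c * f x"
    by unfold_locales (auto simp: fun_eq_iff algebra_simps)
  define unit :: "'k \<Rightarrow> 'k \<Rightarrow> scalar" where "unit k = (\<lambda>x. if x = k then 1 else 0)" for k
  have inj: "inj_on v I"
  proof (rule inj_onI, rule ccontr)
    fix i j assume ij: "i \<in> I" "j \<in> I" "v i = v j" "i \<noteq> j"
    then show False using orth[OF ij(1,2,4)] nonzero[OF ij(2)] by simp
  qed
  have sum_app: "(\<Sum>x\<in>S. g x) k = (\<Sum>x\<in>S. g x k)" for S and g :: "'z \<Rightarrow> 'k \<Rightarrow> scalar" and k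
    by (induction S rule: infinite_finite_induct) auto
  have "vs.independent (v ` I)"
  proof (rule vs.independent_if_scalars_zero)
    show "finite (v ` I)" using I by simp
    fix a x assume z: "(\<Sum>x\<in>v ` I. (\<lambda>y. a x * x y)) = 0" and x: "x \<in> v ` I"
    obtain i where i: "i \<in> I" "x = v i" using x by blast
    have "(\<Sum>j\<in>I. a (v j) * v j k) = 0" for k
    proof -
      have "(\<Sum>x\<in>v ` I. (\<lambda>y. a x * x y)) k = 0" using z by simp
      then show ?thesis unfolding sum_app by (simp add: sum.reindex[OF inj])
    qed
    then have "0 = (\<Sum>k\<in>P. (\<Sum>j\<in>I. a (v j) * v j k) * v i k * Z k)" by simp
    also have "\<dots> = (\<Sum>k\<in>P. \<Sum>j\<in>I. a (v j) * (v j k * v i k * Z k))"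
      by (simp add: sum_distrib_right mult.assoc)
    also have "\<dots> = (\<Sum>j\<in>I. a (v j) * (\<Sum>k\<in>P. v j k * v i k * Z k))"
      by (subst sum.swap) (simp add: sum_distrib_left)
    also have "\<dots> = (\<Sum>j\<in>{i}. a (v j) * (\<Sum>k\<in>P. v j k * v i k * Z k))"
      using I i(1) orth by (intro sum.mono_neutral_right) auto
    finally show "a x = 0" using nonzero[OF i(1)] i(2) by simp
  qed
  moreover have "v ` I \<subseteq> vs.span (unit ` P)"
  proof
    fix x assume "x \<in> v ` I"
    then obtain i where i: "i \<in> I" "x = v i" by blast
    have "v i = (\<Sum>k\<in>P. (\<lambda>y. v i k * unit k y))"
    proof
      fix y
      have "(\<Sum>k\<in>P. v i k * unit k y) = (if y \<in> P then v i y else 0)"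
        using P by (simp add: unit_def if_distrib[of "(*) _"] cong: if_cong)
      then show "v i y = (\<Sum>k\<in>P. (\<lambda>y. v i k * unit k y)) y"
        unfolding sum_app using supp[OF i(1)] by auto
    qed
    also have "\<dots> \<in> vs.span (unit ` P)"
      by (intro vs.span_sum vs.span_scale vs.span_base) auto
    finally show "x \<in> vs.span (unit ` P)" using i by simp
  qed
  ultimately have "card (v ` I) \<le> card (unit ` P)"
    using vs.independent_span_bound[of "unit ` P" "v ` I"] P by simp
  also have "\<dots> \<le> card P" using P by (rule card_image_le)
  finally show ?thesis using card_image[OF inj] by simp
qed

section \<open>Norms, evaluation at (1, 0, 0, ...) and the one-part Jack function\<close>

locale jack_family =
  fixes J :: "nat multiset \<Rightarrow> symfun"
  assumes J: "is_jack_family J"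
begin

abbreviation "a \<equiv> jack_alpha"
abbreviation "c \<rho> \<equiv> Poly_Mapping.lookup (J \<rho>)"

definition Z :: "nat multiset \<Rightarrow> scalar" where
  "Z \<mu> = of_nat (z_part \<mu>) * a ^ size \<mu>"

lemma Z_pos: "0 \<notin># \<mu> \<Longrightarrow> 0 < Z \<mu>"
  using z_part_pos[of \<mu>] jack_alpha_pos by (simp add: Z_def)

lemma J_expand:
  assumes "\<rho> \<in> partitions n"
  obtains m where "\<And>e. expand (J \<rho>) e = (if exponents e \<in> partitions n \<and> dominance_le (exponents e) \<rho>
    then m (exponents e) else 0)" "m (replicate_mset n 1) = fact n"
proof -
  let ?S = "{\<mu> \<in> partitions n. dominance_le \<mu> \<rho>}"
  from J assms obtain m where m: "\<And>e. expand (J \<rho>) e = (\<Sum>\<mu>\<in>?S. m \<mu> * monomial_sym \<mu> e)"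
    "m (replicate_mset n 1) = fact n"
    unfolding is_jack_family_def by blast
  have "expand (J \<rho>) e = (if exponents e \<in> ?S then m (exponents e) else 0)" for e
  proof -
    have "finite ?S" using finite_partitions by simp
    then show ?thesis
      unfolding m(1) monomial_sym_def by (simp add: if_distrib[of "(*) _"] cong: if_cong)
  qed
  then show ?thesis using m(2) that[of m] by simp
qed

lemma J_no_zero: "\<rho> \<in> partitions n \<Longrightarrow> \<mu> \<in> Poly_Mapping.keys (J \<rho>) \<Longrightarrow> 0 \<notin># \<mu>"
  using J by (auto simp: is_jack_family_def symmetric_functions_def)

text \<open>Among the keys of wrong degree let \<mu> have the most parts. A monomial with exponents
  \<mu> could come from another p_\<kappa> only if \<kappa> had the same degree and more parts, so
  its coefficient in \<open>J \<rho>\<close> is nonzero. But the expansion into monomial functions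
  contains only monomials of degree n.\<close>

lemma J_homogeneous:
  assumes "\<rho> \<in> partitions n"
  shows "Poly_Mapping.keys (J \<rho>) \<subseteq> partitions n"
proof (rule ccontr)
  let ?K = "{\<mu> \<in> Poly_Mapping.keys (J \<rho>). sum_mset \<mu> \<noteq> n}"
  assume "\<not> Poly_Mapping.keys (J \<rho>) \<subseteq> partitions n"
  then have "?K \<noteq> {}" using J_no_zero[OF assms] by (auto simp: partitions_def)
  then have "Max (size ` ?K) \<in> size ` ?K" by (intro Max_in) auto
  then obtain \<mu> where "\<mu> \<in> ?K" "size \<mu> = Max (size ` ?K)" by (metis (no_types, lifting) imageE)
  then have \<mu>: "\<mu> \<in> ?K" "\<And>\<kappa>. \<kappa> \<in> ?K \<Longrightarrow> size \<kappa> \<le> size \<mu>" by auto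
  have no0: "0 \<notin># \<mu>" using \<mu>(1) J_no_zero[OF assms] by blast
  obtain e where e: "exponents e = \<mu>" using ex_exponents[OF no0] by blast
  obtain m where "\<And>e. expand (J \<rho>) e = (if exponents e \<in> partitions n \<and> dominance_le (exponents e) \<rho>
    then m (exponents e) else 0)" using J_expand[OF assms] by metis
  then have "expand (J \<rho>) e = 0" using e \<mu>(1) by (simp add: partitions_def)
  moreover have "expand (J \<rho>) e = (\<Sum>\<kappa>\<in>{\<mu>}. c \<rho> \<kappa> * power_sum_part \<kappa> e)"
    unfolding expand_def
  proof (rule sum.mono_neutral_right)
    show "\<forall>\<kappa>\<in>Poly_Mapping.keys (J \<rho>) - {\<mu>}. c \<rho> \<kappa> * power_sum_part \<kappa> e = 0"
    proof
      fix \<kappa> assume \<kappa>: "\<kappa> \<in> Poly_Mapping.keys (J \<rho>) - {\<mu>}"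
      have "power_sum_part \<kappa> e = 0"
      proof (rule ccontr)
        assume nz: "power_sum_part \<kappa> e \<noteq> 0"
        have "0 \<notin># \<kappa>" using \<kappa> J_no_zero[OF assms] by blast
        note s = power_sum_part_support[OF this nz]
        then have "\<kappa> \<in> ?K" "size \<mu> < size \<kappa>" using \<kappa> \<mu>(1) e by auto
        then show False using \<mu>(2)[of \<kappa>] by simp
      qed
      then show "c \<rho> \<kappa> * power_sum_part \<kappa> e = 0" by simp
    qed
  qed (use \<mu> in auto)
  ultimately have "c \<rho> \<mu> * power_sum_part \<mu> e = 0" by simp
  then show False using \<mu>(1) power_sum_part_diagonal[OF no0 e] by (simp add: in_keys_iff)
qed

lemma c_zero: "\<rho> \<in> partitions n \<Longrightarrow> \<mu> \<notin> partitions n \<Longrightarrow> c \<rho> \<mu> = 0"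
  using J_homogeneous[of \<rho> n] by (auto simp: in_keys_iff)

lemma expand_partitions:
  "\<rho> \<in> partitions n \<Longrightarrow> expand (J \<rho>) e = (\<Sum>\<mu>\<in>partitions n. c \<rho> \<mu> * power_sum_part \<mu> e)"
  unfolding expand_def
  by (rule sum.mono_neutral_left[OF finite_partitions J_homogeneous]) (auto simp: in_keys_iff)

lemma inner_partitions:
  "\<rho> \<in> partitions n \<Longrightarrow> jack_inner (J \<rho>) f = (\<Sum>\<mu>\<in>partitions n. c \<rho> \<mu> * Poly_Mapping.lookup f \<mu> * Z \<mu>)"
  unfolding jack_inner_def Z_def
  by (rule sum.mono_neutral_left[OF finite_partitions J_homogeneous]) (auto simp: in_keys_iff)

text \<open>The sum is the coefficient of the n-th power of one variable. Among monomial functions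
  only the one of (n) contains this power, and (n) is dominated by no other partition.\<close>

lemma J_at_one:
  assumes "\<rho> \<in> partitions n" "\<rho> \<noteq> top_part n"
  shows "(\<Sum>\<mu>\<in>partitions n. c \<rho> \<mu>) = 0"
proof -
  let ?e = "Poly_Mapping.single 0 n :: nat \<Rightarrow>\<^sub>0 nat"
  obtain m where m: "\<And>e. expand (J \<rho>) e = (if exponents e \<in> partitions n \<and> dominance_le (exponents e) \<rho>
    then m (exponents e) else 0)" using J_expand[OF assms(1)] by metis
  have "exponents ?e = top_part n" by (simp add: exponents_def top_part_def)
  then have "expand (J \<rho>) ?e = 0" using m dominance_top[OF assms(1)] assms(2) by auto
  moreover have "expand (J \<rho>) ?e = (\<Sum>\<mu>\<in>partitions n. c \<rho> \<mu>)"
    unfolding expand_partitions[OF assms(1)]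
    by (rule sum.cong) (auto simp: power_sum_part_single partitions_def)
  ultimately show ?thesis by simp
qed

text \<open>Only the n-th power of p_1 contains squarefree monomials of degree n, with coefficient
  n!, and the normalization of \<open>J \<rho>\<close> prescribes the same n!.\<close>

lemma J_ones:
  assumes "\<rho> \<in> partitions n"
  shows "c \<rho> (replicate_mset n 1) = 1"
proof -
  let ?o = "replicate_mset n (1 :: nat)"
  obtain e where e: "exponents e = ?o"
    using ex_exponents[OF partitionsD(1)[OF ones_partition]] by blast
  obtain m where m: "\<And>e. expand (J \<rho>) e = (if exponents e \<in> partitions n \<and> dominance_le (exponents e) \<rho>
    then m (exponents e) else 0)" "m ?o = fact n" using J_expand[OF assms] by metis
  have "expand (J \<rho>) e = fact n"
    unfolding m(1) e using ones_partition dominance_ones[OF assms] m(2) by simp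
  moreover have "expand (J \<rho>) e = (\<Sum>\<mu>\<in>{?o}. c \<rho> \<mu> * power_sum_part \<mu> e)"
    unfolding expand_partitions[OF assms]
  proof (rule sum.mono_neutral_right[OF finite_partitions])
    show "\<forall>\<mu>\<in>partitions n - {?o}. c \<rho> \<mu> * power_sum_part \<mu> e = 0"
    proof
      fix \<mu> assume \<mu>: "\<mu> \<in> partitions n - {?o}"
      have "power_sum_part \<mu> e = 0"
      proof (rule ccontr)
        assume "power_sum_part \<mu> e \<noteq> 0"
        from power_sum_part_support(2)[OF _ this] \<mu> e have "n < size \<mu>" by (auto simp: partitions_def)
        then show False using size_le_sum[of \<mu>] \<mu> by (simp add: partitions_def)
      qed
      then show "c \<rho> \<mu> * power_sum_part \<mu> e = 0" by simp
    qed
  qed (use ones_partition in auto)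
  ultimately show ?thesis using power_sum_part_ones[OF e] by simp
qed

text \<open>A sum of squares with positive weights in an ordered field. It shows that the Jack
  functions have nonzero norm, and also that the remainder in \<open>J_top\<close> would
  have.\<close>

lemma inner_pos:
  assumes "\<And>\<mu>. \<mu> \<notin> partitions n \<Longrightarrow> f \<mu> = (0 :: scalar)" "f \<kappa> \<noteq> 0"
  shows "0 < (\<Sum>\<mu>\<in>partitions n. f \<mu> * f \<mu> * Z \<mu>)"
proof (rule sum_pos2[OF finite_partitions])
  show \<kappa>: "\<kappa> \<in> partitions n" using assms by blast
  show "0 < f \<kappa> * f \<kappa> * Z \<kappa>"
    using assms(2) Z_pos[OF partitionsD(1)[OF \<kappa>]] by (simp add: zero_less_mult_iff linorder_neq_iff) linarith
  show "0 \<le> f \<mu> * f \<mu> * Z \<mu>" if "\<mu> \<in> partitions n" for \<mu>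
    using Z_pos[OF partitionsD(1)[OF that]] by simp
qed

lemma J_norm: "\<rho> \<in> partitions n \<Longrightarrow> 0 < jack_inner (J \<rho>) (J \<rho>)"
  unfolding inner_partitions using c_zero J_ones[of \<rho> n]
  by (intro inner_pos[where \<kappa> = "replicate_mset n 1"]) auto

text \<open>The vector that represents the sum of the coefficients, that is the value at (1, 0, 0,
  ...), under the inner product, see \<open>g_inner\<close>.\<close>

definition g :: "nat \<Rightarrow> nat multiset \<Rightarrow> scalar" where
  "g n \<mu> = (if \<mu> \<in> partitions n then 1 / Z \<mu> else 0)"

lemma g_inner: "(\<Sum>\<mu>\<in>partitions n. g n \<mu> * f \<mu> * Z \<mu>) = (\<Sum>\<mu>\<in>partitions n. f \<mu>)"
proof (rule sum.cong[OF refl])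
  fix \<mu> assume "\<mu> \<in> partitions n"
  then show "g n \<mu> * f \<mu> * Z \<mu> = f \<mu>" using Z_pos[OF partitionsD(1), of \<mu> n] by (simp add: g_def)
qed

text \<open>By \<open>J_at_one\<close> the vector \<open>g n\<close> is orthogonal to every Jack
  function of degree n except the one of (n). After subtraction of its projection on that one, the
  remainder is orthogonal to all of them, and counting dimensions shows that it is 0.\<close>

lemma J_top: "c (top_part n) \<mu> = fact n * a ^ n * g n \<mu>"
proof -
  let ?P = "partitions n" and ?t = "top_part n"
  define N where "N = jack_inner (J ?t) (J ?t)"
  define T where "T = (\<Sum>\<mu>\<in>?P. c ?t \<mu>)"
  have N: "N \<noteq> 0" using J_norm[OF top_part_partition] by (simp add: N_def less_imp_neq[symmetric])
  \<comment> \<open>\<open>T / N\<close> is the coefficient of the projection, since the inner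
    product of \<open>g n\<close> with \<open>J ?t\<close> is \<open>T\<close>.\<close>
  define r where "r \<mu> = g n \<mu> - T / N * c ?t \<mu>" for \<mu>
  have orth: "(\<Sum>\<mu>\<in>?P. c \<rho> \<mu> * c \<kappa> \<mu> * Z \<mu>) = 0" if "\<rho> \<in> ?P" "\<kappa> \<in> ?P" "\<rho> \<noteq> \<kappa>" for \<rho> \<kappa>
    using J that inner_partitions[OF that(1), of "J \<kappa>"] by (auto simp: is_jack_family_def)
  have r_orth: "(\<Sum>\<mu>\<in>?P. r \<mu> * c \<rho> \<mu> * Z \<mu>) = 0" if \<rho>: "\<rho> \<in> ?P" for \<rho>
  proof -
    have "(\<Sum>\<mu>\<in>?P. r \<mu> * c \<rho> \<mu> * Z \<mu>) =
        (\<Sum>\<mu>\<in>?P. g n \<mu> * c \<rho> \<mu> * Z \<mu>) - T / N * (\<Sum>\<mu>\<in>?P. c ?t \<mu> * c \<rho> \<mu> * Z \<mu>)"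
      by (simp add: r_def sum_subtractf sum_distrib_left algebra_simps)
    also have "\<dots> = 0"
    proof (cases "\<rho> = ?t")
      case True
      then show ?thesis
        using N unfolding g_inner N_def inner_partitions[OF top_part_partition] by (simp add: T_def)
    next
      case False
      then show ?thesis
        using orth[OF top_part_partition \<rho>] J_at_one[OF \<rho>] by (simp add: g_inner)
    qed
    finally show ?thesis .
  qed
  have r_supp: "r \<mu> = 0" if "\<mu> \<notin> ?P" for \<mu>
    using that c_zero[OF top_part_partition] by (simp add: r_def g_def)
  have r0: "r \<mu> = 0" for \<mu>
  proof (rule ccontr)
    assume "r \<mu> \<noteq> 0"
    then have norm: "0 < (\<Sum>\<mu>\<in>?P. r \<mu> * r \<mu> * Z \<mu>)" using r_supp by (rule inner_pos[rotated])
    \<comment> \<open>The remainder, indexed by \<open>None\<close>, joins the Jack functions; this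
      would be an orthogonal family with one member too many.\<close>
    define v where "v i = (case i of None \<Rightarrow> r | Some \<rho> \<Rightarrow> c \<rho>)" for i
    have "card (insert None (Some ` ?P)) \<le> card ?P"
    proof (rule card_orthogonal_family[where v = v and Z = Z])
      show "finite ?P" "finite (insert None (Some ` ?P))" using finite_partitions by simp_all
      show "v i k = 0" if "i \<in> insert None (Some ` ?P)" "k \<notin> ?P" for i k
        using that r_supp c_zero by (auto simp: v_def)
      show "(\<Sum>k\<in>?P. v i k * v j k * Z k) = 0"
        if ij: "i \<in> insert None (Some ` ?P)" "j \<in> insert None (Some ` ?P)" "i \<noteq> j" for i j
      proof -
        have "(\<Sum>k\<in>?P. c \<rho> k * r k * Z k) = 0" if "\<rho> \<in> ?P" for \<rho>
          using r_orth[OF that] by (simp add: mult.commute[of "r _"])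
        then show ?thesis using ij orth r_orth by (cases i; cases j) (auto simp: v_def)
      qed
      show "(\<Sum>k\<in>?P. v i k * v i k * Z k) \<noteq> 0" if "i \<in> insert None (Some ` ?P)" for i
      proof -
        have "(\<Sum>k\<in>?P. c \<rho> k * c \<rho> k * Z k) \<noteq> 0" if "\<rho> \<in> ?P" for \<rho>
          using J_norm[OF that] unfolding inner_partitions[OF that] by simp
        then show ?thesis using that norm by (auto simp: v_def)
      qed
    qed
    then show False using finite_partitions[of n] by (simp add: card_image card_insert_if)
  qed
  have eq: "g n \<mu> = T / N * c ?t \<mu>" for \<mu> using r0[of \<mu>] by (simp add: r_def)
  \<comment> \<open>The factor \<open>T / N\<close> is found by comparing the coefficients of the
    n-th power of p_1, which is 1 in \<open>J ?t\<close> by \<open>J_ones\<close>.\<close>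
  have "Z (replicate_mset n 1) = fact n * a ^ n"
    by (cases "n = 0") (simp_all add: Z_def z_part_def)
  then have "1 / (fact n * a ^ n) = T / N"
    using eq[of "replicate_mset n 1"] ones_partition[of n] J_ones[OF top_part_partition, of n] by (simp add: g_def)
  then have "g n \<mu> = 1 / (fact n * a ^ n) * c ?t \<mu>" using eq[of \<mu>] by simp
  moreover have "fact n * a ^ n \<noteq> 0" using jack_alpha_pos by simp
  ultimately show ?thesis by simp
qed

text \<open>Only \<rho> = (n) survives, by \<open>J_at_one\<close>. With k = n! \<alpha>^n and T the
  sum of the coefficients of J_(n), \<open>J_top\<close> makes its norm k T; so T cancels, and of
  the k^2 from the two coefficients one factor k remains.\<close>

lemma J_sum_at_one:
  "(\<Sum>\<rho>\<in>partitions n. 1 / jack_inner (J \<rho>) (J \<rho>) * (c \<rho> \<mu> * c \<rho> \<nu> * (\<Sum>\<tau>\<in>partitions n. c \<rho> \<tau>))) =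
    fact n * a ^ n * g n \<mu> * g n \<nu>"
proof -
  let ?t = "top_part n" and ?k = "fact n * a ^ n"
  have k: "?k \<noteq> 0" "a \<noteq> 0" using jack_alpha_pos by simp_all
  have "(\<Sum>\<rho>\<in>partitions n. 1 / jack_inner (J \<rho>) (J \<rho>) * (c \<rho> \<mu> * c \<rho> \<nu> * (\<Sum>\<tau>\<in>partitions n. c \<rho> \<tau>))) =
      (\<Sum>\<rho>\<in>{?t}. 1 / jack_inner (J \<rho>) (J \<rho>) * (c \<rho> \<mu> * c \<rho> \<nu> * (\<Sum>\<tau>\<in>partitions n. c \<rho> \<tau>)))"
  proof (rule sum.mono_neutral_right[OF finite_partitions])
    show "{?t} \<subseteq> partitions n" using top_part_partition by simp
    show "\<forall>\<rho>\<in>partitions n - {?t}. 1 / jack_inner (J \<rho>) (J \<rho>) *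
        (c \<rho> \<mu> * c \<rho> \<nu> * (\<Sum>\<tau>\<in>partitions n. c \<rho> \<tau>)) = 0"
    proof
      fix \<rho> assume "\<rho> \<in> partitions n - {?t}"
      then have "(\<Sum>\<tau>\<in>partitions n. c \<rho> \<tau>) = 0" by (intro J_at_one) auto
      then show "1 / jack_inner (J \<rho>) (J \<rho>) *
          (c \<rho> \<mu> * c \<rho> \<nu> * (\<Sum>\<tau>\<in>partitions n. c \<rho> \<tau>)) = 0" by simp
    qed
  qed
  moreover have "jack_inner (J ?t) (J ?t) = ?k * (\<Sum>\<tau>\<in>partitions n. c ?t \<tau>)"
  proof -
    have "jack_inner (J ?t) (J ?t) = (\<Sum>\<tau>\<in>partitions n. ?k * (g n \<tau> * c ?t \<tau> * Z \<tau>))"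
      unfolding inner_partitions[OF top_part_partition]
      by (rule sum.cong[OF refl]) (subst J_top, simp only: mult.assoc)
    also have "\<dots> = ?k * (\<Sum>\<tau>\<in>partitions n. c ?t \<tau>)"
      unfolding sum_distrib_left[symmetric] g_inner ..
    finally show ?thesis .
  qed
  moreover have "jack_inner (J ?t) (J ?t) \<noteq> 0"
    using J_norm[OF top_part_partition, of n] by simp
  ultimately show ?thesis using k by (simp add: J_top[of n \<mu>] J_top[of n \<nu>])
qed

end

section \<open>The coefficients \<open>h\<close> at \<open>p\<^sub>\<tau> = 1\<close>\<close>

lemma const3_mult: "const3 (x * y) = const3 x * const3 y"
  by (simp add: const3_def mult_single)

lemma const3_of_nat: "const3 (of_nat n) = of_nat n"
  by (simp add: const3_def)

lemma const3_one: "const3 1 = 1"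
  by (simp add: const3_def)

lemma const3_uminus: "const3 (- x) = - const3 x"
  by (simp add: const3_def single_uminus)

lemma const3_power: "const3 (x ^ n) = const3 x ^ n"
  by (induction n) (simp_all add: const3_mult const3_one)

lemma lookup_const3_mult: "Poly_Mapping.lookup (const3 x * f) k = x * Poly_Mapping.lookup f k"
  unfolding const3_def mult_map_scale_conv_mult[symmetric] by (simp add: map.rep_eq when_def)

text \<open>For a fixed coefficient, the logarithm may be replaced by a finite partial sum
  \<open>L\<close>. The derivative of \<open>L\<close> is a geometric sum times G', which
  multiplication by F = 1 + G telescopes to G' minus a multiple of a high power of G; that power
  starts beyond the coefficient in question.\<close>

lemma formal_log_deriv:
  assumes F0: "fps_nth F 0 = 1"
  shows "F * fps_deriv (formal_log F) = fps_deriv F"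
proof (rule fps_ext)
  fix n
  define G where "G = F - 1"
  have G0: "fps_nth G 0 = 0" using F0 by (simp add: G_def)
  let ?c = "\<lambda>k. const3 ((-1) ^ (k + 1) / of_nat k)"
  \<comment> \<open>The derivative shifts coefficients by one, so the logarithm has to be exact up
    to n + 1.\<close>
  define N where "N = Suc n"
  define L where "L = (\<Sum>k = 1..N. fps_const (?c k) * G ^ k)"
  have log_nth: "fps_nth (formal_log F) m = fps_nth L m" if "m \<le> N" for m
  proof -
    have "fps_nth L m = (\<Sum>k = 1..N. ?c k * fps_nth (G ^ k) m)"
      by (simp add: L_def fps_sum_nth)
    also have "\<dots> = (\<Sum>k = 1..m. ?c k * fps_nth (G ^ k) m)"
      using that startsby_zero_power_prefix[OF G0]
      by (intro sum.mono_neutral_right) auto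
    finally show ?thesis by (simp add: formal_log_def G_def)
  qed
  have "fps_deriv L = (\<Sum>k = 1..N. fps_const (?c k) * (fps_const (of_nat k) * fps_deriv G * G ^ (k - 1)))"
    by (simp only: L_def fps_deriv_sum fps_deriv_mult_const_left fps_deriv_power)
  also have "\<dots> = (\<Sum>k = 1..N. (- G) ^ (k - 1) * fps_deriv G)"
  proof (rule sum.cong[OF refl])
    fix k assume "k \<in> {1..N}"
    then obtain j where k: "k = Suc j" by (cases k) auto
    have "?c k * of_nat k = (- 1) ^ j"
    proof -
      have "?c k * of_nat k = const3 ((-1) ^ (k + 1) / of_nat k * of_nat k)"
        by (simp only: const3_mult const3_of_nat)
      also have "(-1) ^ (k + 1) / of_nat k * of_nat k = ((-1) ^ j :: scalar)"
      proof -
        have "of_nat k \<noteq> (0 :: scalar)" unfolding of_nat_eq_0_iff k by simp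
        then have "(-1) ^ (k + 1) / of_nat k * of_nat k = ((-1) ^ (k + 1) :: scalar)" by simp
        then show ?thesis by (simp add: k)
      qed
      finally show ?thesis by (simp add: const3_power const3_uminus const3_one)
    qed
    moreover have "fps_const (- 1 :: symfun3) = - 1" by (simp add: fps_eq_iff)
    then have "fps_const ((- 1 :: symfun3) ^ j) = (- 1) ^ j" by (metis fps_const_power)
    ultimately have "fps_const (?c k) * fps_const (of_nat k) = (- 1) ^ j" by (simp only: fps_const_mult)
    then have "fps_const (?c k) * (fps_const (of_nat k) * fps_deriv G * G ^ j) = (- 1) ^ j * (fps_deriv G * G ^ j)"
      by (simp only: mult.assoc[symmetric])
    then show "fps_const (?c k) * (fps_const (of_nat k) * fps_deriv G * G ^ (k - 1)) = (- G) ^ (k - 1) * fps_deriv G"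
      using k by (simp add: power_minus[of G] mult_ac)
  qed
  also have "\<dots> = (\<Sum>j<N. (- G) ^ j) * fps_deriv G"
    unfolding sum_distrib_right by (rule sum.reindex_bij_witness[where i = Suc and j = "\<lambda>k. k - 1"]) auto
  finally have "F * fps_deriv L = ((1 - (- G)) * (\<Sum>j<N. (- G) ^ j)) * fps_deriv G"
    by (simp add: G_def mult_ac)
  also have "\<dots> = fps_deriv G - (- G) ^ N * fps_deriv G"
    unfolding one_diff_power_eq[symmetric] by (simp add: algebra_simps)
  finally have main: "F * fps_deriv L = fps_deriv G - (- G) ^ N * fps_deriv G" .
  have "fps_nth (F * fps_deriv (formal_log F)) n = fps_nth (F * fps_deriv L) n"
    unfolding fps_mult_nth by (rule sum.cong) (simp_all add: log_nth N_def)
  also have "\<dots> = fps_nth (fps_deriv G) n"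
  proof -
    have "fps_nth ((- G) ^ N) i = 0" if "i \<le> n" for i
      using startsby_zero_power_prefix[of "- G" N] G0 that by (simp add: N_def)
    then have "fps_nth ((- G) ^ N * fps_deriv G) n = 0"
      unfolding fps_mult_nth by (intro sum.neutral) auto
    then show ?thesis unfolding main by simp
  qed
  finally show "fps_nth (F * fps_deriv (formal_log F)) n = fps_nth (fps_deriv F) n" by (simp add: G_def)
qed

text \<open>Replaces every p_\<tau>(z) by 1, the effect of z = (1, 0, 0, ...); by
  \<open>specialise_mult\<close> products become convolutions.\<close>

definition specialise :: "symfun3 \<Rightarrow> scalar pair_fun" where
  "specialise f x = (\<Sum>k\<in>Poly_Mapping.keys f. if (fst k, fst (snd k)) = x then Poly_Mapping.lookup f k else 0)"

lemma specialise_superset: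
  assumes "finite B" "\<And>k. k \<notin> B \<Longrightarrow> Poly_Mapping.lookup f k = 0"
  shows "specialise f x = (\<Sum>k\<in>B. if (fst k, fst (snd k)) = x then Poly_Mapping.lookup f k else 0)"
  unfolding specialise_def
  by (rule sum.mono_neutral_left[OF assms(1)]) (use assms(2) in \<open>auto simp: in_keys_iff\<close>)

lemma specialise_add: "specialise (f + g) x = specialise f x + specialise g x"
proof -
  let ?B = "Poly_Mapping.keys f \<union> Poly_Mapping.keys g"
  have B: "finite ?B" by simp
  note s = specialise_superset[OF B]
  show ?thesis
    by (subst (1 2 3) s)
      (auto simp: in_keys_iff lookup_add sum.distrib[symmetric] intro!: sum.cong)
qed

lemma specialise_zero: "specialise 0 x = 0"
  by (simp add: specialise_def)

lemma specialise_sum: "specialise (\<Sum>i\<in>I. f i) x = (\<Sum>i\<in>I. specialise (f i) x)"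
  by (induction I rule: infinite_finite_induct) (simp_all add: specialise_add specialise_zero)

lemma specialise_diff: "specialise (f - g) x = specialise f x - specialise g x"
  using specialise_add[of "f - g" g x] by simp

lemma specialise_single:
  "specialise (Poly_Mapping.single k y) x = (if (fst k, fst (snd k)) = x then y else 0)"
  by (subst specialise_superset[of "{k}"]) (auto simp: lookup_single when_def)

lemma sum_monomials: "f = (\<Sum>k\<in>Poly_Mapping.keys f. Poly_Mapping.single k (Poly_Mapping.lookup f k))"
  by (rule poly_mapping_eqI) (auto simp: lookup_sum lookup_single when_def in_keys_iff)

lemma specialise_mult: "specialise (f * g) x = conv (specialise f) (specialise g) x"
proof -
  let ?pr = "\<lambda>k :: nat multiset \<times> nat multiset \<times> nat multiset. (fst k, fst (snd k))"
  let ?f = "Poly_Mapping.lookup f" and ?g = "Poly_Mapping.lookup g"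
  let ?K = "Poly_Mapping.keys f" and ?L = "Poly_Mapping.keys g"
  have "f * g = (\<Sum>k\<in>?K. \<Sum>l\<in>?L. Poly_Mapping.single (k + l) (?f k * ?g l))"
    by (subst sum_monomials[of f], subst sum_monomials[of g]) (simp add: sum_product mult_single)
  then have "specialise (f * g) x = (\<Sum>k\<in>?K. \<Sum>l\<in>?L. if ?pr k + ?pr l = x then ?f k * ?g l else 0)"
    by (simp add: specialise_sum specialise_single)
  also have "\<dots> = (\<Sum>k\<in>?K. \<Sum>l\<in>?L. \<Sum>p\<in>psplits x. (if ?pr k = fst p then ?f k else 0) * (if ?pr l = snd p then ?g l else 0))"
  proof (intro sum.cong refl)
    fix k l
    have "(\<Sum>p\<in>psplits x. (if ?pr k = fst p then ?f k else 0) * (if ?pr l = snd p then ?g l else 0)) =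
        (\<Sum>p\<in>psplits x. if p = (?pr k, ?pr l) then ?f k * ?g l else 0)"
      by (rule sum.cong) auto
    also have "\<dots> = (if ?pr k + ?pr l = x then ?f k * ?g l else 0)"
      by (simp add: finite_psplits) (simp add: psplits_def)
    finally show "(if ?pr k + ?pr l = x then ?f k * ?g l else 0) =
        (\<Sum>p\<in>psplits x. (if ?pr k = fst p then ?f k else 0) * (if ?pr l = snd p then ?g l else 0))" by simp
  qed
  also have "\<dots> = (\<Sum>k\<in>?K. \<Sum>p\<in>psplits x. \<Sum>l\<in>?L. (if ?pr k = fst p then ?f k else 0) * (if ?pr l = snd p then ?g l else 0))"
    by (rule sum.cong[OF refl]) (rule sum.swap)
  also have "\<dots> = (\<Sum>p\<in>psplits x. \<Sum>k\<in>?K. \<Sum>l\<in>?L. (if ?pr k = fst p then ?f k else 0) * (if ?pr l = snd p then ?g l else 0))"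
    by (rule sum.swap)
  also have "\<dots> = conv (specialise f) (specialise g) x"
    by (simp add: conv_def split_def specialise_def sum_product)
  finally show ?thesis .
qed

lemma lookup_tensor3:
  "Poly_Mapping.lookup (tensor3 f g h) (\<mu>, \<nu>, \<tau>) =
    Poly_Mapping.lookup f \<mu> * Poly_Mapping.lookup g \<nu> * Poly_Mapping.lookup h \<tau>"
proof -
  let ?c = "\<lambda>p. Poly_Mapping.lookup f (fst p) * Poly_Mapping.lookup g (fst (snd p)) * Poly_Mapping.lookup h (snd (snd p))"
  let ?B = "Poly_Mapping.keys f \<times> Poly_Mapping.keys g \<times> Poly_Mapping.keys h"
  have "tensor3 f g h = (\<Sum>p\<in>?B. Poly_Mapping.single p (?c p))"
    by (simp add: tensor3_def sum.cartesian_product split_def)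
  then have "Poly_Mapping.lookup (tensor3 f g h) (\<mu>, \<nu>, \<tau>) = (\<Sum>p\<in>?B. if p = (\<mu>, \<nu>, \<tau>) then ?c p else 0)"
    by (simp add: lookup_sum lookup_single when_def)
  also have "\<dots> = (if (\<mu>, \<nu>, \<tau>) \<in> ?B then ?c (\<mu>, \<nu>, \<tau>) else 0)"
    by (rule sum.delta) simp
  finally show ?thesis by (auto simp: in_keys_iff)
qed

text \<open>\<open>specialise\<close> adds up all third keys, whereas the claim sums over
  \<open>partitions n\<close>; this grading shows that no other keys occur in the coefficient of
  t^n.\<close>

definition z_graded :: "nat \<Rightarrow> symfun3 \<Rightarrow> bool" where
  "z_graded n f \<longleftrightarrow> (\<forall>k. Poly_Mapping.lookup f k \<noteq> 0 \<longrightarrow> snd (snd k) \<in> partitions n)"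

lemma z_graded_const: "z_graded n f \<Longrightarrow> z_graded n (const3 x * f)"
  by (auto simp: z_graded_def lookup_const3_mult)

lemma z_graded_diff: "z_graded n f \<Longrightarrow> z_graded n g \<Longrightarrow> z_graded n (f - g)"
  unfolding z_graded_def lookup_minus by (metis diff_0_right)

lemma z_graded_sum: "(\<And>i. i \<in> I \<Longrightarrow> z_graded n (f i)) \<Longrightarrow> z_graded n (\<Sum>i\<in>I. f i)"
  unfolding z_graded_def lookup_sum by (metis (no_types, lifting) sum.neutral)

lemma z_graded_mult: "z_graded m f \<Longrightarrow> z_graded n g \<Longrightarrow> z_graded (m + n) (f * g)"
  unfolding z_graded_def
proof (intro allI impI)
  fix k assume f: "\<forall>k. Poly_Mapping.lookup f k \<noteq> 0 \<longrightarrow> snd (snd k) \<in> partitions m"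
    and g: "\<forall>k. Poly_Mapping.lookup g k \<noteq> 0 \<longrightarrow> snd (snd k) \<in> partitions n"
    and "Poly_Mapping.lookup (f * g) k \<noteq> 0"
  then have "k \<in> Poly_Mapping.keys (f * g)" by (simp add: in_keys_iff)
  then obtain p q where "k = p + q" "p \<in> Poly_Mapping.keys f" "q \<in> Poly_Mapping.keys g"
    using keys_mult[of f g] by blast
  moreover from this have "snd (snd p) \<in> partitions m" "snd (snd q) \<in> partitions n"
    using f g unfolding in_keys_iff by blast+
  ultimately show "snd (snd k) \<in> partitions (m + n)" by (auto simp: partitions_def)
qed

context jack_family
begin

abbreviation "F \<equiv> fps_nth (jack_series J)"
abbreviation "h \<equiv> fps_nth (h_series J)"

lemma lookup_F: "Poly_Mapping.lookup (F n) (\<mu>, \<nu>, \<tau>) =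
    (\<Sum>\<rho>\<in>partitions n. 1 / jack_inner (J \<rho>) (J \<rho>) * (c \<rho> \<mu> * c \<rho> \<nu> * c \<rho> \<tau>))"
  by (simp add: jack_series_def lookup_sum lookup_const3_mult lookup_tensor3)

lemma F_support: "Poly_Mapping.lookup (F n) (\<mu>, \<nu>, \<tau>) \<noteq> 0 \<Longrightarrow>
    \<mu> \<in> partitions n \<and> \<nu> \<in> partitions n \<and> \<tau> \<in> partitions n"
proof (rule ccontr)
  assume "\<not> (\<mu> \<in> partitions n \<and> \<nu> \<in> partitions n \<and> \<tau> \<in> partitions n)"
  then have "c \<rho> \<mu> * c \<rho> \<nu> * c \<rho> \<tau> = 0" if "\<rho> \<in> partitions n" for \<rho>
    using c_zero[OF that] by auto
  then have "Poly_Mapping.lookup (F n) (\<mu>, \<nu>, \<tau>) = 0" unfolding lookup_F by (intro sum.neutral) simp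
  moreover assume "Poly_Mapping.lookup (F n) (\<mu>, \<nu>, \<tau>) \<noteq> 0"
  ultimately show False by blast
qed

lemma F_graded: "z_graded n (F n)"
  unfolding z_graded_def using F_support by auto

lemma specialise_F: "specialise (F n) (\<mu>, \<nu>) = fact n * a ^ n * g n \<mu> * g n \<nu>"
proof -
  let ?P = "partitions n"
  let ?l = "\<lambda>k. Poly_Mapping.lookup (F n) k"
  have "specialise (F n) (\<mu>, \<nu>) = (\<Sum>k\<in>{\<mu>} \<times> {\<nu>} \<times> ?P. ?l k)"
  proof -
    have "specialise (F n) (\<mu>, \<nu>) = (\<Sum>k\<in>Poly_Mapping.keys (F n) \<union> {\<mu>} \<times> {\<nu>} \<times> ?P.
        if (fst k, fst (snd k)) = (\<mu>, \<nu>) then ?l k else 0)"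
      by (rule specialise_superset) (auto simp: finite_partitions in_keys_iff)
    also have "\<dots> = (\<Sum>k\<in>{\<mu>} \<times> {\<nu>} \<times> ?P. ?l k)"
      using F_support by (intro sum.mono_neutral_cong_right) (auto simp: finite_partitions)
    finally show ?thesis .
  qed
  also have "\<dots> = (\<Sum>\<tau>\<in>?P. ?l (\<mu>, \<nu>, \<tau>))"
    by (rule sum.reindex_bij_witness[where i = "\<lambda>\<tau>. (\<mu>, \<nu>, \<tau>)" and j = "snd \<circ> snd"]) auto
  also have "\<dots> = (\<Sum>\<rho>\<in>?P. 1 / jack_inner (J \<rho>) (J \<rho>) * (c \<rho> \<mu> * c \<rho> \<nu> * (\<Sum>\<tau>\<in>?P. c \<rho> \<tau>)))"
    unfolding lookup_F by (subst sum.swap) (simp add: sum_distrib_left mult.assoc)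
  finally show ?thesis unfolding J_sum_at_one .
qed

lemma F_0: "F 0 = 1"
proof (rule poly_mapping_eqI)
  fix k :: "nat multiset \<times> nat multiset \<times> nat multiset"
  obtain \<mu> \<nu> \<tau> where k: "k = (\<mu>, \<nu>, \<tau>)" by (cases k)
  have P: "partitions 0 = {{#}}"
  proof -
    have "\<mu> = {#}" if "0 \<notin># \<mu>" "sum_mset \<mu> = 0" for \<mu> :: "nat multiset"
      using size_le_sum[OF that(1)] that(2) by (metis le_zero_eq size_eq_0_iff_empty)
    then show ?thesis by (auto simp: partitions_def)
  qed
  have c1: "c {#} {#} = 1" using J_ones[of "{#}" 0] P by simp
  have "jack_inner (J {#}) (J {#}) = 1"
    using inner_partitions[of "{#}" 0 "J {#}"] by (simp add: P c1 Z_def z_part_def)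
  then have l: "Poly_Mapping.lookup (F 0) (\<mu>, \<nu>, \<tau>) = c {#} \<mu> * c {#} \<nu> * c {#} \<tau>"
    by (simp add: lookup_F P)
  have "c {#} \<kappa> = (if \<kappa> = {#} then 1 else 0)" for \<kappa>
    using c1 c_zero[of "{#}" 0 \<kappa>] P by auto
  then show "Poly_Mapping.lookup (F 0) k = Poly_Mapping.lookup 1 k"
    unfolding k l by (auto simp: lookup_one when_def zero_prod_def)
qed

text \<open>By \<open>formal_log_deriv\<close>, \<open>jack_series J\<close> times
  \<open>h_series J\<close> is \<alpha> t times the derivative of \<open>jack_series J\<close>. As
  \<open>F 0 = 1\<close>, coefficient m can be solved for \<open>h m\<close>.\<close>

lemma h_recursion:
  "h m = const3 (a * of_nat m) * F m - (\<Sum>i = 1..m. F i * h (m - i))"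
proof -
  have "jack_series J * h_series J = fps_const (const3 a) * (fps_X * fps_deriv (jack_series J))"
    unfolding h_series_def formal_log_deriv[OF F_0, symmetric] by (simp only: mult_ac)
  then have "fps_nth (jack_series J * h_series J) m = const3 a * (of_nat m * F m)"
    by (simp add: fps_X_mult_nth)
  moreover have "fps_nth (jack_series J * h_series J) m = (\<Sum>i = 0..m. F i * h (m - i))"
    by (rule fps_mult_nth)
  moreover have "\<dots> = h m + (\<Sum>i = 1..m. F i * h (m - i))"
    by (subst sum.atLeast_Suc_atMost) (simp_all add: F_0)
  ultimately have "h m + (\<Sum>i = 1..m. F i * h (m - i)) = const3 a * of_nat m * F m"
    by (simp add: mult.assoc)
  then show ?thesis unfolding const3_mult const3_of_nat by (simp add: eq_diff_eq)
qed

lemma h_graded: "z_graded m (h m)"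
proof (induction m rule: less_induct)
  case (less m)
  have "z_graded m (F i * h (m - i))" if "i \<in> {1..m}" for i
    using z_graded_mult[OF F_graded[of i] less.IH[of "m - i"]] that by simp
  then show ?case
    by (subst h_recursion) (intro z_graded_diff z_graded_const F_graded z_graded_sum)
qed

lemma h_coeff_sum:
  "(\<Sum>\<tau>\<in>partitions n. h_coeff J \<mu> \<nu> \<tau>) = specialise (h n) (\<mu>, \<nu>)"
proof -
  let ?P = "partitions n"
  let ?l = "\<lambda>k. Poly_Mapping.lookup (h n) k"
  have "specialise (h n) (\<mu>, \<nu>) = (\<Sum>k\<in>Poly_Mapping.keys (h n) \<union> {\<mu>} \<times> {\<nu>} \<times> ?P.
      if (fst k, fst (snd k)) = (\<mu>, \<nu>) then ?l k else 0)"
    by (rule specialise_superset) (auto simp: finite_partitions in_keys_iff)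
  also have "\<dots> = (\<Sum>k\<in>{\<mu>} \<times> {\<nu>} \<times> ?P. ?l k)"
    using h_graded[of n] unfolding z_graded_def
    by (intro sum.mono_neutral_cong_right) (auto simp: finite_partitions)
  also have "\<dots> = (\<Sum>\<tau>\<in>?P. ?l (\<mu>, \<nu>, \<tau>))"
    by (rule sum.reindex_bij_witness[where i = "\<lambda>\<tau>. (\<mu>, \<nu>, \<tau>)" and j = "snd \<circ> snd"]) auto
  finally show ?thesis by (simp add: h_coeff_def partitions_def)
qed

end

section \<open>Comparison of the specialised h with the series of maps\<close>

locale jack_recursion = jack_family J + degree_recursion w jack_alpha
  for J :: "nat multiset \<Rightarrow> symfun" and w :: "nat \<Rightarrow> scalar pair_fun"
begin

lemma specialise_F_V: "specialise (F n) x = (if sum_mset (fst x) = n then V 0 x else 0)"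
proof -
  obtain \<mu> \<nu> where x: "x = (\<mu>, \<nu>)" by (cases x)
  have "g n \<kappa> = (if sum_mset \<kappa> = n then wt \<kappa> else 0)" for \<kappa>
    by (auto simp: g_def wt_def Z_def partitions_def)
  then show ?thesis unfolding x specialise_F by (auto simp: V_def)
qed

lemma V_0_nonzero: "sum_mset (fst y) = 0 \<Longrightarrow> V 0 y = (if y = 0 then 1 else 0)"
proof -
  assume y: "sum_mset (fst y) = 0"
  obtain \<mu> \<nu> where p: "y = (\<mu>, \<nu>)" by (cases y)
  have empty: "\<kappa> = {#}" if "0 \<notin># \<kappa>" "sum_mset \<kappa> = 0" for \<kappa> :: "nat multiset"
    using size_le_sum[OF that(1)] that(2) by (metis le_zero_eq size_eq_0_iff_empty)
  have "wt {#} = 1" by (simp add: wt_def z_part_def)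
  then show ?thesis
    using y empty[of \<mu>] empty[of \<nu>] unfolding p by (auto simp: V_def zero_prod_def wt_def)
qed

text \<open>Under specialisation \<open>F\<close> becomes \<open>V 0\<close>, graded by the black
  degree, so \<open>h_recursion\<close> turns into the recursion that \<open>conv_total\<close>
  gives for \<open>total\<close>.\<close>

lemma specialise_h: "specialise (h m) x = (if sum_mset (fst x) = m then total x else 0)"
proof (induction m arbitrary: x rule: less_induct)
  case (less m)
  let ?d = "\<lambda>y :: nat multiset \<times> nat multiset. sum_mset (fst y)"
  have const: "specialise (const3 y * f) x = y * specialise f x" for y f
    by (subst specialise_superset[of "Poly_Mapping.keys f"])
      (auto simp: lookup_const3_mult in_keys_iff specialise_def sum_distrib_left intro!: sum.cong)
  have prod: "specialise (F i * h (m - i)) x =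
      (\<Sum>p\<in>psplits x. if ?d (fst p) = i \<and> ?d x = m then V 0 (fst p) * total (snd p) else 0)"
    if i: "i \<in> {1..m}" for i
  proof -
    have "specialise (h (m - i)) z = (if ?d z = m - i then total z else 0)" for z
      using i by (intro less.IH) auto
    then have "specialise (F i * h (m - i)) x =
        (\<Sum>p\<in>psplits x. (if ?d (fst p) = i then V 0 (fst p) else 0) * (if ?d (snd p) = m - i then total (snd p) else 0))"
      by (simp add: specialise_mult conv_def split_def specialise_F_V)
    also have "\<dots> = (\<Sum>p\<in>psplits x. if ?d (fst p) = i \<and> ?d x = m then V 0 (fst p) * total (snd p) else 0)"
    proof (rule sum.cong[OF refl])
      fix p assume "p \<in> psplits x"
      then have "?d x = ?d (fst p) + ?d (snd p)" by (auto simp: psplits_def)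
      then show "(if ?d (fst p) = i then V 0 (fst p) else 0) * (if ?d (snd p) = m - i then total (snd p) else 0) =
          (if ?d (fst p) = i \<and> ?d x = m then V 0 (fst p) * total (snd p) else 0)"
        using i by auto
    qed
    finally show ?thesis .
  qed
  have h: "specialise (h m) x = a * of_nat m * specialise (F m) x - (\<Sum>i = 1..m. specialise (F i * h (m - i)) x)"
    by (subst h_recursion) (simp only: specialise_diff specialise_sum const)
  show ?case
  proof (cases "?d x = m")
    case False
    then have "specialise (F i * h (m - i)) x = 0" if "i \<in> {1..m}" for i using prod[OF that] by simp
    then show ?thesis unfolding h using False by (simp add: specialise_F_V)
  next
    case True
    have "(\<Sum>i = 1..m. specialise (F i * h (m - i)) x) =
        (\<Sum>i = 1..m. \<Sum>p\<in>psplits x. if ?d (fst p) = i then V 0 (fst p) * total (snd p) else 0)"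
      using prod True by (intro sum.cong) auto
    also have "\<dots> = (\<Sum>p\<in>psplits x. \<Sum>i = 1..m. if ?d (fst p) = i then V 0 (fst p) * total (snd p) else 0)"
      by (rule sum.swap)
    \<comment> \<open>Summing over i \<ge> 1 omits the splittings whose first part has black degree
      0. Since \<open>V 0\<close> has constant term 1 and no other term of black degree 0, only
      \<open>total x\<close> is lost.\<close>
    also have "\<dots> = (\<Sum>p\<in>psplits x. V 0 (fst p) * total (snd p) - (if p = (0, x) then total x else 0))"
    proof (rule sum.cong[OF refl])
      fix p assume p: "p \<in> psplits x"
      then have le: "?d (fst p) \<le> m" and px: "fst p + snd p = x" using True by (auto simp: psplits_def)
      show "(\<Sum>i = 1..m. if ?d (fst p) = i then V 0 (fst p) * total (snd p) else 0) =
          V 0 (fst p) * total (snd p) - (if p = (0, x) then total x else 0)"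
      proof (cases "?d (fst p) = 0")
        case True
        have "p = (0, x) \<longleftrightarrow> fst p = 0" using px by (metis add_0 fst_conv prod.collapse)
        then show ?thesis using True px V_0_nonzero[OF True] by auto
      next
        case False
        then have "p \<noteq> (0, x)" by auto
        define d where "d = ?d (fst p)"
        have "1 \<le> d" "d \<le> m" using False le unfolding d_def by linarith+
        then show ?thesis unfolding d_def[symmetric] using \<open>p \<noteq> (0, x)\<close> by simp
      qed
    qed
    also have "\<dots> = conv (V 0) total x - total x"
    proof -
      have "(0, x) \<in> psplits x" by (simp add: psplits_def)
      then show ?thesis by (simp add: sum_subtractf conv_def split_def finite_psplits)
    qed
    also have "conv (V 0) total x = a * of_nat m * V 0 x"
      using conv_total[of x] True by (simp add: conv_commute)
    finally show ?thesis unfolding h using True by (simp add: specialise_F_V)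
  qed
qed

end

section \<open>Summing over the face degrees\<close>

definition face_type :: "flag_map \<Rightarrow> nat multiset" where
  "face_type M = image_mset (\<lambda>F. card F div 4) (mset_set (face_of M ` flags M))"

lemma sum_card_orbits:
  assumes "finite A" "free_involution A f" "free_involution A g"
  shows "(\<Sum>O'\<in>orbit f g ` A. card O') = card A"
proof -
  have "\<Union>(orbit f g ` A) = A"
    using orbit_in[OF assms(2,3)] orbit_self by blast
  moreover have "card (\<Union>(orbit f g ` A)) = (\<Sum>O'\<in>orbit f g ` A. card O')"
  proof (rule card_Union_disjoint)
    show "pairwise disjnt (orbit f g ` A)"
    proof (rule pairwiseI)
      fix U V assume "U \<in> orbit f g ` A" "V \<in> orbit f g ` A" "U \<noteq> V"
      then obtain x y where xy: "x \<in> A" "y \<in> A" "U = orbit f g x" "V = orbit f g y" by blast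
      show "disjnt U V" unfolding disjnt_iff
      proof (intro allI notI)
        fix z assume "z \<in> U \<and> z \<in> V"
        then show False
          using orbit_eq[OF assms(2,3) xy(1), of z] orbit_eq[OF assms(2,3) xy(2), of z] xy \<open>U \<noteq> V\<close> by simp
      qed
    qed
    show "finite U" if "U \<in> orbit f g ` A" for U
      using that orbit_in[OF assms(2,3)] assms(1) finite_subset by blast
  qed
  ultimately show ?thesis by simp
qed

context edged_map
begin

text \<open>\<open>far\<close> exchanges the black and the white flags of a face, and
  \<open>corner\<close> pairs the black ones.\<close>

lemma face_card:
  assumes x: "x \<in> A"
  shows "4 dvd card (face_of M x)" "0 < card (face_of M x)"
proof -
  let ?F = "face_of M x"
  have FA: "?F \<subseteq> A" unfolding face_of_def by (rule orbit_in[OF f_inv c_inv x])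
  have finF: "finite ?F" using FA fin finite_subset by blast
  have step: "f y \<in> ?F" "c y \<in> ?F" if "y \<in> ?F" for y
    using that unfolding face_of_def by (auto intro: orbit_step)
  let ?B = "{y \<in> ?F. b y}" and ?W = "{y \<in> ?F. \<not> b y}"
  have "even (card ?B)"
  proof (rule even_card_free_involution)
    show "free_involution ?B c" unfolding free_involution_def using step FA c b by auto
  qed (use finF in simp)
  moreover have "bij_betw f ?B ?W"
    by (rule bij_betw_byWitness[where f' = f]) (use step FA f b in auto)
  then have "card ?W = card ?B" by (simp add: bij_betw_same_card)
  moreover have "card ?F = card ?B + card ?W"
    using finF by (subst card_Un_disjoint[symmetric]) (auto intro: arg_cong[where f = card])
  ultimately show "4 dvd card ?F" by auto
  have "x \<in> ?F" by (simp add: face_of_def orbit_self)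
  then show "0 < card ?F" using finF card_gt_0_iff by blast
qed

lemma card_black: "card A = 2 * card {y \<in> A. b y}"
proof -
  let ?B = "{y \<in> A. b y}" and ?W = "{y \<in> A. \<not> b y}"
  have "bij_betw f ?B ?W"
    by (rule bij_betw_byWitness[where f' = f]) (use f b in auto)
  then have "card ?W = card ?B" by (simp add: bij_betw_same_card)
  moreover have "card A = card ?B + card ?W"
    using fin by (subst card_Un_disjoint[symmetric]) (auto intro: arg_cong[where f = card])
  ultimately show ?thesis by simp
qed

lemma sum_face_type: "4 * sum_mset (face_type M) = card A"
proof -
  have "4 * sum_mset (face_type M) = (\<Sum>F\<in>face_of M ` A. 4 * (card F div 4))"
    by (simp add: face_type_def sum_unfold_sum_mset[symmetric] sum_distrib_left)
  also have "\<dots> = (\<Sum>F\<in>face_of M ` A. card F)"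
    by (rule sum.cong[OF refl]) (use face_card(1) in auto)
  also have "\<dots> = card A"
    unfolding face_of_def using sum_card_orbits[OF fin f_inv c_inv] .
  finally show ?thesis .
qed

lemma sum_black_degrees: "4 * sum_mset (degrees_of (vertex_of M ` {y \<in> A. b y})) = card A"
proof -
  let ?B = "{y \<in> A. b y}"
  have inv: "free_involution ?B s" "free_involution ?B c"
    unfolding free_involution_def using s c b by auto
  have "2 * sum_mset (degrees_of (vertex_of M ` ?B)) = (\<Sum>V\<in>vertex_of M ` ?B. 2 * (card V div 2))"
    by (simp add: sum_unfold_sum_mset[symmetric] sum_distrib_left)
  also have "\<dots> = (\<Sum>V\<in>vertex_of M ` ?B. card V)"
    by (rule sum.cong[OF refl]) (use even_vertex in auto)
  also have "\<dots> = card ?B"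
    unfolding vertex_of_def using sum_card_orbits[OF _ inv] fin by simp
  finally show ?thesis using card_black by simp
qed

lemma degrees_of_black:
  assumes "profile M = (i, \<mu>, \<nu>)"
  shows "degrees_of (vertex_of M ` {y \<in> A. b y}) = add_mset i \<mu>" "0 < i"
proof -
  let ?S = "vertex_of M ` {y \<in> A. b y}"
  have "mset_set ?S = add_mset (vertex_of M r) (mset_set (?S - {vertex_of M r}))"
    by (rule mset_set.remove) (use fin r black in auto)
  then show "degrees_of ?S = add_mset i \<mu>" using assms profile_M by simp
  show "0 < i" using assms profile_M card_vertex_deleted(2)[of r] by auto
qed

text \<open>The parts of the face type and the black degrees both add up to a quarter of the number
  of flags, which is the number of edges.\<close>

lemma face_type_partition:
  assumes "profile M = (i, \<mu>, \<nu>)"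
  shows "face_type M \<in> partitions (i + sum_mset \<mu>)"
proof -
  have "4 * (i + sum_mset \<mu>) = 4 * sum_mset (face_type M)"
    using sum_black_degrees sum_face_type degrees_of_black(1)[OF assms] by simp
  moreover have "0 \<notin># face_type M"
  proof
    assume "0 \<in># face_type M"
    then obtain x where x: "x \<in> A" "card (face_of M x) div 4 = 0"
      using fin by (auto simp: face_type_def)
    then show False using face_card[OF x(1)] by (auto elim!: dvdE)
  qed
  ultimately show ?thesis by (simp add: partitions_def)
qed

lemma has_type_iff:
  "has_type M \<mu> \<nu> \<tau> \<longleftrightarrow> (\<exists>i \<mu>'. profile M = (i, \<mu>', \<nu>) \<and> \<mu> = add_mset i \<mu>') \<and> \<tau> = face_type M"
proof -
  have sets: "{x \<in> A. d x} = {x \<in> A. b x}" "{x \<in> A. \<not> d x} = {x \<in> A. \<not> b x}"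
    if "vertex_colouring M d" "d r" for d
    using colouring_unique[OF bip ne that] by auto
  obtain i \<mu>' \<nu>' where p: "profile M = (i, \<mu>', \<nu>')" by (cases "profile M")
  have W: "degrees_of (vertex_of M ` {y \<in> A. \<not> b y}) = \<nu>'" using p profile_M by simp
  have "has_type M \<mu> \<nu> \<tau> \<longleftrightarrow> \<mu> = add_mset i \<mu>' \<and> \<nu> = \<nu>' \<and> \<tau> = face_type M"
  proof
    assume "has_type M \<mu> \<nu> \<tau>"
    then obtain d where d: "vertex_colouring M d" "d r" "\<mu> = degrees_of (vertex_of M ` {x \<in> A. d x})"
      "\<nu> = degrees_of (vertex_of M ` {x \<in> A. \<not> d x})" "\<tau> = face_type M"
      unfolding has_type_def face_type_def by auto
    then show "\<mu> = add_mset i \<mu>' \<and> \<nu> = \<nu>' \<and> \<tau> = face_type M"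
      using sets[OF d(1,2)] degrees_of_black(1)[OF p] W by simp
  next
    assume "\<mu> = add_mset i \<mu>' \<and> \<nu> = \<nu>' \<and> \<tau> = face_type M"
    then show "has_type M \<mu> \<nu> \<tau>"
      unfolding has_type_def face_type_def using ne black degrees_of_black(1)[OF p] W
      by (intro conjI exI[of _ b]) simp_all
  qed
  then show ?thesis unfolding p by auto
qed

end

lemma (in iso_maps) face_type_iso: "face_type N = face_type M"
proof -
  let ?S = "face_of M ` flags M"
  have face: "face_of N (h x) = h ` face_of M x" if "x \<in> flags M" for x
    unfolding face_of_def by (rule h_orbit[OF that M.f_inv M.c_inv]) (use h in auto)
  have sub: "V \<subseteq> flags M" if "V \<in> ?S" for V
    using that orbit_in[OF M.f_inv M.c_inv] by (auto simp: face_of_def)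
  have inj: "inj_on ((`) h) ?S"
  proof (rule inj_onI)
    fix U V assume "U \<in> ?S" "V \<in> ?S" "h ` U = h ` V"
    then show "U = V" using inj_on_image_eq_iff[OF h_inj] sub by metis
  qed
  have "face_of N ` flags N = (`) h ` ?S"
    unfolding h_img[symmetric] using face by (auto simp: image_image)
  then have "mset_set (face_of N ` flags N) = image_mset ((`) h) (mset_set ?S)"
    using inj by (simp add: image_mset_mset_set)
  moreover have "image_mset (\<lambda>V. card (h ` V) div 4) (mset_set ?S) = face_type M"
    unfolding face_type_def
  proof (rule image_mset_cong)
    fix V assume "V \<in># mset_set ?S"
    then have "V \<subseteq> flags M" using sub M.fin by auto
    then show "card (h ` V) div 4 = card V div 4" using h_inj by (metis card_image inj_on_subset)
  qed
  ultimately show ?thesis by (simp add: face_type_def multiset.map_comp o_def)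
qed

lemma face_type_rep:
  assumes "bipartite_map M" "flags M \<noteq> {}" "X = abs_rooted_map M"
  shows "face_type (rep_rooted_map X) = face_type M"
proof -
  obtain h where "flag_iso h M (rep_rooted_map X)" unfolding assms(3) by (rule iso_rep[OF assms(1)])
  from iso_mapsI[OF assms(1) rep_bipartite this assms(2)] show ?thesis by (rule iso_maps.face_type_iso)
qed

lemma maps_of_typeD:
  assumes "X \<in> maps_of_type \<mu> \<nu> \<tau>"
  shows "face_type (rep_rooted_map X) = \<tau>"
    "\<exists>j. j + 1 \<in># \<mu> \<and> X \<in> maps_with (j + 1) (\<mu> - {#j + 1#}) \<nu>"
proof -
  obtain M where M: "bipartite_map M" "has_type M \<mu> \<nu> \<tau>" "X = abs_rooted_map M"
    using assms by (auto simp: maps_of_type_def)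
  have ne: "flags M \<noteq> {}" using M(2) by (simp add: has_type_def)
  interpret edged_map M using M(1) ne by unfold_locales
  obtain i \<mu>' where p: "profile M = (i, \<mu>', \<nu>)" "\<mu> = add_mset i \<mu>'" "\<tau> = face_type M"
    using M(2) has_type_iff by auto
  show "face_type (rep_rooted_map X) = \<tau>" using face_type_rep[OF M(1) ne M(3)] p(3) by simp
  obtain j where j: "i = j + 1" using degrees_of_black(2)[OF p(1)] by (metis Suc_eq_plus1 gr0_implies_Suc)
  have "degs X = (j + 1, \<mu> - {#j + 1#}, \<nu>)" using degs_abs[OF M(1)] M(3) p j by simp
  then show "\<exists>j. j + 1 \<in># \<mu> \<and> X \<in> maps_with (j + 1) (\<mu> - {#j + 1#}) \<nu>"
    using p(2) j by (auto simp: maps_with_def)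
qed

lemma maps_of_typeI:
  assumes "X \<in> maps_with (j + 1) (\<mu> - {#j + 1#}) \<nu>" "j + 1 \<in># \<mu>"
  shows "face_type (rep_rooted_map X) \<in> partitions (sum_mset \<mu>)"
    "X \<in> maps_of_type \<mu> \<nu> (face_type (rep_rooted_map X))"
proof -
  let ?M = "rep_rooted_map X"
  have p: "profile ?M = (j + 1, \<mu> - {#j + 1#}, \<nu>)" using assms(1) by (simp add: maps_with_def degs_def)
  interpret edged_map ?M using edged_rep[of X j] p by (simp add: degs_def)
  show "face_type ?M \<in> partitions (sum_mset \<mu>)"
    using face_type_partition[OF p] sum_mset_remove[OF assms(2)] by metis
  have "has_type ?M \<mu> \<nu> (face_type ?M)" unfolding has_type_iff using p assms(2) by simp
  then show "X \<in> maps_of_type \<mu> \<nu> (face_type ?M)"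
    unfolding maps_of_type_def using bip abs_rep[of X] by (intro image_eqI[of _ _ ?M]) auto
qed

text \<open>Summed over all \<tau>, the condition on the faces disappears, because the face type of
  each map is a partition of n. The maps are then regrouped by the degree j + 1 of the root
  vertex.\<close>

lemma sum_H_coeff:
  assumes \<eta>: "measure_of_non_orientability \<eta>" and n: "sum_mset \<mu> = n"
  shows "(\<Sum>\<tau>\<in>partitions n. H_coeff \<eta> \<mu> \<nu> \<tau> \<beta>) =
    (\<Sum>j | j + 1 \<in># \<mu>. degree_series \<eta> \<beta> (j + 1) (\<mu> - {#j + 1#}) \<nu>)"
proof -
  let ?J = "{j. j + 1 \<in># \<mu>}"
  let ?m = "\<lambda>j. maps_with (j + 1) (\<mu> - {#j + 1#}) \<nu>"
  have sub: "maps_of_type \<mu> \<nu> \<tau> \<subseteq> (\<Union>j\<in>?J. ?m j)" for \<tau> using maps_of_typeD(2) by blast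
  have fin: "finite (\<Union>j\<in>?J. ?m j)" using finite_far_parts finite_maps_with by blast
  have union: "(\<Union>\<tau>\<in>partitions n. maps_of_type \<mu> \<nu> \<tau>) = (\<Union>j\<in>?J. ?m j)"
  proof (intro subset_antisym subsetI)
    fix X assume "X \<in> (\<Union>\<tau>\<in>partitions n. maps_of_type \<mu> \<nu> \<tau>)"
    then show "X \<in> (\<Union>j\<in>?J. ?m j)" using sub by blast
  next
    fix X assume "X \<in> (\<Union>j\<in>?J. ?m j)"
    then obtain j where "X \<in> ?m j" "j + 1 \<in># \<mu>" by blast
    from maps_of_typeI[OF this] show "X \<in> (\<Union>\<tau>\<in>partitions n. maps_of_type \<mu> \<nu> \<tau>)"
      unfolding n by (rule UN_I)
  qed
  have "(\<Sum>\<tau>\<in>partitions n. H_coeff \<eta> \<mu> \<nu> \<tau> \<beta>) = (\<Sum>X\<in>(\<Union>\<tau>\<in>partitions n. maps_of_type \<mu> \<nu> \<tau>). \<beta> ^ \<eta> X)"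
    unfolding H_coeff_def
  proof (rule sum.UNION_disjoint[symmetric])
    show "\<forall>\<tau>\<in>partitions n. finite (maps_of_type \<mu> \<nu> \<tau>)" using fin sub finite_subset by blast
    show "\<forall>\<tau>\<in>partitions n. \<forall>\<sigma>\<in>partitions n. \<tau> \<noteq> \<sigma> \<longrightarrow> maps_of_type \<mu> \<nu> \<tau> \<inter> maps_of_type \<mu> \<nu> \<sigma> = {}"
      using maps_of_typeD(1) by blast
  qed (rule finite_partitions)
  also have "\<dots> = (\<Sum>j\<in>?J. \<Sum>X\<in>?m j. \<beta> ^ \<eta> X)"
    unfolding union
  proof (rule sum.UNION_disjoint)
    show "finite ?J" by (rule finite_far_parts)
    show "\<forall>j\<in>?J. finite (?m j)" using finite_maps_with by blast
    show "\<forall>i\<in>?J. \<forall>j\<in>?J. i \<noteq> j \<longrightarrow> ?m i \<inter> ?m j = {}" by (auto simp: maps_with_def)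
  qed
  finally show ?thesis by (simp add: degree_series_def[OF \<eta>])
qed

lemma conv_splits:
  "conv f g (\<mu>, \<nu>) = (\<Sum>((a, a'), (b, b')) \<in> splits \<mu> \<times> splits \<nu>. f (a, b) * g (a', b'))"
proof -
  have "conv f g (\<mu>, \<nu>) = (\<Sum>p\<in>psplits (\<mu>, \<nu>). f (fst p) * g (snd p))"
    by (simp add: conv_def split_def)
  also have "\<dots> = (\<Sum>x\<in>splits \<mu> \<times> splits \<nu>. (\<lambda>p. f (fst p) * g (snd p)) ((\<lambda>((a, a'), (b, b')). ((a, b), (a', b'))) x))"
    by (rule sum.reindex_bij_betw[OF psplits_bij, symmetric])
  finally show ?thesis by (simp add: split_def)
qed

theorem theorem4p2:
  fixes \<eta> :: "rooted_map \<Rightarrow> nat"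
    and J :: "nat multiset \<Rightarrow> symfun"
    and n :: nat
    and \<mu> \<nu> :: "nat multiset"
  assumes "is_jack_family J"
    and "measure_of_non_orientability \<eta>"
    and "n > 0"
    and "\<mu> \<in> partitions n"
    and "\<nu> \<in> partitions n"
  shows "(\<Sum>\<tau>\<in>partitions n. h_coeff J \<mu> \<nu> \<tau>)
         = (\<Sum>\<tau>\<in>partitions n. H_coeff \<eta> \<mu> \<nu> \<tau> (jack_alpha - 1))"
proof -
  define w where "w i x = degree_series \<eta> (jack_alpha - 1) i (fst x) (snd x)" for i x
  interpret jack_recursion J w
  proof unfold_locales
    show "is_jack_family J" by (rule assms(1))
    show "jack_alpha \<noteq> 0" using jack_alpha_pos by simp
    show "w 0 = (\<lambda>x. if x = 0 then 1 else 0)"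
      by (rule ext) (auto simp: w_def degree_series_0[OF assms(2)] zero_prod_def prod_eq_iff)
    fix i and x :: "nat multiset \<times> nat multiset"
    obtain \<mu> \<nu> where x: "x = (\<mu>, \<nu>)" by (cases x)
    have far: "far_series \<eta> (jack_alpha - 1) \<kappa> \<sigma> = (\<Sum>j | j + 1 \<in># \<sigma>. w j (\<sigma> - {#j + 1#}, \<kappa>))" for \<kappa> \<sigma>
      by (simp add: far_series_def[OF assms(2)] w_def)
    show "w (Suc i) x = conv (w i) (\<lambda>(\<mu>, \<nu>). \<Sum>j | j + 1 \<in># \<nu>. w j (\<nu> - {#j + 1#}, \<mu>)) x +
      (\<Sum>j\<in>shrinks (snd x). jack_alpha * of_nat (j * (count (snd x) j + 1)) *
         w i (fst x, add_mset j (snd x - {#j + 1#})))"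
      \<comment> \<open>At \<beta> = \<alpha> - 1 the factor 1 + \<beta> of
        \<open>degree_series_Suc\<close> is \<alpha>.\<close>
      unfolding x conv_splits prod.case far[symmetric] fst_conv snd_conv
      using degree_series_Suc[OF assms(2), of "jack_alpha - 1" i \<mu> \<nu>] by (simp add: w_def)
  qed
  have n: "sum_mset \<mu> = n" using assms(4) by (simp add: partitions_def)
  have "(\<Sum>\<tau>\<in>partitions n. h_coeff J \<mu> \<nu> \<tau>) = total (\<mu>, \<nu>)"
    unfolding h_coeff_sum specialise_h using n by simp
  also have "\<dots> = (\<Sum>\<tau>\<in>partitions n. H_coeff \<eta> \<mu> \<nu> \<tau> (jack_alpha - 1))"
    unfolding sum_H_coeff[OF assms(2) n] by (simp add: total_def w_def)
  finally show ?thesis .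
qed

end
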